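(* Let $K$ be a field, $A=K[X_1,\ldots,X_n]$, and let $I\subsetneq A$ be a universal squarefree lexsegment ideal (USLI) generated in degree $d$. Then the symmetric algebra $\mathrm{Sym}_A(I)$ of $I$ satisfies: (1) $\dim(\mathrm{Sym}_A(I))=n+1$; (2) $\mathrm{e}(\mathrm{Sym}_A(I))=|G(I)|$; (3) $\mathrm{reg}(\mathrm{Sym}_A(I))=1$; (4) $\mathrm{depth}(\mathrm{Sym}_A(I))=n+1$.
   Context: $A=K[X_1,\dots,X_n]$ is standard graded. For a monomial ideal $I$, $G(I)$ is its unique minimal set of monomial generators; $I$ is generated in degree $d$ ($d\ge1$) if $G(I)$ is nonempty and all its elements have degree $d$. For squarefree monomials of the same degree $u=X_{i_1}\cdots X_{i_d}$, $v=X_{j_1}\cdots X_{j_d}$ with $i_1<\cdots<i_d$ and $j_1<\cdots<j_d$, write $u>_{\mathrm{slex}}v$ if for some $1\le s\le d$ one has $i_1=j_1,\ldots,i_{s-1}=j_{s-1}$ and $i_s<j_s$. A monomial ideal $I\subsetneq A$ is a squarefree lexsegment ideal if it is generated by squarefree monomials and for all squarefree monomials $u\in I$ and all squarefree monomials $v\in A$ with $\deg u=\deg v$ and $v>_{\mathrm{slex}}u$ one has $v\in I$. For $m\ge1$ put $A_{[m]}=K[X_1,\ldots,X_n,X_{n+1},\ldots,X_{n+m}]$. A squarefree lexsegment ideal $I$ of $A$ is a universal squarefree lexsegment ideal (USLI) if for every integer $m\ge 1$ the ideal $IA_{[m]}$ is a squarefree lexsegment ideal of $A_{[m]}$. If $G(I)=\{f_1,\dots,f_q\}$,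 then $\mathrm{Sym}_A(I)=S/J$ with $S=K[X_1,\dots,X_n,T_1,\dots,T_q]$ and $J$ generated by the forms $\sum_i a_iT_i$ with $a_i\in A$, $\sum_i a_if_i=0$. Since the $f_i$ have the same degree, $J$ is homogeneous for the standard grading of $S$ (all $X_i$ and $T_j$ of degree $1$), and $\mathrm{Sym}_A(I)$ is regarded as the standard graded $K$-algebra $S/J$: $\dim$ is Krull dimension, $\mathrm{e}$ is the multiplicity of this standard graded algebra, $\mathrm{reg}$ is the Castelnuovo-Mumford regularity of $S/J$ as a graded $S$-module, and $\mathrm{depth}$ is the depth with respect to the graded maximal ideal.
   Formalization: Part (3), reg(Sym_A(I)) = 1, is stated only for |G(I)| ≥ 2; for principal I = (X_1⋯X_d) the symmetric algebra is a polynomial ring of regularity 0, so (3) fails there. *)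

theory Defs
  imports
    "HOL-Library.Poly_Mapping"
    "HOL-Library.Extended_Nat"
    "HOL-Library.Extended_Real"
    "HOL-Computational_Algebra.Polynomial"
    "HOL-Algebra.QuotRing"
    "HOL-Algebra.Module"
    "HOL-Algebra.Embedded_Algebras"
begin

section \<open>Polynomial rings in finitely many variables\<close>

text \<open>
  Monomials are exponent vectors, polynomials are finitely supported functions from monomials to
  the field.  The type has infinitely many variables; the ring \<open>K[Y\<^sub>1,\<dots>,Y\<^sub>N]\<close> is the subring of
  the polynomials in which only the variables with index in \<open>{1..N}\<close> occur.  In this way \<open>A\<close> is
  literally a subring of \<open>A\<^bsub>[m]\<^esub>\<close>.
\<close>

type_synonym pp = "nat \<Rightarrow>\<^sub>0 nat"
type_synonym 'k mpoly = "pp \<Rightarrow>\<^sub>0 'k"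

definition monomials :: "nat \<Rightarrow> pp set" where
  "monomials N = {m. Poly_Mapping.keys m \<subseteq> {1..N}}"

definition mdeg :: "pp \<Rightarrow> nat" where
  "mdeg m = (\<Sum>v\<in>Poly_Mapping.keys m. Poly_Mapping.lookup m v)"

definition mpmon :: "pp \<Rightarrow> 'k::field mpoly" where
  "mpmon m = Poly_Mapping.single m 1"

definition const :: "'k::field \<Rightarrow> 'k mpoly" where
  "const c = Poly_Mapping.single 0 c"

definition var :: "nat \<Rightarrow> 'k::field mpoly" where
  "var i = mpmon (Poly_Mapping.single i 1)"

definition PR :: "nat \<Rightarrow> 'k::field mpoly ring" where
  "PR N = \<lparr>carrier = {p. Poly_Mapping.keys p \<subseteq> monomials N}, monoid.mult = (*), one = 1, zero = 0, add = (+)\<rparr>"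

text \<open>The homogeneous component of degree \<open>j\<close>; it is \<open>{0}\<close> for negative \<open>j\<close>.\<close>

definition homog :: "nat \<Rightarrow> int \<Rightarrow> 'k::field mpoly set" where
  "homog N j = {p \<in> carrier (PR N). \<forall>m\<in>Poly_Mapping.keys p. int (mdeg m) = j}"

definition irrelevant_ideal :: "nat \<Rightarrow> 'k::field mpoly set" where
  "irrelevant_ideal N = Idl\<^bsub>PR N\<^esub> (var ` {1..N})"

section \<open>Universal squarefree lexsegment ideals\<close>

definition min_gens :: "nat \<Rightarrow> 'k::field mpoly set \<Rightarrow> pp set" where
  "min_gens n I = (THE M. M \<subseteq> monomials n \<and> Idl\<^bsub>PR n\<^esub> (mpmon ` M) = I \<and>
     (\<forall>M'. M' \<subset> M \<longrightarrow> Idl\<^bsub>PR n\<^esub> (mpmon ` M') \<noteq> I))"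

definition generated_in_degree :: "nat \<Rightarrow> 'k::field mpoly set \<Rightarrow> nat \<Rightarrow> bool" where
  "generated_in_degree n I d \<longleftrightarrow>
     d \<ge> 1 \<and> min_gens n I \<noteq> {} \<and> (\<forall>m\<in>min_gens n I. mdeg m = d)"

definition sqfree_monomials :: "nat \<Rightarrow> pp set" where
  "sqfree_monomials n = {m \<in> monomials n. \<forall>v. Poly_Mapping.lookup m v \<le> 1}"

text \<open>
  For a squarefree monomial, \<open>sorted_list_of_set (Poly_Mapping.keys u)\<close> is the sequence
  \<open>i\<^sub>1 < \<dots> < i\<^sub>d\<close> of the indices of its variables.
\<close>

definition slex_gt :: "pp \<Rightarrow> pp \<Rightarrow> bool" where
  "slex_gt u v \<longleftrightarrow>
     (let i = sorted_list_of_set (Poly_Mapping.keys u); j = sorted_list_of_set (Poly_Mapping.keys v) in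
      length i = length j \<and>
      (\<exists>s < length i. (\<forall>t < s. i ! t = j ! t) \<and> i ! s < j ! s))"

definition sqfree_lexsegment :: "nat \<Rightarrow> 'k::field mpoly set \<Rightarrow> bool" where
  "sqfree_lexsegment n I \<longleftrightarrow>
     I \<subset> carrier (PR n) \<and>
     (\<exists>M \<subseteq> sqfree_monomials n. I = Idl\<^bsub>PR n\<^esub> (mpmon ` M)) \<and>
     (\<forall>u\<in>sqfree_monomials n. \<forall>v\<in>sqfree_monomials n.
        mpmon u \<in> I \<and> mdeg u = mdeg v \<and> slex_gt v u \<longrightarrow> mpmon v \<in> I)"

definition USLI :: "nat \<Rightarrow> 'k::field mpoly set \<Rightarrow> bool" where
  "USLI n I \<longleftrightarrow> sqfree_lexsegment n I \<and>
     (\<forall>m\<ge>1. sqfree_lexsegment (n + m) (Idl\<^bsub>PR (n + m)\<^esub> I))"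

section \<open>The symmetric algebra\<close>

text \<open>
  The generators of the ideal are \<open>f 1, \<dots>, f q\<close>.  The ring
  \<open>S = K[X\<^sub>1,\<dots>,X\<^sub>n,T\<^sub>1,\<dots>,T\<^sub>q]\<close> is \<open>PR (n + q)\<close>, with \<open>T\<^sub>i\<close> the variable with index \<open>n + i\<close>.
\<close>

definition sym_ideal :: "nat \<Rightarrow> nat \<Rightarrow> (nat \<Rightarrow> 'k::field mpoly) \<Rightarrow> 'k mpoly set" where
  "sym_ideal n q f = Idl\<^bsub>PR (n + q)\<^esub>
     {(\<Sum>i=1..q. a i * var (n + i)) | a.
        (\<forall>i\<in>{1..q}. a i \<in> carrier (PR n)) \<and> (\<Sum>i=1..q. a i * f i) = 0}"

section \<open>Krull dimension and depth\<close>

text \<open>The supremum of the empty set is \<open>0\<close> in \<^typ>\<open>enat\<close>; it occurs only for the zero ring.\<close>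

definition krull_dim :: "('a, 'b) ring_scheme \<Rightarrow> enat" where
  "krull_dim R = Sup {enat k | k. \<exists>P. (\<forall>i\<le>k. primeideal (P i) R) \<and> (\<forall>i<k. P i \<subset> P (Suc i))}"

text \<open>
  For a commutative ring \<open>R\<close>: multiplication by \<open>xs ! i\<close> is injective on \<open>R / (xs ! 0, \<dots>, xs ! (i - 1))\<close>,
  and \<open>R / (xs)\<close> is nonzero.
\<close>

definition regular_sequence :: "('a, 'b) ring_scheme \<Rightarrow> 'a list \<Rightarrow> bool" where
  "regular_sequence R xs \<longleftrightarrow>
     set xs \<subseteq> carrier R \<and>
     (\<forall>i<length xs. \<forall>a\<in>carrier R.
        xs ! i \<otimes>\<^bsub>R\<^esub> a \<in> Idl\<^bsub>R\<^esub> (set (take i xs)) \<longrightarrow> a \<in> Idl\<^bsub>R\<^esub> (set (take i xs))) \<and>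
     Idl\<^bsub>R\<^esub> (set xs) \<noteq> carrier R"

definition depth :: "('a, 'b) ring_scheme \<Rightarrow> 'a set \<Rightarrow> enat" where
  "depth R \<mm> = Sup {enat (length xs) | xs. set xs \<subseteq> \<mm> \<and> regular_sequence R xs}"

section \<open>Hilbert function and multiplicity\<close>

text \<open>
  A standard graded \<open>k\<close>-algebra is given by the ring \<open>R\<close>, the subfield \<open>k\<close> and the family \<open>C\<close> of
  its homogeneous components.
\<close>

definition hilbert_fun :: "('a, 'b) ring_scheme \<Rightarrow> 'a set \<Rightarrow> (nat \<Rightarrow> 'a set) \<Rightarrow> nat \<Rightarrow> nat" where
  "hilbert_fun R k C i = (THE r. ring.dimension R r k (C i))"

definition hilbert_poly :: "('a, 'b) ring_scheme \<Rightarrow> 'a set \<Rightarrow> (nat \<Rightarrow> 'a set) \<Rightarrow> rat poly" where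
  "hilbert_poly R k C =
     (THE p. \<forall>\<^sub>F i in sequentially. of_nat (hilbert_fun R k C i) = poly p (of_nat i))"

definition multiplicity :: "('a, 'b) ring_scheme \<Rightarrow> 'a set \<Rightarrow> (nat \<Rightarrow> 'a set) \<Rightarrow> rat" where
  "multiplicity R k C =
     (let D = the_enat (krull_dim R) in
      if D = 0 then of_nat (\<Sum>i | hilbert_fun R k C i \<noteq> 0. hilbert_fun R k C i)
      else fact (D - 1) * Polynomial.coeff (hilbert_poly R k C) (D - 1))"

section \<open>Castelnuovo--Mumford regularity\<close>

text \<open>
  A minimal graded free resolution
  \<open>\<dots> \<rightarrow> F\<^sub>2 \<rightarrow> F\<^sub>1 \<rightarrow> F\<^sub>0 \<rightarrow> M \<rightarrow> 0\<close> over \<open>S = PR N\<close> of a module \<open>M\<close> with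
  homogeneous components \<open>C j\<close>.  Here \<open>F\<^sub>i\<close> is the direct sum of the \<open>S(-a i ! k)\<close>, \<open>k < length (a i)\<close>;
  \<open>e k \<in> M\<close> is the image of the \<open>k\<close>-th basis element of \<open>F\<^sub>0\<close>, and \<open>D i\<close> is the matrix
  (rows indexed by the basis of \<open>F\<^sub>i\<close>) of the map \<open>F\<^bsub>i+1\<^esub> \<rightarrow> F\<^sub>i\<close>.  Finite resolutions
  are those with \<open>a i = []\<close> for large \<open>i\<close>.
\<close>

definition min_graded_free_resolution ::
  "nat \<Rightarrow> ('k::field mpoly, 'm, 'x) module_scheme \<Rightarrow> (int \<Rightarrow> 'm set) \<Rightarrow>
     (nat \<Rightarrow> int list) \<Rightarrow> (nat \<Rightarrow> 'm) \<Rightarrow> (nat \<Rightarrow> nat \<Rightarrow> nat \<Rightarrow> 'k mpoly) \<Rightarrow> bool" where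
  "min_graded_free_resolution N M C a e D \<longleftrightarrow>
     (let r = (\<lambda>i. length (a i));
          free = (\<lambda>i. {..<r i} \<rightarrow>\<^sub>E carrier (PR N));
          aug = (\<lambda>c. \<Oplus>\<^bsub>M\<^esub>k\<in>{..<r 0}. c k \<odot>\<^bsub>M\<^esub> e k);
          d = (\<lambda>i c. \<lambda>k\<in>{..<r i}. \<Sum>l<r (Suc i). D i k l * c l)
      in
        \<comment> \<open>all maps are homogeneous of degree 0\<close>
        (\<forall>k<r 0. e k \<in> C (a 0 ! k)) \<and>
        (\<forall>i. \<forall>k<r i. \<forall>l<r (Suc i). D i k l \<in> homog N (a (Suc i) ! l - a i ! k)) \<and>
        \<comment> \<open>exactness at \<open>M\<close>, at \<open>F\<^sub>0\<close> and at \<open>F\<^bsub>i+1\<^esub>\<close>\<close>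
        aug ` free 0 = carrier M \<and>
        {c \<in> free 0. aug c = \<zero>\<^bsub>M\<^esub>} = d 0 ` free 1 \<and>
        (\<forall>i. {c \<in> free (Suc i). d i c = (\<lambda>k\<in>{..<r i}. 0)} = d (Suc i) ` free (Suc (Suc i))) \<and>
        \<comment> \<open>minimality\<close>
        (\<forall>i. \<forall>k<r i. \<forall>l<r (Suc i). D i k l \<in> irrelevant_ideal N))"

text \<open>
  The supremum of \<open>b - i\<close> over the shifts \<open>b\<close> in homological degree \<open>i\<close> of a minimal graded free
  resolution; all minimal graded free resolutions of \<open>M\<close> have the same shifts.
\<close>

definition regularity ::
  "nat \<Rightarrow> ('k::field mpoly, 'm, 'x) module_scheme \<Rightarrow> (int \<Rightarrow> 'm set) \<Rightarrow> ereal" where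
  "regularity N M C = (THE \<rho>. \<exists>a e D. min_graded_free_resolution N M C a e D \<and>
     \<rho> = Sup {ereal (of_int (a i ! k - int i)) | i k. k < length (a i)})"

section \<open>The invariants of the graded algebra \<open>S / J\<close>\<close>

definition quot_module ::
  "nat \<Rightarrow> 'k::field mpoly set \<Rightarrow> ('k mpoly, 'k mpoly set) module" where
  "quot_module N J = ring.extend (PR N Quot J)
     (module.fields (\<lambda>s x. (J +>\<^bsub>PR N\<^esub> s) \<otimes>\<^bsub>PR N Quot J\<^esub> x))"

definition quot_comp :: "nat \<Rightarrow> 'k::field mpoly set \<Rightarrow> int \<Rightarrow> 'k mpoly set set" where
  "quot_comp N J j = (\<lambda>p. J +>\<^bsub>PR N\<^esub> p) ` homog N j"

definition quot_dim :: "nat \<Rightarrow> 'k::field mpoly set \<Rightarrow> enat" where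
  "quot_dim N J = krull_dim (PR N Quot J)"

definition quot_mult :: "nat \<Rightarrow> 'k::field mpoly set \<Rightarrow> rat" where
  "quot_mult N J = multiplicity (PR N Quot J) ((\<lambda>c. J +>\<^bsub>PR N\<^esub> const c) ` UNIV)
     (\<lambda>i. quot_comp N J (int i))"

definition quot_reg :: "nat \<Rightarrow> 'k::field mpoly set \<Rightarrow> ereal" where
  "quot_reg N J = regularity N (quot_module N J) (quot_comp N J)"

definition quot_depth :: "nat \<Rightarrow> 'k::field mpoly set \<Rightarrow> enat" where
  "quot_depth N J = depth (PR N Quot J) ((\<lambda>p. J +>\<^bsub>PR N\<^esub> p) ` irrelevant_ideal N)"

end

theory Submission
  imports Defs
begin

text \<open>
  Comparing a generator \<open>u\<close> with \<open>X\<^sub>1 \<cdots> X\<^bsub>d-1\<^esub>X\<^bsub>n+1\<^esub>\<close> in \<open>A\<^bsub>[1]\<^esub>\<close> shows that a USLI generated in degree \<open>d\<close> has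
  generators \<open>f\<^sub>i = X\<^sub>1 \<cdots> X\<^bsub>d-1\<^esub> y\<^sub>i\<close> with distinct variables \<open>y\<^sub>1, \<dots>, y\<^sub>q\<close>.  Hence \<open>J\<close> is the ideal of
  \<open>2\<close>-minors of the matrix with rows \<open>y\<close> and \<open>T\<close>, and it is the kernel of the monomial map
  \<open>X\<^sub>v \<mapsto> X\<^sub>v\<close>, \<open>T\<^sub>i \<mapsto> y\<^sub>i t\<close> to \<open>A[t]\<close>.

  Upper bounds for dimension and depth: if \<open>x\<^sub>1, \<dots>, x\<^sub>r\<close> are successively nonzerodivisors modulo an
  ascending chain of ideals over \<open>J\<close>, each lying in the next ideal, then the monomials in the \<open>x\<^sub>i\<close> are
  linearly independent modulo \<open>J\<close>; counting those with bounded exponents inside \<open>A[t]\<close> gives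
  \<open>r \<le> n + 1\<close>.  A chain of primes is obtained by setting the variables of \<open>A[t]\<close> to \<open>1\<close> one at a time,
  and a regular sequence from the linear forms \<open>y\<^bsub>i+1\<^esub> - T\<^sub>i\<close> (and
  \<open>X\<^sub>v - T\<^sub>q\<close> for the variables \<open>X\<^sub>v\<close> not among the \<open>y\<^sub>i\<close>), which degenerate the image ring step by
  step to that of \<open>y\<^sub>i \<mapsto> y\<^sub>1 t\<^bsup>i-1\<^esup>\<close>, followed by \<open>y\<^sub>1\<close> and \<open>T\<^sub>q\<close>.  The Hilbert function
  counts the monomials \<open>\<alpha> t\<^sup>b\<close> with \<open>\<alpha>\<close> of degree \<open>i\<close> in \<open>A\<close> and \<open>b \<le> c\<close>, where \<open>c\<close> is the degree of \<open>\<alpha>\<close> in the \<open>y\<^sub>k\<close>.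

  For the regularity, the minors admit a Stanley decomposition of \<open>J\<close> with linear rewriting rules
  that decrease a weight.  The rewriting rules generate the syzygies and again have these properties, so
  all matrices of the resolution after the first are linear.  Any other minimal resolution is
  linear in the same way because two minimal covers of a module differ by an invertible scalar matrix.
\<close>

section \<open>Polynomials\<close>

text \<open>With a single generator J is zero and the quotient is a polynomial ring of regularity 0,
  so the regularity clause concerns at least two generators. \<open>regularity\<close> is a definite
  description over all minimal resolutions, so besides one linear resolution the shifts of every
  other one must be determined. A coinductive notion of linear resolution treats all homological
  degrees at once, because the syzygies of a Stanley system form another such system. The obstacle
  for the depth is to recognise the quotient after each linear form. Each form identifies two
  variables in such a way that the quotient is again a monomial subring, cut out by one linear
  inequality on exponents; this inequality is what shows that dividing by the binomial image of the
  form does not leave the subring. After n - 1 forms the ring is spanned by the monomials y_1^a t^b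
  with b at most q a, the cone over the rational normal curve of degree q. The last two elements map
  to the ends y_1 and y_1 t^q of its degree one part.\<close>

abbreviation lookup where "lookup \<equiv> Poly_Mapping.lookup"
abbreviation keys where "keys \<equiv> Poly_Mapping.keys"
abbreviation single where "single \<equiv> Poly_Mapping.single"

lemma lookup_single_if: "lookup (single a b) c = (if a = c then b else 0)"
  by (simp add: lookup_single when_def)

lemma keys_plus_pp: "keys (a + b :: pp) = keys a \<union> keys b"
  by (auto simp: in_keys_iff lookup_add)

lemma monomials_add [simp]: "a + b \<in> monomials N \<longleftrightarrow> a \<in> monomials N \<and> b \<in> monomials N"
  by (auto simp: monomials_def keys_plus_pp)

lemma monomials_0 [simp]: "0 \<in> monomials N"
  by (simp add: monomials_def)

lemma monomials_mono: "N \<le> N' \<Longrightarrow> monomials N \<subseteq> monomials N'"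
  by (force simp: monomials_def)

lemma monomials_single: "1 \<le> v \<Longrightarrow> v \<le> N \<Longrightarrow> single v k \<in> monomials N"
  by (auto simp: monomials_def)

lemma mdeg_superset: "finite V \<Longrightarrow> keys m \<subseteq> V \<Longrightarrow> mdeg m = (\<Sum>v\<in>V. lookup m v)"
  unfolding mdeg_def by (intro sum.mono_neutral_left) (auto simp: in_keys_iff)

lemma mdeg_monomials: "m \<in> monomials N \<Longrightarrow> mdeg m = (\<Sum>v=1..N. lookup m v)"
  by (rule mdeg_superset) (auto simp: monomials_def)

lemma mdeg_add [simp]: "mdeg (a + b) = mdeg a + mdeg b"
  unfolding mdeg_def by (rule setsum_keys_plus_distrib) auto

lemma mdeg_0 [simp]: "mdeg 0 = 0"
  by (simp add: mdeg_def)

lemma mdeg_single [simp]: "mdeg (single v k) = k"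
  by (cases "k = 0") (auto simp: mdeg_def)

lemma mdeg_sum: "mdeg (sum f A) = (\<Sum>x\<in>A. mdeg (f x))"
  by (induction A rule: infinite_finite_induct) auto

lemma mdeg_eq_0_iff [simp]: "mdeg m = 0 \<longleftrightarrow> m = 0"
  by (auto simp: mdeg_def in_keys_iff poly_mapping_eq_iff fun_eq_iff)

lemma pp_split:
  assumes "lookup m v > 0"
  obtains m' :: pp where "m = single v 1 + m'"
proof
  show "m = single v 1 + (m - single v 1)"
    using assms by (intro poly_mapping_eqI) (auto simp: lookup_add lookup_minus lookup_single when_def)
qed

section \<open>The polynomial ring and its ideals\<close>

lemma PR_carrier: "p \<in> carrier (PR N) \<longleftrightarrow> keys p \<subseteq> monomials N"
  by (simp add: PR_def)

lemma PR_simps [simp]: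
  "mult (PR N) = (*)" "one (PR N) = 1" "zero (PR N) = 0" "add (PR N) = (+)"
  by (simp_all add: PR_def)

lemma PR_carrier_mono: "N \<le> N' \<Longrightarrow> p \<in> carrier (PR N) \<Longrightarrow> p \<in> carrier (PR N')"
  using monomials_mono by (auto simp: PR_carrier)

lemma PR_add: "p \<in> carrier (PR N) \<Longrightarrow> r \<in> carrier (PR N) \<Longrightarrow> p + r \<in> carrier (PR N)"
  using keys_add[of p r] by (auto simp: PR_carrier)

lemma PR_uminus: "p \<in> carrier (PR N) \<Longrightarrow> - p \<in> carrier (PR N)"
  by (auto simp: PR_carrier in_keys_iff)

lemma PR_diff: "p \<in> carrier (PR N) \<Longrightarrow> r \<in> carrier (PR N) \<Longrightarrow> p - r \<in> carrier (PR N)"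
  using PR_add[of p N "- r"] PR_uminus[of r N] by simp

lemma PR_mult: "p \<in> carrier (PR N) \<Longrightarrow> r \<in> carrier (PR N) \<Longrightarrow> p * r \<in> carrier (PR N)"
  using keys_mult[of p r] by (fastforce simp: PR_carrier)

lemma PR_0: "0 \<in> carrier (PR N)" and PR_1: "1 \<in> carrier (PR N)"
  by (auto simp: PR_carrier)

lemma PR_sum: "(\<And>x. x \<in> A \<Longrightarrow> f x \<in> carrier (PR N)) \<Longrightarrow> sum f A \<in> carrier (PR N)"
proof (induction A rule: infinite_finite_induct)
  case (insert x F)
  then show ?case using PR_add[of "f x" N "sum f F"] by simp
qed (auto simp: PR_carrier)

lemma PR_single: "m \<in> monomials N \<Longrightarrow> single m c \<in> carrier (PR N)"
  by (auto simp: PR_carrier keys_single split: if_splits)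

lemma PR_const: "const c \<in> carrier (PR N)"
  unfolding const_def by (rule PR_single) simp

lemma PR_mpmon: "m \<in> monomials N \<Longrightarrow> mpmon m \<in> carrier (PR N)"
  unfolding mpmon_def by (rule PR_single)

lemma PR_var: "1 \<le> v \<Longrightarrow> v \<le> N \<Longrightarrow> var v \<in> carrier (PR N)"
  unfolding var_def by (rule PR_mpmon) (simp add: monomials_single)

lemma PR_power: "p \<in> carrier (PR N) \<Longrightarrow> p ^ k \<in> carrier (PR N)"
proof (induction k)
  case (Suc k)
  then show ?case using PR_mult[of p N "p ^ k"] by simp
qed (auto simp: PR_carrier)

lemmas PR_closed = PR_add PR_uminus PR_diff PR_mult PR_0 PR_1

lemma cring_PR: "cring (PR N)"
proof (rule cringI)
  show "abelian_group (PR N)"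
  proof (rule abelian_groupI)
    fix x assume "x \<in> carrier (PR N)"
    then show "\<exists>y\<in>carrier (PR N). y \<oplus>\<^bsub>PR N\<^esub> x = \<zero>\<^bsub>PR N\<^esub>"
      using PR_uminus[of x N] by (intro bexI[of _ "- x"]) auto
  qed (use PR_closed in \<open>auto simp: algebra_simps\<close>)
  show "comm_monoid (PR N)"
    by (rule comm_monoidI) (use PR_closed in \<open>auto simp: algebra_simps\<close>)
qed (auto simp: algebra_simps)

lemma ring_PR: "ring (PR N)"
  using cring_PR by (rule cring.axioms)

lemma ideal_PR_iff:
  "ideal I (PR N) \<longleftrightarrow> I \<subseteq> carrier (PR N) \<and> 0 \<in> I \<and> (\<forall>a\<in>I. \<forall>b\<in>I. a + b \<in> I) \<and>
     (\<forall>a\<in>I. \<forall>x\<in>carrier (PR N). x * a \<in> I)"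
proof (intro iffI conjI)
  assume I: "ideal I (PR N)"
  interpret ideal I "PR N" by (rule I)
  show "I \<subseteq> carrier (PR N)" by (rule a_subset)
  show "0 \<in> I" using additive_subgroup.zero_closed[OF is_additive_subgroup] by simp
  show "\<forall>a\<in>I. \<forall>b\<in>I. a + b \<in> I" using additive_subgroup.a_closed[OF is_additive_subgroup] by simp
  show "\<forall>a\<in>I. \<forall>x\<in>carrier (PR N). x * a \<in> I" using I_l_closed by simp
next
  assume I: "I \<subseteq> carrier (PR N) \<and> 0 \<in> I \<and> (\<forall>a\<in>I. \<forall>b\<in>I. a + b \<in> I) \<and>
     (\<forall>a\<in>I. \<forall>x\<in>carrier (PR N). x * a \<in> I)"
  then have um: "- a \<in> I" if "a \<in> I" for a
    using I that PR_uminus[OF PR_1[of N]] by (metis mult_minus1)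
  interpret ring "PR N" by (rule ring_PR)
  have inv: "\<ominus>\<^bsub>PR N\<^esub> a = - a" if "a \<in> carrier (PR N)" for a
    by (rule minus_equality) (use that PR_uminus in \<open>auto\<close>)
  have inv': "inv\<^bsub>add_monoid (PR N)\<^esub> a \<in> I" if "a \<in> I" for a
  proof -
    have "inv\<^bsub>add_monoid (PR N)\<^esub> a = - a" using inv[of a] I that by (auto simp: a_inv_def)
    then show ?thesis using um[OF that] by simp
  qed
  show "ideal I (PR N)"
  proof (rule idealI[OF ring_PR])
    show "subgroup I (add_monoid (PR N))"
      by (rule subgroup.intro) (use I inv' in auto)
  qed (use I in \<open>auto simp: mult.commute\<close>)
qed

context
  fixes I and N :: nat
  assumes I: "ideal I (PR N :: 'k::field mpoly ring)"
begin

lemma ideal_PR_carrier: "a \<in> I \<Longrightarrow> a \<in> carrier (PR N)"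
  using I unfolding ideal_PR_iff by blast

lemma ideal_PR_0: "0 \<in> I"
  using I unfolding ideal_PR_iff by blast

lemma ideal_PR_add: "a \<in> I \<Longrightarrow> b \<in> I \<Longrightarrow> a + b \<in> I"
  using I unfolding ideal_PR_iff by blast

lemma ideal_PR_mult: "a \<in> I \<Longrightarrow> x \<in> carrier (PR N) \<Longrightarrow> x * a \<in> I"
  using I unfolding ideal_PR_iff by blast

lemma ideal_PR_uminus: "a \<in> I \<Longrightarrow> - a \<in> I"
  using ideal_PR_mult[of a "- 1"] PR_uminus[OF PR_1[of N]] by simp

lemma ideal_PR_diff: "a \<in> I \<Longrightarrow> b \<in> I \<Longrightarrow> a - b \<in> I"
  using ideal_PR_add[of a "- b"] ideal_PR_uminus[of b] by simp

lemma ideal_PR_sum: "(\<And>x. x \<in> A \<Longrightarrow> f x \<in> I) \<Longrightarrow> sum f A \<in> I"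
  by (induction A rule: infinite_finite_induct) (auto intro: ideal_PR_0 ideal_PR_add)

end

lemma Idl_PR_ideal: "F \<subseteq> carrier (PR N) \<Longrightarrow> ideal (Idl\<^bsub>PR N\<^esub> F) (PR N)"
  by (rule ring.genideal_ideal[OF ring_PR])

lemma Idl_PR_self: "F \<subseteq> carrier (PR N) \<Longrightarrow> a \<in> F \<Longrightarrow> a \<in> Idl\<^bsub>PR N\<^esub> F"
  using ring.genideal_self[OF ring_PR] by blast

lemma Idl_PR_minimal: "ideal I (PR N) \<Longrightarrow> F \<subseteq> I \<Longrightarrow> Idl\<^bsub>PR N\<^esub> F \<subseteq> I"
  by (rule ring.genideal_minimal[OF ring_PR])

lemma mpoly_expand: "(p :: 'k::field mpoly) = (\<Sum>m\<in>keys p. single m (lookup p m))"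
proof (rule poly_mapping_eqI)
  fix k
  have "lookup (\<Sum>m\<in>keys p. single m (lookup p m)) k = (\<Sum>m\<in>keys p. if m = k then lookup p k else 0)"
    unfolding lookup_sum by (intro sum.cong) (auto simp: lookup_single when_def)
  also have "\<dots> = lookup p k"
    by (simp add: in_keys_iff)
  finally show "lookup p k = lookup (\<Sum>m\<in>keys p. single m (lookup p m)) k" ..
qed

lemma mpoly_induct [case_names zero single add]:
  fixes p :: "'k::field mpoly"
  assumes "P 0" "\<And>m c. m \<in> keys p \<Longrightarrow> P (single m c)" "\<And>a b. P a \<Longrightarrow> P b \<Longrightarrow> P (a + b)"
  shows "P p"
proof -
  have "P (\<Sum>m\<in>A. single m (lookup p m))" if "A \<subseteq> keys p" for A
    using finite_subset[OF that finite_keys] that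
    by (induction A rule: finite_induct) (auto intro: assms)
  then show ?thesis using mpoly_expand[of p] by (metis order_refl)
qed

lemma lookup_single_mult [simp]: "lookup (single m c * (p :: 'k::field mpoly)) (m + k) = c * lookup p k"
proof (induction p rule: mpoly_induct)
  case (add a b)
  then show ?case by (simp add: distrib_left lookup_add)
qed (auto simp: mult_single lookup_single when_def)

lemma keys_single_mult: "keys (single m c * (p :: 'k::field mpoly)) \<subseteq> (+) m ` keys p"
  using keys_mult[of "single m c" p] by (auto simp: keys_single split: if_splits)

lemma lookup_single_mult_0: "(\<And>k'. k \<noteq> m + k') \<Longrightarrow> lookup (single m c * (p :: 'k::field mpoly)) k = 0"
  using keys_single_mult[of m c p] by (metis imageE in_keys_iff subsetD)

lemma const_simps: "const 0 = 0" "const 1 = 1" "const (a + b) = const a + const b" "const (a * b) = const a * const b"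
  "const (- a) = - const a" "const (a - b) = const a - const b"
  by (simp_all add: const_def single_add mult_single single_uminus single_diff)

lemma single_eq_const_mult: "single m c = const c * mpmon m"
  by (simp add: const_def mpmon_def mult_single)

lemma mpmon_add: "mpmon (a + b) = mpmon a * mpmon b"
  by (simp add: mpmon_def mult_single)

lemma mpmon_0 [simp]: "mpmon 0 = 1"
  by (simp add: mpmon_def)

lemma mpmon_nonzero [simp]: "mpmon a \<noteq> 0"
  by (metis lookup_single_eq lookup_zero mpmon_def zero_neq_one)

lemma mpmon_eq_iff [simp]: "(mpmon a :: 'k::field mpoly) = mpmon b \<longleftrightarrow> a = b"
proof
  assume "(mpmon a :: 'k mpoly) = mpmon b"
  then have "keys (mpmon a :: 'k mpoly) = keys (mpmon b :: 'k mpoly)" by simp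
  then show "a = b" by (simp add: mpmon_def)
qed simp

lemma keys_mpmon [simp]: "keys (mpmon m :: 'k::field mpoly) = {m}"
  by (simp add: mpmon_def)

text \<open>The exponent 0 is a sum of exponents in only one way. Constant coefficients therefore
  multiply, which drives every minimality argument below.\<close>

lemma lookup_mult_0:
  "lookup ((p :: 'k::field mpoly) * r) 0 = lookup p 0 * lookup r 0"
proof (induction p rule: mpoly_induct)
  case (single m c)
  show ?case
  proof (cases "m = 0")
    case False
    then have "lookup (single m c * r) 0 = 0"
      by (intro lookup_single_mult_0) (metis add_eq_0_iff_both_eq_0 mdeg_add mdeg_eq_0_iff)
    then show ?thesis using False by (simp add: lookup_single)
  qed (use lookup_single_mult[of 0 c r 0] in simp)
qed (auto simp: lookup_add distrib_right)

section \<open>Homogeneous components and the graded maximal ideal\<close>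

lemma homog_iff: "p \<in> homog N j \<longleftrightarrow> keys p \<subseteq> monomials N \<and> (\<forall>m\<in>keys p. int (mdeg m) = j)"
  by (simp add: homog_def PR_carrier)

lemma homog_carrier: "p \<in> homog N j \<Longrightarrow> p \<in> carrier (PR N)"
  by (simp add: homog_def)

lemma homog_0 [simp]: "0 \<in> homog N j"
  by (simp add: homog_iff)

lemma homog_add: "p \<in> homog N j \<Longrightarrow> r \<in> homog N j \<Longrightarrow> p + r \<in> homog N j"
  unfolding homog_iff using keys_add[of p r] by blast

lemma homog_uminus: "p \<in> homog N j \<Longrightarrow> - p \<in> homog N j"
  by (auto simp: homog_iff in_keys_iff)

lemma homog_diff: "p \<in> homog N j \<Longrightarrow> r \<in> homog N j \<Longrightarrow> p - r \<in> homog N j"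
  using homog_add[of p N j "- r"] homog_uminus[of r N j] by simp

lemma homog_sum: "(\<And>x. x \<in> A \<Longrightarrow> f x \<in> homog N j) \<Longrightarrow> sum f A \<in> homog N j"
  by (induction A rule: infinite_finite_induct) (auto intro: homog_add)

lemma homog_mult: "p \<in> homog N i \<Longrightarrow> r \<in> homog N j \<Longrightarrow> p * r \<in> homog N (i + j)"
  unfolding homog_iff using keys_mult[of p r] by fastforce

lemma homog_single: "m \<in> monomials N \<Longrightarrow> int (mdeg m) = j \<Longrightarrow> single m c \<in> homog N j"
  by (auto simp: homog_iff keys_single split: if_splits)

lemma homog_mpmon: "m \<in> monomials N \<Longrightarrow> int (mdeg m) = j \<Longrightarrow> mpmon m \<in> homog N j"
  unfolding mpmon_def by (rule homog_single)

lemma homog_var: "1 \<le> v \<Longrightarrow> v \<le> N \<Longrightarrow> var v \<in> homog N 1"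
  unfolding var_def by (rule homog_mpmon) (simp_all add: monomials_single)

lemma homog_const: "const c \<in> homog N 0"
  unfolding const_def by (rule homog_single) simp_all

lemma homog_neg: "p \<in> homog N j \<Longrightarrow> j < 0 \<Longrightarrow> p = 0"
  using keys_eq_empty by (fastforce simp: homog_iff)

lemma homog_0D:
  assumes "p \<in> homog N 0" shows "p = const (lookup p 0)"
proof -
  have "keys p \<subseteq> {0}" using assms by (auto simp: homog_iff)
  then show ?thesis
    by (intro poly_mapping_eqI) (auto simp: const_def lookup_single when_def in_keys_iff)
qed

definition hcomp :: "int \<Rightarrow> 'k::field mpoly \<Rightarrow> 'k mpoly" where
  "hcomp j p = (\<Sum>m\<in>{m \<in> keys p. int (mdeg m) = j}. single m (lookup p m))"

lemma lookup_hcomp: "lookup (hcomp j p) m = (if int (mdeg m) = j then lookup p m else 0)"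
proof -
  have "lookup (hcomp j p) m =
      (\<Sum>k\<in>{k \<in> keys p. int (mdeg k) = j}. if k = m then lookup p m else 0)"
    unfolding hcomp_def lookup_sum by (intro sum.cong) (auto simp: lookup_single when_def)
  also have "\<dots> = (if int (mdeg m) = j then lookup p m else 0)"
    by (auto simp: in_keys_iff)
  finally show ?thesis .
qed

lemma hcomp_add: "hcomp j (p + r) = hcomp j p + hcomp j r"
  by (intro poly_mapping_eqI) (simp add: lookup_hcomp lookup_add)

lemma hcomp_0 [simp]: "hcomp j 0 = 0"
  by (simp add: hcomp_def)

lemma hcomp_sum: "hcomp j (sum f A) = (\<Sum>x\<in>A. hcomp j (f x))"
  by (induction A rule: infinite_finite_induct) (auto simp: hcomp_add)

lemma hcomp_homog: "p \<in> carrier (PR N) \<Longrightarrow> hcomp j p \<in> homog N j"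
  by (auto simp: homog_iff PR_carrier in_keys_iff lookup_hcomp subset_iff split: if_splits)

lemma hcomp_same: "p \<in> homog N j \<Longrightarrow> hcomp j p = p"
  by (intro poly_mapping_eqI) (auto simp: lookup_hcomp homog_iff in_keys_iff)

lemma hcomp_mult_homog:
  assumes "r \<in> homog N i"
  shows "hcomp j (p * r) = hcomp (j - i) p * r"
proof -
  have "hcomp j (single m c * r) = hcomp (j - i) (single m c) * r" for m c
  proof (cases "int (mdeg m) = j - i")
    case True
    then have "hcomp (j - i) (single m c) = single m c"
      by (intro poly_mapping_eqI) (auto simp: lookup_hcomp lookup_single when_def)
    moreover have "hcomp j (single m c * r) = single m c * r"
    proof (rule poly_mapping_eqI)
      fix k
      show "lookup (hcomp j (single m c * r)) k = lookup (single m c * r) k"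
        using keys_single_mult[of m c r] assms True
        by (auto simp: lookup_hcomp in_keys_iff homog_iff subset_iff image_iff)
    qed
    ultimately show ?thesis by simp
  next
    case False
    then have "hcomp (j - i) (single m c) = 0"
      by (intro poly_mapping_eqI) (auto simp: lookup_hcomp lookup_single when_def)
    moreover have "hcomp j (single m c * r) = 0"
    proof (rule poly_mapping_eqI)
      fix k
      show "lookup (hcomp j (single m c * r)) k = lookup 0 k"
        using keys_single_mult[of m c r] assms False
        by (auto simp: lookup_hcomp in_keys_iff homog_iff subset_iff image_iff)
    qed
    ultimately show ?thesis by simp
  qed
  then show ?thesis
    by (induction p rule: mpoly_induct) (auto simp: hcomp_add distrib_right)
qed

text \<open>Turns minimality of a resolution into the vanishing of the constant coefficients of its
  matrices.\<close>

lemma irrelevant_ideal_eq: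
  "irrelevant_ideal N = {p \<in> carrier (PR N :: 'k::field mpoly ring). lookup p 0 = 0}" (is "_ = ?M")
proof
  have id: "ideal ?M (PR N :: 'k mpoly ring)"
    unfolding ideal_PR_iff using PR_add[of _ N] PR_mult[of _ N] PR_0[of N] by (auto simp: lookup_add lookup_mult_0)
  have "var ` {1..N} \<subseteq> ?M"
  proof
    fix x :: "'k mpoly" assume "x \<in> var ` {1..N}"
    then obtain v where v: "x = var v" "1 \<le> v" "v \<le> N" by auto
    have "lookup x 0 = 0"
      using v by (metis keys_mpmon lookup_not_eq_zero_eq_in_keys mdeg_0 mdeg_single singletonD var_def zero_neq_one)
    then show "x \<in> ?M" using v PR_var[of v N] by auto
  qed
  then show "irrelevant_ideal N \<subseteq> ?M"
    unfolding irrelevant_ideal_def by (rule Idl_PR_minimal[OF id])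
  have vc: "var ` {1..N} \<subseteq> carrier (PR N :: 'k mpoly ring)" using PR_var by fastforce
  have I: "ideal (irrelevant_ideal N) (PR N :: 'k mpoly ring)"
    unfolding irrelevant_ideal_def by (rule Idl_PR_ideal[OF vc])
  show "?M \<subseteq> irrelevant_ideal N"
  proof
    fix p assume p: "p \<in> ?M"
    have "single m (lookup p m) \<in> irrelevant_ideal N" if m: "m \<in> keys p" for m
    proof -
      have "m \<noteq> 0" using p m by (auto simp: in_keys_iff)
      then obtain v where v: "v \<in> keys m" using keys_eq_empty by (metis all_not_in_conv mdeg_def mdeg_eq_0_iff sum.empty)
      then obtain m' where m': "m = single v 1 + m'" using pp_split[of m v] by (auto simp: in_keys_iff)
      have mm: "m \<in> monomials N" using p m by (auto simp: PR_carrier)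
      then have v1: "v \<in> {1..N}" using v by (auto simp: monomials_def)
      have "single m' (lookup p m) * var v \<in> irrelevant_ideal N"
        by (rule ideal_PR_mult[OF I])
          (use v1 vc mm m' in \<open>auto simp: irrelevant_ideal_def intro!: Idl_PR_self PR_single\<close>)
      then show ?thesis by (simp add: var_def mpmon_def mult_single m' add.commute)
    qed
    then show "p \<in> irrelevant_ideal N"
      using ideal_PR_sum[OF I, of "keys p"] mpoly_expand[of p] by metis
  qed
qed

section \<open>Monomial substitutions\<close>

text \<open>The action of a monomial substitution on exponents. The factor
  \<open>of_nat (lookup m v)\<close> is taken in the convolution semiring of exponent vectors, where
  a natural number acts by repeated addition.\<close>

definition mext :: "(nat \<Rightarrow> pp) \<Rightarrow> pp \<Rightarrow> pp" where
  "mext g m = (\<Sum>v\<in>keys m. of_nat (lookup m v) * g v)"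

lemma mext_0 [simp]: "mext g 0 = 0"
  by (simp add: mext_def)

lemma mext_add: "mext g (a + b) = mext g a + mext g b"
  unfolding mext_def by (rule setsum_keys_plus_distrib) (auto simp: algebra_simps)

lemma mext_single: "mext g (single v k) = of_nat k * g v"
  by (cases "k = 0") (auto simp: mext_def)

lemma mext_single_1 [simp]: "mext g (single v 1) = g v" "mext g (single v (Suc 0)) = g v"
  by (simp_all add: mext_single)

lemma lookup_of_nat_mult_pp [simp]: "lookup (of_nat k * (p :: pp)) w = k * lookup p w"
  by (induction k) (auto simp: distrib_right lookup_add)

text \<open>The inclusion of keys in the step case keeps assumptions about the support of
  \<open>m\<close> available during the induction.\<close>

lemma pp_induct [case_names zero add]:
  fixes m :: pp
  assumes "P 0" "\<And>v m'. P m' \<Longrightarrow> keys (single v 1 + m') \<subseteq> keys m \<Longrightarrow> P (single v 1 + m')"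
  shows "P m"
proof -
  have "P k" if "keys k \<subseteq> keys m" for k
    using that
  proof (induction "mdeg k" arbitrary: k)
    case (Suc d)
    then have "k \<noteq> 0" by auto
    then obtain v where v: "v \<in> keys k" using keys_eq_empty
      by (metis all_not_in_conv mdeg_def mdeg_eq_0_iff sum.empty)
    then obtain k' where k': "k = single v 1 + k'" using pp_split[of k v] by (auto simp: in_keys_iff)
    then have "P k'" using Suc by (auto simp: keys_plus_pp)
    then show ?case using assms(2) k' Suc(3) by simp
  qed (auto intro: assms)
  then show ?thesis by simp
qed

lemma mext_cong: "(\<And>v. v \<in> keys m \<Longrightarrow> g v = h v) \<Longrightarrow> mext g m = mext h m"
  unfolding mext_def by (rule sum.cong) auto

lemma mext_mext: "mext g (mext h m) = mext (\<lambda>v. mext g (h v)) m"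
  by (induction m rule: pp_induct) (auto simp: mext_add)

lemma mext_id: "mext (\<lambda>v. single v 1) m = m"
  by (induction m rule: pp_induct) (auto simp: mext_add)

lemma mext_monomials: "(\<And>v. v \<in> keys m \<Longrightarrow> g v \<in> monomials N) \<Longrightarrow> mext g m \<in> monomials N"
  by (induction m rule: pp_induct) (auto simp: mext_add keys_plus_pp subset_iff)

section \<open>Monomial ring maps and their kernels\<close>

definition psub :: "(nat \<Rightarrow> pp) \<Rightarrow> 'k::field mpoly \<Rightarrow> 'k mpoly" where
  "psub g p = (\<Sum>m\<in>keys p. single (mext g m) (lookup p m))"

lemma psub_0 [simp]: "psub g 0 = 0"
  by (simp add: psub_def)

lemma psub_add: "psub g (p + r) = psub g p + psub g r"
  unfolding psub_def by (rule setsum_keys_plus_distrib) (auto simp: single_add)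

lemma psub_single: "psub g (single m c) = single (mext g m) c"
  by (cases "c = 0") (auto simp: psub_def)

lemma psub_mpmon: "psub g (mpmon m) = mpmon (mext g m)"
  by (simp add: mpmon_def psub_single)

lemma psub_var [simp]: "psub g (var v) = mpmon (g v)"
  by (simp add: var_def psub_mpmon)

lemma psub_1 [simp]: "psub g 1 = 1"
  using psub_mpmon[of g 0] by simp

lemma psub_uminus: "psub g (- p) = - psub g p"
  using psub_add[of g p "- p"] by (simp add: eq_neg_iff_add_eq_0 add.commute)

lemma psub_diff: "psub g (p - r) = psub g p - psub g r"
  using psub_add[of g p "- r"] psub_uminus[of g r] by simp

lemma psub_sum: "psub g (sum f A) = (\<Sum>x\<in>A. psub g (f x))"
  by (induction A rule: infinite_finite_induct) (auto simp: psub_add)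

lemma psub_mult: "psub g (p * r) = psub g p * psub g (r :: 'k::field mpoly)"
proof (induction p rule: mpoly_induct)
  case (single m c)
  show ?case
    by (induction r rule: mpoly_induct)
      (auto simp: mult_single psub_single mext_add distrib_left psub_add)
qed (auto simp: psub_add distrib_right)

lemma psub_psub: "psub g (psub h p) = psub (\<lambda>v. mext g (h v)) (p :: 'k::field mpoly)"
  by (induction p rule: mpoly_induct) (auto simp: psub_add psub_single mext_mext)

lemma psub_cong:
  assumes "\<And>m v. m \<in> keys p \<Longrightarrow> v \<in> keys m \<Longrightarrow> g v = h v"
  shows "psub g p = psub h (p :: 'k::field mpoly)"
  unfolding psub_def using assms by (intro sum.cong refl arg_cong2[where f = single] mext_cong) auto

lemma psub_id:
  assumes "\<And>m v. m \<in> keys p \<Longrightarrow> v \<in> keys m \<Longrightarrow> g v = single v 1"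
  shows "psub g p = (p :: 'k::field mpoly)"
proof -
  have "psub g p = psub (\<lambda>v. single v 1) p" by (rule psub_cong) (use assms in auto)
  also have "\<dots> = p" using mext_id by (simp add: psub_def flip: mpoly_expand)
  finally show ?thesis .
qed

lemma psub_carrier:
  assumes "\<And>v. v \<in> {1..N} \<Longrightarrow> g v \<in> monomials N'" "p \<in> carrier (PR N)"
  shows "psub g p \<in> carrier (PR N')"
  unfolding psub_def
  by (intro PR_sum PR_single mext_monomials) (use assms in \<open>auto simp: PR_carrier monomials_def subset_iff\<close>)

lemma keys_psub: "keys (psub g p) \<subseteq> mext g ` keys p"
  unfolding psub_def using keys_sum[of "\<lambda>m. single (mext g m) (lookup p m)" "keys p"]
  by (fastforce simp: keys_single split: if_splits)

text \<open>The toric ideal of the monomial map given by \<open>g\<close>.\<close>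

definition pker :: "nat \<Rightarrow> (nat \<Rightarrow> pp) \<Rightarrow> 'k::field mpoly set" where
  "pker N g = {p \<in> carrier (PR N). psub g p = 0}"

text \<open>The quotient by the kernel embeds into a polynomial ring, which is a domain.\<close>

lemma pker_prime: "primeideal (pker N g) (PR N :: 'k::field mpoly ring)"
proof (rule primeidealI)
  show "ideal (pker N g) (PR N :: 'k mpoly ring)"
    unfolding ideal_PR_iff pker_def using PR_closed(1,4,5)
    by (auto simp: psub_add psub_mult)
  show "cring (PR N :: 'k mpoly ring)" by (rule cring_PR)
  have "1 \<notin> pker N g" by (simp add: pker_def)
  then show "carrier (PR N :: 'k mpoly ring) \<noteq> pker N g"
    using PR_1[of N] by (metis (no_types))
qed (auto simp: pker_def psub_mult)

lemma pker_ideal: "ideal (pker N g) (PR N :: 'k::field mpoly ring)"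
  using pker_prime by (rule primeideal.axioms)

section \<open>Linear syzygies\<close>

definition weight :: "(nat \<Rightarrow> nat) \<Rightarrow> pp \<Rightarrow> nat" where
  "weight wt m = (\<Sum>v\<in>keys m. lookup m v * wt v)"

lemma weight_add [simp]: "weight wt (a + b) = weight wt a + weight wt b"
  unfolding weight_def by (rule setsum_keys_plus_distrib) (auto simp: algebra_simps)

lemma weight_single [simp]: "weight wt (single v k) = k * wt v"
  by (cases "k = 0") (auto simp: weight_def)

lemma weight_scale: "weight (\<lambda>v. M * wt v) m = M * weight wt m"
  by (auto simp: weight_def sum_distrib_left algebra_simps)

lemma sum_assoc:
  fixes a :: "nat \<Rightarrow> 'a::comm_ring_1"
  shows "(\<Sum>i<p. a i * (\<Sum>j<q. b i j * c j)) = (\<Sum>j<q. (\<Sum>i<p. a i * b i j) * c j)"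
  unfolding sum_distrib_left sum_distrib_right by (subst sum.swap) (simp add: mult.assoc)

text \<open>
  The columns \<open>E l\<close> generate a module that is the direct sum of the \<open>E l \<cdot> K[variables not in L l]\<close>:
  \<open>rewrite\<close> moves the variables in \<open>L l\<close> away from \<open>E l\<close>, and its weight condition makes the rewriting
  terminate.
\<close>

locale stanley_gens =
  fixes N r m :: nat and \<delta> :: int and E :: "nat \<Rightarrow> nat \<Rightarrow> 'k::field mpoly"
    and L :: "nat \<Rightarrow> nat list" and wt \<omega> :: "nat \<Rightarrow> nat"
  assumes E_homog: "k < r \<Longrightarrow> l < m \<Longrightarrow> E k l \<in> homog N \<delta>"
    and L_vars: "l < m \<Longrightarrow> set (L l) \<subseteq> {1..N}"
    and L_distinct: "l < m \<Longrightarrow> distinct (L l)"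
    and rewrite: "l < m \<Longrightarrow> x \<in> set (L l) \<Longrightarrow>
      \<exists>c. (\<forall>k<m. c k \<in> homog N 1 \<and> (\<forall>u\<in>keys (c k). weight wt u + \<omega> k < wt x + \<omega> l)) \<and>
          (\<forall>i<r. var x * E i l = (\<Sum>k<m. E i k * c k))"
    and indep: "(\<And>l. l < m \<Longrightarrow> s l \<in> carrier (PR N)) \<Longrightarrow>
      (\<And>l u. l < m \<Longrightarrow> u \<in> keys (s l) \<Longrightarrow> keys u \<inter> set (L l) = {}) \<Longrightarrow>
      (\<And>i. i < r \<Longrightarrow> (\<Sum>l<m. E i l * s l) = 0) \<Longrightarrow> l < m \<Longrightarrow> s l = 0"
begin

text \<open>One pair for each generator and each position in its list of forbidden variables. The
  pairs index the rewriting rules, and hence the generators of the syzygy module.\<close>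

definition pairs :: "(nat \<times> nat) set" where
  "pairs = (SIGMA l:{..<m}. {..<length (L l)})"

definition vr :: "nat \<times> nat \<Rightarrow> nat" where
  "vr \<pi> = L (fst \<pi>) ! snd \<pi>"

definition C :: "nat \<times> nat \<Rightarrow> nat \<Rightarrow> 'k mpoly" where
  "C \<pi> = (SOME c. (\<forall>k<m. c k \<in> homog N 1 \<and> (\<forall>u\<in>keys (c k). weight wt u + \<omega> k < wt (vr \<pi>) + \<omega> (fst \<pi>))) \<and>
          (\<forall>i<r. var (vr \<pi>) * E i (fst \<pi>) = (\<Sum>k<m. E i k * c k)))"

text \<open>The rewriting rule of the pair read as a syzygy of the columns \<open>E l\<close>, with
  all terms on one side.\<close>

definition g :: "nat \<times> nat \<Rightarrow> nat \<Rightarrow> 'k mpoly" where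
  "g \<pi> k = (if k = fst \<pi> then var (vr \<pi>) else 0) - C \<pi> k"

lemma finite_pairs [simp]: "finite pairs"
  by (simp add: pairs_def)

lemma vr_in: "\<pi> \<in> pairs \<Longrightarrow> fst \<pi> < m \<and> vr \<pi> \<in> set (L (fst \<pi>)) \<and> vr \<pi> \<in> {1..N}"
  using L_vars[of "fst \<pi>"] nth_mem[of "snd \<pi>" "L (fst \<pi>)"] by (force simp: pairs_def vr_def)

lemma C_props:
  assumes "\<pi> \<in> pairs"
  shows "k < m \<Longrightarrow> C \<pi> k \<in> homog N 1"
    and "k < m \<Longrightarrow> u \<in> keys (C \<pi> k) \<Longrightarrow> weight wt u + \<omega> k < wt (vr \<pi>) + \<omega> (fst \<pi>)"
    and "i < r \<Longrightarrow> var (vr \<pi>) * E i (fst \<pi>) = (\<Sum>k<m. E i k * C \<pi> k)"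
proof -
  have "(\<forall>k<m. C \<pi> k \<in> homog N 1 \<and> (\<forall>u\<in>keys (C \<pi> k). weight wt u + \<omega> k < wt (vr \<pi>) + \<omega> (fst \<pi>))) \<and>
          (\<forall>i<r. var (vr \<pi>) * E i (fst \<pi>) = (\<Sum>k<m. E i k * C \<pi> k))"
    using someI_ex[OF rewrite[of "fst \<pi>" "vr \<pi>"]] vr_in[OF assms] unfolding C_def by blast
  then show "k < m \<Longrightarrow> C \<pi> k \<in> homog N 1"
    and "k < m \<Longrightarrow> u \<in> keys (C \<pi> k) \<Longrightarrow> weight wt u + \<omega> k < wt (vr \<pi>) + \<omega> (fst \<pi>)"
    and "i < r \<Longrightarrow> var (vr \<pi>) * E i (fst \<pi>) = (\<Sum>k<m. E i k * C \<pi> k)"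
    by auto
qed

lemma var_vr: "\<pi> \<in> pairs \<Longrightarrow> var (vr \<pi>) \<in> homog N 1"
  using vr_in[of \<pi>] by (intro homog_var) auto

lemma g_homog: "\<pi> \<in> pairs \<Longrightarrow> k < m \<Longrightarrow> g \<pi> k \<in> homog N 1"
  unfolding g_def by (intro homog_diff C_props) (auto intro: var_vr)

lemma g_carrier: "\<pi> \<in> pairs \<Longrightarrow> k < m \<Longrightarrow> g \<pi> k \<in> carrier (PR N)"
  using g_homog homog_carrier by blast

lemma g_syzygy:
  assumes "\<pi> \<in> pairs" "i < r"
  shows "(\<Sum>k<m. E i k * g \<pi> k) = 0"
proof -
  have "(\<Sum>k<m. E i k * g \<pi> k) =
      (\<Sum>k<m. if k = fst \<pi> then E i k * var (vr \<pi>) else 0) - (\<Sum>k<m. E i k * C \<pi> k)"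
    unfolding sum_subtractf[symmetric] by (intro sum.cong) (auto simp: g_def algebra_simps)
  also have "(\<Sum>k<m. if k = fst \<pi> then E i k * var (vr \<pi>) else 0) = var (vr \<pi>) * E i (fst \<pi>)"
    using vr_in[OF assms(1)] by (simp add: mult.commute)
  finally show ?thesis using C_props(3)[OF assms] by simp
qed

text \<open>Separates the leading contributions, which in row \<open>k\<close> come only from the
  pairs over \<open>k\<close>, from the contributions of \<open>C\<close>, which have smaller
  weight.\<close>

lemma sum_g:
  assumes "k < m"
  shows "(\<Sum>\<pi>\<in>pairs. g \<pi> k * d \<pi>) =
    (\<Sum>j<length (L k). var (L k ! j) * d (k, j)) - (\<Sum>\<pi>\<in>pairs. C \<pi> k * d \<pi>)"
proof -
  have "(\<Sum>\<pi>\<in>pairs. (if k = fst \<pi> then var (vr \<pi>) else 0) * d \<pi>) =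
      (\<Sum>l<m. \<Sum>j<length (L l). (if k = l then var (L l ! j) else 0) * d (l, j))"
    unfolding pairs_def by (subst sum.Sigma) (auto simp: vr_def intro: sum.cong)
  also have "\<dots> = (\<Sum>l<m. if k = l then (\<Sum>j<length (L l). var (L l ! j) * d (l, j)) else 0)"
    by (intro sum.cong) auto
  also have "\<dots> = (\<Sum>j<length (L k). var (L k ! j) * d (k, j))"
    using assms by simp
  finally show ?thesis by (simp add: g_def left_diff_distrib sum_subtractf)
qed

text \<open>Taking the first forbidden variable that divides \<open>u\<close> assigns each reducible
  term to exactly one pair, so that a round of rewriting treats it once.\<close>

definition fi :: "nat \<Rightarrow> pp \<Rightarrow> nat" where
  "fi l u = (LEAST j. j < length (L l) \<and> L l ! j \<in> keys u)"

lemma fi: "keys u \<inter> set (L l) \<noteq> {} \<Longrightarrow> fi l u < length (L l) \<and> L l ! fi l u \<in> keys u"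
  unfolding fi_def by (rule LeastI_ex) (auto simp: in_set_conv_nth)

text \<open>Induction on the strict weight bound \<open>W\<close>. One round of rewriting replaces
  all reducible terms by terms of strictly smaller weight, so the new vector satisfies the bound for
  the predecessor of \<open>W\<close>. The bound on the coefficients \<open>d\<close> is carried
  along because it becomes the weight condition for the next syzygy module.\<close>

lemma normal_form:
  assumes "\<And>k. k < m \<Longrightarrow> s k \<in> carrier (PR N)"
    and "\<And>k u. k < m \<Longrightarrow> u \<in> keys (s k) \<Longrightarrow> weight wt u + \<omega> k < W"
  shows "\<exists>d. (\<forall>\<pi>\<in>pairs. d \<pi> \<in> carrier (PR N) \<and> (\<forall>v\<in>keys (d \<pi>). weight wt v + wt (vr \<pi>) + \<omega> (fst \<pi>) < W)) \<and>
    (\<forall>k<m. \<forall>u\<in>keys (s k - (\<Sum>\<pi>\<in>pairs. g \<pi> k * d \<pi>)). keys u \<inter> set (L k) = {})"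
  using assms
proof (induction W arbitrary: s)
  case 0
  then have "s k = 0" if "k < m" for k
    using that keys_eq_empty by (metis all_not_in_conv not_less0)
  then show ?case by (intro exI[of _ "\<lambda>_. 0"]) (auto simp: PR_0)
next
  case (Suc W)
  define NS where "NS k = {u \<in> keys (s k). keys u \<inter> set (L k) \<noteq> {}}" for k
  \<comment> \<open>The reducible terms assigned to the pair, each divided by the variable of the
    pair.\<close>
  define d1 where "d1 \<pi> = (\<Sum>u\<in>{u \<in> NS (fst \<pi>). fi (fst \<pi>) u = snd \<pi>}.
    single (u - single (vr \<pi>) 1) (lookup (s (fst \<pi>)) u))" for \<pi>
  have finNS [simp]: "finite (NS k)" for k by (simp add: NS_def)
  have split: "u = single (vr \<pi>) 1 + (u - single (vr \<pi>) 1)"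
    if "u \<in> NS (fst \<pi>)" "fi (fst \<pi>) u = snd \<pi>" for \<pi> u
  proof -
    have "vr \<pi> \<in> keys u" using that fi[of u "fst \<pi>"] by (auto simp: NS_def vr_def)
    then show ?thesis
      by (intro poly_mapping_eqI) (auto simp: lookup_add lookup_minus lookup_single when_def in_keys_iff)
  qed
  have d1_carrier: "d1 \<pi> \<in> carrier (PR N)" if "\<pi> \<in> pairs" for \<pi>
    unfolding d1_def
  proof (intro PR_sum PR_single)
    fix u assume u: "u \<in> {u \<in> NS (fst \<pi>). fi (fst \<pi>) u = snd \<pi>}"
    have "u \<in> monomials N" using u Suc(2)[of "fst \<pi>"] vr_in[OF that] by (auto simp: NS_def PR_carrier)
    then show "u - single (vr \<pi>) 1 \<in> monomials N" using split[of u \<pi>] u monomials_add[of "single (vr \<pi>) 1" "u - single (vr \<pi>) 1" N] by auto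
  qed
  have d1_wt: "weight wt v + wt (vr \<pi>) + \<omega> (fst \<pi>) < Suc W" if \<pi>v: "\<pi> \<in> pairs" "v \<in> keys (d1 \<pi>)" for \<pi> v
  proof -
    obtain u where u: "u \<in> NS (fst \<pi>)" "fi (fst \<pi>) u = snd \<pi>" "v = u - single (vr \<pi>) 1"
      using \<pi>v(2) keys_sum unfolding d1_def
      by (fastforce simp: keys_single split: if_splits)
    have "weight wt u = wt (vr \<pi>) + weight wt v" using split[OF u(1,2)] u(3)
      by (metis mult_1 weight_add weight_single)
    then show ?thesis using u(1) Suc(3)[of "fst \<pi>" u] vr_in[OF \<pi>v(1)] by (auto simp: NS_def)
  qed
  \<comment> \<open>What the first round produces in place of the reducible terms. Its weights drop
    by the strict inequality for \<open>C\<close>, so the induction hypothesis applies.\<close>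
  define s2 where "s2 k = (\<Sum>\<pi>\<in>pairs. C \<pi> k * d1 \<pi>)" for k
  have "\<exists>d. (\<forall>\<pi>\<in>pairs. d \<pi> \<in> carrier (PR N) \<and> (\<forall>v\<in>keys (d \<pi>). weight wt v + wt (vr \<pi>) + \<omega> (fst \<pi>) < W)) \<and>
    (\<forall>k<m. \<forall>u\<in>keys (s2 k - (\<Sum>\<pi>\<in>pairs. g \<pi> k * d \<pi>)). keys u \<inter> set (L k) = {})"
  proof (rule Suc.IH)
    fix k assume k: "k < m"
    show "s2 k \<in> carrier (PR N)" unfolding s2_def
      by (intro PR_sum PR_mult d1_carrier homog_carrier[OF C_props(1)]) (use k in auto)
    fix u assume "u \<in> keys (s2 k)"
    then obtain \<pi> where \<pi>: "\<pi> \<in> pairs" "u \<in> keys (C \<pi> k * d1 \<pi>)"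
      unfolding s2_def using keys_sum by fastforce
    then obtain a b where ab: "a \<in> keys (C \<pi> k)" "b \<in> keys (d1 \<pi>)" "u = a + b"
      using keys_mult by blast
    show "weight wt u + \<omega> k < W"
      using d1_wt[OF \<pi>(1) ab(2)] C_props(2)[OF \<pi>(1) k ab(1)] ab(3) by simp
  qed
  then obtain d2 where d2: "\<And>\<pi>. \<pi> \<in> pairs \<Longrightarrow> d2 \<pi> \<in> carrier (PR N)"
    "\<And>\<pi> v. \<pi> \<in> pairs \<Longrightarrow> v \<in> keys (d2 \<pi>) \<Longrightarrow> weight wt v + wt (vr \<pi>) + \<omega> (fst \<pi>) < W"
    "\<And>k u. k < m \<Longrightarrow> u \<in> keys (s2 k - (\<Sum>\<pi>\<in>pairs. g \<pi> k * d2 \<pi>)) \<Longrightarrow> keys u \<inter> set (L k) = {}"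
    by blast
  show ?case
  proof (intro exI[of _ "\<lambda>\<pi>. d1 \<pi> + d2 \<pi>"] conjI ballI allI impI)
    fix \<pi> assume \<pi>: "\<pi> \<in> pairs"
    then show "d1 \<pi> + d2 \<pi> \<in> carrier (PR N)" by (intro PR_add d1_carrier d2)
    fix v assume "v \<in> keys (d1 \<pi> + d2 \<pi>)"
    then have "v \<in> keys (d1 \<pi>) \<or> v \<in> keys (d2 \<pi>)" using keys_add[of "d1 \<pi>" "d2 \<pi>"] by auto
    then show "weight wt v + wt (vr \<pi>) + \<omega> (fst \<pi>) < Suc W"
      using d1_wt[OF \<pi>] d2(2)[OF \<pi>] less_SucI by blast
  next
    fix k u assume k: "k < m" and u: "u \<in> keys (s k - (\<Sum>\<pi>\<in>pairs. g \<pi> k * (d1 \<pi> + d2 \<pi>)))"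
    have "(\<Sum>j<length (L k). var (L k ! j) * d1 (k, j)) =
        (\<Sum>j<length (L k). \<Sum>u\<in>{u \<in> NS k. fi k u = j}. single u (lookup (s k) u))"
      unfolding d1_def
    proof (intro sum.cong refl, unfold sum_distrib_left fst_conv snd_conv, intro sum.cong refl)
      fix j u assume "u \<in> {u \<in> NS k. fi k u = j}"
      then have "u = single (vr (k, j)) 1 + (u - single (vr (k, j)) 1)" using split[of u "(k, j)"] by simp
      then have "single (vr (k, j)) 1 + (u - single (vr (k, j)) 1) = u" by (rule sym)
      then show "var (L k ! j) * single (u - single (vr (k, j)) 1) (lookup (s k) u) = single u (lookup (s k) u)"
        by (simp add: var_def mpmon_def mult_single vr_def)
    qed
    also have "\<dots> = (\<Sum>u\<in>NS k. single u (lookup (s k) u))"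
      by (rule sum.group) (use fi in \<open>auto simp: NS_def\<close>)
    finally have eq: "s k - (\<Sum>\<pi>\<in>pairs. g \<pi> k * (d1 \<pi> + d2 \<pi>)) =
        (s k - (\<Sum>u\<in>NS k. single u (lookup (s k) u))) + (s2 k - (\<Sum>\<pi>\<in>pairs. g \<pi> k * d2 \<pi>))"
      using sum_g[OF k, of d1] by (simp add: s2_def distrib_left sum.distrib)
    have "lookup (\<Sum>u\<in>NS k. single u (lookup (s k) u)) w = (if w \<in> NS k then lookup (s k) w else 0)" for w
    proof -
      have "lookup (\<Sum>u\<in>NS k. single u (lookup (s k) u)) w = (\<Sum>u\<in>NS k. if u = w then lookup (s k) w else 0)"
        unfolding lookup_sum by (intro sum.cong) (auto simp: lookup_single when_def)
      then show ?thesis by simp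
    qed
    then have "keys w \<inter> set (L k) = {}" if "w \<in> keys (s k - (\<Sum>u\<in>NS k. single u (lookup (s k) u)))" for w
      using that by (auto simp: in_keys_iff lookup_minus NS_def split: if_splits)
    moreover have "u \<in> keys (s k - (\<Sum>u\<in>NS k. single u (lookup (s k) u))) \<or>
        u \<in> keys (s2 k - (\<Sum>\<pi>\<in>pairs. g \<pi> k * d2 \<pi>))"
      using u keys_add[of "s k - (\<Sum>u\<in>NS k. single u (lookup (s k) u))" "s2 k - (\<Sum>\<pi>\<in>pairs. g \<pi> k * d2 \<pi>)"]
      unfolding eq by auto
    ultimately show "keys u \<inter> set (L k) = {}"
      using d2(3)[OF k] by blast
  qed
qed

text \<open>Subtracting the rewriting relations leaves a syzygy in normal form, and
  \<open>indep\<close> forces it to vanish. Hence the \<open>g \<pi>\<close> generate all syzygies,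
  with control over the weights of the coefficients.\<close>

lemma syzygies:
  assumes "\<And>k. k < m \<Longrightarrow> s k \<in> carrier (PR N)"
    and "\<And>k u. k < m \<Longrightarrow> u \<in> keys (s k) \<Longrightarrow> weight wt u + \<omega> k < W"
    and "\<And>i. i < r \<Longrightarrow> (\<Sum>k<m. E i k * s k) = 0"
  obtains d where "\<And>\<pi>. \<pi> \<in> pairs \<Longrightarrow> d \<pi> \<in> carrier (PR N)"
    and "\<And>\<pi> v. \<pi> \<in> pairs \<Longrightarrow> v \<in> keys (d \<pi>) \<Longrightarrow> weight wt v + wt (vr \<pi>) + \<omega> (fst \<pi>) < W"
    and "\<And>k. k < m \<Longrightarrow> s k = (\<Sum>\<pi>\<in>pairs. g \<pi> k * d \<pi>)"
proof -
  obtain d where d: "\<And>\<pi>. \<pi> \<in> pairs \<Longrightarrow> d \<pi> \<in> carrier (PR N)"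
    "\<And>\<pi> v. \<pi> \<in> pairs \<Longrightarrow> v \<in> keys (d \<pi>) \<Longrightarrow> weight wt v + wt (vr \<pi>) + \<omega> (fst \<pi>) < W"
    "\<And>k u. k < m \<Longrightarrow> u \<in> keys (s k - (\<Sum>\<pi>\<in>pairs. g \<pi> k * d \<pi>)) \<Longrightarrow> keys u \<inter> set (L k) = {}"
    using normal_form[of s W] assms by blast
  have "s k - (\<Sum>\<pi>\<in>pairs. g \<pi> k * d \<pi>) = 0" if "k < m" for k
  proof (rule indep[of "\<lambda>k. s k - (\<Sum>\<pi>\<in>pairs. g \<pi> k * d \<pi>)"])
    fix i assume i: "i < r"
    have "(\<Sum>k<m. E i k * (\<Sum>\<pi>\<in>pairs. g \<pi> k * d \<pi>)) = (\<Sum>\<pi>\<in>pairs. (\<Sum>k<m. E i k * g \<pi> k) * d \<pi>)"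
      unfolding sum_distrib_left sum_distrib_right by (subst sum.swap) (simp add: mult.assoc)
    also have "\<dots> = 0" using g_syzygy i by simp
    finally show "(\<Sum>k<m. E i k * (s k - (\<Sum>\<pi>\<in>pairs. g \<pi> k * d \<pi>))) = 0"
      using assms(3)[OF i] by (simp add: right_diff_distrib sum_subtractf)
  qed (use assms(1) d g_carrier that in \<open>auto intro!: PR_diff PR_sum PR_mult\<close>)
  then show ?thesis using that[of d] d by auto
qed

lemma hom_coeffs:
  assumes "\<And>\<pi>. \<pi> \<in> pairs \<Longrightarrow> d \<pi> \<in> carrier (PR N)"
    and "\<And>k. k < m \<Longrightarrow> s k \<in> homog N 2"
    and "\<And>k. k < m \<Longrightarrow> s k = (\<Sum>\<pi>\<in>pairs. g \<pi> k * d \<pi>)" and "k < m"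
  shows "s k = (\<Sum>\<pi>\<in>pairs. g \<pi> k * hcomp 1 (d \<pi>))"
proof -
  have "s k = hcomp 2 (\<Sum>\<pi>\<in>pairs. g \<pi> k * d \<pi>)" using hcomp_same[OF assms(2)[OF assms(4)]] assms(3)[OF assms(4)] by simp
  also have "\<dots> = (\<Sum>\<pi>\<in>pairs. g \<pi> k * hcomp 1 (d \<pi>))"
    unfolding hcomp_sum
  proof (intro sum.cong refl)
    fix \<pi> assume "\<pi> \<in> pairs"
    then show "hcomp 2 (g \<pi> k * d \<pi>) = g \<pi> k * hcomp 1 (d \<pi>)"
      using hcomp_mult_homog[OF g_homog[OF _ assms(4)], of \<pi> 2 "d \<pi>"] by (simp add: mult.commute)
  qed
  finally show ?thesis .
qed

text \<open>Consider a term \<open>u\<close> of some \<open>s (l, j)\<close> for which the leading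
  product x_j u in row \<open>l\<close> has maximal weight. The \<open>C\<close> parts are strictly
  lighter and cannot cancel it. Another leading product x_i v with i different from j can equal it
  only if x_i divides u and x_j divides v; whichever of the two indices is smaller, one of these
  divisibilities is excluded by \<open>std\<close>.\<close>

lemma indep_syzygies:
  assumes s: "\<And>\<pi>. \<pi> \<in> pairs \<Longrightarrow> s \<pi> \<in> carrier (PR N)"
    and std: "\<And>\<pi> u. \<pi> \<in> pairs \<Longrightarrow> u \<in> keys (s \<pi>) \<Longrightarrow> keys u \<inter> set (take (snd \<pi>) (L (fst \<pi>))) = {}"
    and zero: "\<And>k. k < m \<Longrightarrow> (\<Sum>\<pi>\<in>pairs. g \<pi> k * s \<pi>) = 0"
    and \<pi>: "\<pi> \<in> pairs"
  shows "s \<pi> = 0"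
proof (rule ccontr)
  assume "s \<pi> \<noteq> 0"
  define T where "T = (SIGMA \<pi>:pairs. keys (s \<pi>))"
  define f where "f = (\<lambda>(\<pi>, u). weight wt u + wt (vr \<pi>) + \<omega> (fst \<pi>))"
  have "finite T" by (simp add: T_def)
  moreover have "T \<noteq> {}"
  proof -
    obtain u where "u \<in> keys (s \<pi>)" using \<open>s \<pi> \<noteq> 0\<close> keys_eq_empty by fastforce
    then have "(\<pi>, u) \<in> T" using \<pi> by (simp add: T_def)
    then show ?thesis by blast
  qed
  ultimately have "Max (f ` T) \<in> f ` T" "\<And>t'. t' \<in> T \<Longrightarrow> f t' \<le> Max (f ` T)"
    by (auto intro: Max_in)
  then obtain t where t: "t \<in> T" "\<And>t'. t' \<in> T \<Longrightarrow> f t' \<le> f t"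
    by (metis imageE)
  obtain l j u where tt: "t = ((l, j), u)" by (metis surj_pair)
  have lj: "(l, j) \<in> pairs" and u: "u \<in> keys (s (l, j))" using t(1) tt by (auto simp: T_def)
  have l: "l < m" and j: "j < length (L l)" using lj by (auto simp: pairs_def)
  define w where "w = single (L l ! j) 1 + u"
  have Cz: "lookup (\<Sum>\<pi>\<in>pairs. C \<pi> l * s \<pi>) w = 0"
  proof (rule ccontr)
    assume "lookup (\<Sum>\<pi>\<in>pairs. C \<pi> l * s \<pi>) w \<noteq> 0"
    then have "w \<in> keys (\<Sum>\<pi>\<in>pairs. C \<pi> l * s \<pi>)" by (simp add: in_keys_iff)
    then obtain \<pi> where \<pi>: "\<pi> \<in> pairs" "w \<in> keys (C \<pi> l * s \<pi>)"
      using keys_sum by fastforce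
    then obtain a b where ab: "a \<in> keys (C \<pi> l)" "b \<in> keys (s \<pi>)" "w = a + b"
      using keys_mult by blast
    have "f (\<pi>, b) \<le> f ((l, j), u)" using t(2)[of "(\<pi>, b)"] ab \<pi> tt by (auto simp: T_def)
    moreover have "weight wt w = wt (L l ! j) + weight wt u" by (simp add: w_def)
    moreover have "weight wt w = weight wt a + weight wt b" using ab by simp
    ultimately show False
      using C_props(2)[OF \<pi>(1) l ab(1)] by (simp add: f_def vr_def)
  qed
  have "lookup (var (L l ! i) * s (l, i)) w = (if i = j then lookup (s (l, j)) u else 0)"
    if i: "i < length (L l)" for i
  proof (cases "i = j")
    case True
    then show ?thesis using lookup_single_mult[of "single (L l ! j) 1" 1 "s (l, j)" u]
      by (simp add: var_def mpmon_def w_def)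
  next
    case False
    have li: "(l, i) \<in> pairs" using i l by (auto simp: pairs_def)
    have neq: "L l ! i \<noteq> L l ! j" using False i j L_distinct[OF l] by (simp add: nth_eq_iff_index_eq)
    have "\<not> w \<in> keys (var (L l ! i) * s (l, i))"
    proof
      assume "w \<in> keys (var (L l ! i) * s (l, i))"
      then obtain v where v: "v \<in> keys (s (l, i))" "w = single (L l ! i) 1 + v"
        using keys_single_mult[of "single (L l ! i) 1" 1] by (auto simp: var_def mpmon_def)
      have "lookup u (L l ! i) = lookup w (L l ! i)"
        using neq by (simp add: w_def lookup_add lookup_single_not_eq)
      moreover have "lookup v (L l ! j) = lookup w (L l ! j)"
        unfolding v(2) using neq by (simp add: lookup_add lookup_single_not_eq)
      moreover have "lookup w (L l ! i) > 0" "lookup w (L l ! j) > 0"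
        by (simp add: v(2) lookup_add) (simp add: w_def lookup_add)
      ultimately have in_u: "L l ! i \<in> keys u" and in_v: "L l ! j \<in> keys v"
        by (simp_all add: in_keys_iff)
      show False
      proof (cases "i < j")
        case True
        then have "L l ! i \<in> set (take j (L l))" using i j by (auto simp: in_set_conv_nth)
        then show False using in_u std[OF lj u] by auto
      next
        case False
        then have "L l ! j \<in> set (take i (L l))" using \<open>i \<noteq> j\<close> i j
          by (auto simp: in_set_conv_nth intro!: exI[of _ j])
        then show False using in_v std[OF li v(1)] by auto
      qed
    qed
    then show ?thesis using False by (simp add: in_keys_iff)
  qed
  then have "lookup (\<Sum>i<length (L l). var (L l ! i) * s (l, i)) w =
      (\<Sum>i<length (L l). if i = j then lookup (s (l, j)) u else 0)"
    unfolding lookup_sum by (intro sum.cong) auto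
  also have "\<dots> = lookup (s (l, j)) u" using j by simp
  finally have "lookup (\<Sum>\<pi>\<in>pairs. g \<pi> l * s \<pi>) w = lookup (s (l, j)) u"
    unfolding sum_g[OF l] lookup_minus Cz by simp
  then show False using zero[OF l] u by (simp add: in_keys_iff)
qed

text \<open>
  The syzygies \<open>g \<pi>\<close> again satisfy the axioms: the variables moved away from \<open>g (l, j)\<close> are the first \<open>j\<close>
  entries of \<open>L l\<close>, and scaling the weights leaves room for breaking ties by \<open>j\<close>.
\<close>

lemma syzygy_step:
  obtains p E' L' wt' \<omega>' where "stanley_gens N m p 1 E' L' wt' \<omega>'"
    and "\<And>s. (\<And>k. k < m \<Longrightarrow> s k \<in> carrier (PR N)) \<Longrightarrow>
      (\<forall>i<r. (\<Sum>k<m. E i k * s k) = 0) \<longleftrightarrow>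
      (\<exists>d. (\<forall>l<p. d l \<in> carrier (PR N)) \<and> (\<forall>k<m. s k = (\<Sum>l<p. E' k l * d l)))"
proof -
  obtain h where h: "bij_betw h {..<card pairs} pairs"
    using ex_bij_betw_nat_finite[OF finite_pairs] by (auto simp: atLeast0LessThan)
  define p where "p = card pairs"
  define hi where "hi = the_inv_into {..<p} h"
  have hp: "h l \<in> pairs" "hi (h l) = l" if "l < p" for l
    using h that unfolding hi_def p_def
    by (auto simp: bij_betw_def intro: the_inv_into_f_f)
  have hip: "hi \<pi> < p" "h (hi \<pi>) = \<pi>" if "\<pi> \<in> pairs" for \<pi>
    using h that unfolding hi_def p_def bij_betw_def
    by (metis lessThan_iff order_refl the_inv_into_into) (metis h bij_betw_def f_the_inv_into_f that)
  have sum_h: "(\<Sum>l<p. f (h l)) = (\<Sum>\<pi>\<in>pairs. f \<pi>)" for f :: "nat \<times> nat \<Rightarrow> 'k mpoly"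
    using sum.reindex_bij_betw[OF h] by (simp add: p_def)
  have sum_hi: "(\<Sum>l<p. f (h l) * d l) = (\<Sum>\<pi>\<in>pairs. f \<pi> * d (hi \<pi>))" for f and d :: "nat \<Rightarrow> 'k mpoly"
    unfolding sum_h[symmetric] using hp by (intro sum.cong) auto
  \<comment> \<open>Exceeds every second component of a pair, so that a drop of the old weight by
    one, scaled by \<open>M\<close>, outweighs any difference of tie-breakers.\<close>
  define M where "M = Suc (\<Sum>l<m. length (L l))"
  have M: "snd \<pi> < M" if "\<pi> \<in> pairs" for \<pi>
  proof -
    have "length (L (fst \<pi>)) \<le> (\<Sum>l<m. length (L l))"
      using that by (intro member_le_sum) (auto simp: pairs_def)
    then show ?thesis using that by (auto simp: pairs_def M_def)
  qed
  define E' where "E' k l = g (h l) k" for k l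
  define L' where "L' l = take (snd (h l)) (L (fst (h l)))" for l
  define wt' where "wt' v = M * wt v" for v
  define \<omega>' where "\<omega>' l = M * (\<omega> (fst (h l)) + wt (vr (h l))) + snd (h l)" for l
  have "stanley_gens N m p 1 E' L' wt' \<omega>'"
  proof
    show "E' k l \<in> homog N 1" if "k < m" "l < p" for k l
      using that by (auto simp: E'_def intro: g_homog hp)
    show "set (L' l) \<subseteq> {1..N}" "distinct (L' l)" if "l < p" for l
      using vr_in[OF hp(1)[OF that]] L_vars[of "fst (h l)"] L_distinct[of "fst (h l)"] set_take_subset[of "snd (h l)" "L (fst (h l))"]
      unfolding L'_def by auto
  next
    fix t x assume t: "t < p" and x: "x \<in> set (L' t)"
    obtain l j where lj: "h t = (l, j)" by fastforce
    have ljp: "(l, j) \<in> pairs" using hp(1)[OF t] lj by simp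
    then have l: "l < m" and j: "j < length (L l)" by (auto simp: pairs_def)
    obtain i where i: "i < j" "x = L l ! i" using x lj by (auto simp: L'_def in_set_conv_nth)
    have lip: "(l, i) \<in> pairs" using l j i by (auto simp: pairs_def)
    define xi where "xi = L l ! i"
    define xj where "xj = L l ! j"
    have vrs: "vr (l, i) = xi" "vr (l, j) = xj" by (simp_all add: vr_def xi_def xj_def)
    have hom_xi: "var xi \<in> homog N 1" and hom_xj: "var xj \<in> homog N 1"
      using var_vr[OF lip] var_vr[OF ljp] vrs by auto
    \<comment> \<open>The S-pair of the two rules for the same \<open>l\<close>: both rewrite the
      overlap of \<open>xi\<close> and \<open>xj\<close>, which cancels in the difference.\<close>
    define s where "s k = var xj * C (l, i) k - var xi * C (l, j) k" for k
    have s_eq: "s k = var xi * g (l, j) k - var xj * g (l, i) k" for k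
      by (simp add: s_def g_def vrs algebra_simps)
    \<comment> \<open>The weight of the cancelled overlap. Both surviving parts lie strictly below
      it.\<close>
    define W where "W = wt xi + wt xj + \<omega> l"
    have s_hom: "s k \<in> homog N 2" if "k < m" for k
      using homog_diff[OF homog_mult[OF hom_xj C_props(1)[OF lip that]] homog_mult[OF hom_xi C_props(1)[OF ljp that]]]
      by (simp add: s_def)
    have s_wt: "weight wt u + \<omega> k < W" if k: "k < m" and u: "u \<in> keys (s k)" for k u
    proof -
      have "u \<in> keys (var xj * C (l, i) k) \<or> u \<in> keys (var xi * C (l, j) k)"
        using u keys_diff[of "var xj * C (l, i) k" "var xi * C (l, j) k"] unfolding s_def in_keys_iff lookup_minus by force
      then show ?thesis
      proof
        assume "u \<in> keys (var xj * C (l, i) k)"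
        then obtain a where "a \<in> keys (C (l, i) k)" "u = single xj 1 + a"
          using keys_single_mult[of "single xj 1" 1] by (auto simp: var_def mpmon_def)
        then show ?thesis using C_props(2)[OF lip k] vrs by (fastforce simp: W_def)
      next
        assume "u \<in> keys (var xi * C (l, j) k)"
        then obtain a where "a \<in> keys (C (l, j) k)" "u = single xi 1 + a"
          using keys_single_mult[of "single xi 1" 1] by (auto simp: var_def mpmon_def)
        then show ?thesis using C_props(2)[OF ljp k] vrs by (fastforce simp: W_def)
      qed
    qed
    have s_ker: "(\<Sum>k<m. E i' k * s k) = 0" if i': "i' < r" for i'
    proof -
      have "(\<Sum>k<m. E i' k * s k) =
          var xi * (\<Sum>k<m. E i' k * g (l, j) k) - var xj * (\<Sum>k<m. E i' k * g (l, i) k)"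
        unfolding s_eq sum_distrib_left sum_subtractf[symmetric] by (intro sum.cong) (auto simp: algebra_simps)
      then show ?thesis using g_syzygy[OF ljp i'] g_syzygy[OF lip i'] by simp
    qed
    obtain d where d: "\<And>\<pi>. \<pi> \<in> pairs \<Longrightarrow> d \<pi> \<in> carrier (PR N)"
      "\<And>\<pi> v. \<pi> \<in> pairs \<Longrightarrow> v \<in> keys (d \<pi>) \<Longrightarrow> weight wt v + wt (vr \<pi>) + \<omega> (fst \<pi>) < W"
      "\<And>k. k < m \<Longrightarrow> s k = (\<Sum>\<pi>\<in>pairs. g \<pi> k * d \<pi>)"
      using syzygies[of s W] s_hom[THEN homog_carrier] s_wt s_ker by blast
    define d' where "d' \<pi> = hcomp 1 (d \<pi>)" for \<pi>
    have sd': "s k = (\<Sum>\<pi>\<in>pairs. g \<pi> k * d' \<pi>)" if "k < m" for k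
      unfolding d'_def by (rule hom_coeffs[of d s, OF d(1) s_hom d(3) that])
    \<comment> \<open>Solving the expression of the S-pair for \<open>var xi * g (l, j)\<close> adds
      \<open>var xj\<close> at the pair \<open>(l, i)\<close>. Its weight ties with the left side,
      and the tie is broken by i < j.\<close>
    define c where "c = (\<lambda>\<pi>. d' \<pi> + (if \<pi> = (l, i) then var xj else 0))"
    have sum_c: "var xi * g (l, j) k = (\<Sum>\<pi>\<in>pairs. g \<pi> k * c \<pi>)" if k: "k < m" for k
    proof -
      have "(\<Sum>\<pi>\<in>pairs. g \<pi> k * c \<pi>) = s k + (\<Sum>\<pi>\<in>pairs. if \<pi> = (l, i) then g \<pi> k * var xj else 0)"
        unfolding sd'[OF k] sum.distrib[symmetric] by (intro sum.cong) (auto simp: c_def distrib_left)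
      also have "(\<Sum>\<pi>\<in>pairs. if \<pi> = (l, i) then g \<pi> k * var xj else 0) = g (l, i) k * var xj"
        using lip by simp
      finally show ?thesis by (simp add: s_eq algebra_simps)
    qed
    have c_hom: "c \<pi> \<in> homog N 1" if "\<pi> \<in> pairs" for \<pi>
      using hcomp_homog[OF d(1)[OF that], of 1] hom_xj by (auto simp: c_def d'_def intro: homog_add)
    have c_wt: "weight wt' u + \<omega>' k < wt' x + \<omega>' t" if k: "k < p" and u: "u \<in> keys (c (h k))" for k u
    proof -
      have x_eq: "x = xi" using i by (simp add: xi_def)
      have xt: "wt' x + \<omega>' t = M * W + j"
        by (simp add: wt'_def x_eq \<omega>'_def lj vrs W_def algebra_simps)
      have "u \<in> keys (d' (h k)) \<or> (h k = (l, i) \<and> u \<in> keys (var xj :: 'k mpoly))"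
        using u keys_add[of "d' (h k)" "if h k = (l, i) then var xj else 0"] unfolding c_def by (auto split: if_splits)
      then show ?thesis
      proof
        assume "u \<in> keys (d' (h k))"
        then have "u \<in> keys (d (h k))" by (auto simp: d'_def in_keys_iff lookup_hcomp split: if_splits)
        then have "Suc (weight wt u + wt (vr (h k)) + \<omega> (fst (h k))) \<le> W"
          using d(2)[OF hp(1)[OF k]] by (simp add: Suc_leI)
        then have "M * Suc (weight wt u + wt (vr (h k)) + \<omega> (fst (h k))) \<le> M * W" by (rule mult_le_mono2)
        then show ?thesis using M[OF hp(1)[OF k]] xt
          unfolding wt'_def weight_scale by (simp add: \<omega>'_def algebra_simps)
      next
        assume hk: "h k = (l, i) \<and> u \<in> keys (var xj :: 'k mpoly)"
        then have "u = single xj 1" by (simp add: var_def)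
        then have "weight wt' u + \<omega>' k = M * W + i"
          using hk by (simp add: \<omega>'_def wt'_def vrs W_def algebra_simps)
        then show ?thesis using xt i by simp
      qed
    qed
    show "\<exists>c. (\<forall>k<p. c k \<in> homog N 1 \<and> (\<forall>u\<in>keys (c k). weight wt' u + \<omega>' k < wt' x + \<omega>' t)) \<and>
          (\<forall>k<m. var x * E' k t = (\<Sum>l<p. E' k l * c l))"
    proof (intro exI[of _ "\<lambda>k. c (h k)"] conjI allI impI ballI)
      fix k assume "k < m"
      have "(\<Sum>l<p. E' k l * c (h l)) = (\<Sum>\<pi>\<in>pairs. g \<pi> k * c \<pi>)"
        unfolding E'_def sum_h[symmetric] ..
      then show "var x * E' k t = (\<Sum>l<p. E' k l * c (h l))"
        using sum_c[OF \<open>k < m\<close>] i by (simp add: E'_def lj xi_def)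
    qed (use c_hom c_wt hp in auto)
  next
    fix s l assume s: "\<And>l. l < p \<Longrightarrow> s l \<in> carrier (PR N)"
      and std: "\<And>l u. l < p \<Longrightarrow> u \<in> keys (s l) \<Longrightarrow> keys u \<inter> set (L' l) = {}"
      and zero: "\<And>k. k < m \<Longrightarrow> (\<Sum>l<p. E' k l * s l) = 0" and l: "l < p"
    have "s (hi (h l)) = 0"
    proof (rule indep_syzygies[of "\<lambda>\<pi>. s (hi \<pi>)" "h l"])
      show "(\<Sum>\<pi>\<in>pairs. g \<pi> k * s (hi \<pi>)) = 0" if "k < m" for k
        using zero[OF that] sum_hi[of "\<lambda>\<pi>. g \<pi> k" s] by (simp add: E'_def)
      show "keys u \<inter> set (take (snd \<pi>) (L (fst \<pi>))) = {}" if "\<pi> \<in> pairs" "u \<in> keys (s (hi \<pi>))" for \<pi> u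
        using std[of "hi \<pi>" u] hip[OF that(1)] that(2) by (simp add: L'_def)
    qed (use s hip hp l in auto)
    then show "s l = 0" using hp l by simp
  qed
  moreover have "(\<forall>i<r. (\<Sum>k<m. E i k * s k) = 0) \<longleftrightarrow>
      (\<exists>d. (\<forall>l<p. d l \<in> carrier (PR N)) \<and> (\<forall>k<m. s k = (\<Sum>l<p. E' k l * d l)))"
    if s: "\<And>k. k < m \<Longrightarrow> s k \<in> carrier (PR N)" for s
  proof
    assume ker: "\<forall>i<r. (\<Sum>k<m. E i k * s k) = 0"
    define W where "W = Suc (\<Sum>k<m. \<Sum>u\<in>keys (s k). weight wt u + \<omega> k)"
    have "weight wt u + \<omega> k < W" if "k < m" "u \<in> keys (s k)" for k u
    proof -
      have "weight wt u + \<omega> k \<le> (\<Sum>u\<in>keys (s k). weight wt u + \<omega> k)"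
        using that by (intro member_le_sum) auto
      also have "\<dots> \<le> (\<Sum>k<m. \<Sum>u\<in>keys (s k). weight wt u + \<omega> k)"
        using that by (intro member_le_sum[where f = "\<lambda>k. \<Sum>u\<in>keys (s k). weight wt u + \<omega> k"]) auto
      finally show ?thesis by (simp add: W_def)
    qed
    note W = this
    show "\<exists>d. (\<forall>l<p. d l \<in> carrier (PR N)) \<and> (\<forall>k<m. s k = (\<Sum>l<p. E' k l * d l))"
    proof (rule syzygies[of s W])
      fix d assume d: "\<And>\<pi>. \<pi> \<in> pairs \<Longrightarrow> d \<pi> \<in> carrier (PR N)"
        "\<And>k. k < m \<Longrightarrow> s k = (\<Sum>\<pi>\<in>pairs. g \<pi> k * d \<pi>)"
      have "s k = (\<Sum>l<p. E' k l * d (h l))" if "k < m" for k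
        using d(2)[OF that] sum_h[of "\<lambda>\<pi>. g \<pi> k * d \<pi>"] by (simp add: E'_def)
      then show "\<exists>d. (\<forall>l<p. d l \<in> carrier (PR N)) \<and> (\<forall>k<m. s k = (\<Sum>l<p. E' k l * d l))"
        using d(1) hp by (intro exI[of _ "\<lambda>l. d (h l)"]) auto
    qed (use s ker W in auto)
  next
    assume "\<exists>d. (\<forall>l<p. d l \<in> carrier (PR N)) \<and> (\<forall>k<m. s k = (\<Sum>l<p. E' k l * d l))"
    then obtain d where d: "\<And>k. k < m \<Longrightarrow> s k = (\<Sum>l<p. E' k l * d l)" by blast
    have "(\<Sum>k<m. E i k * s k) = 0" if "i < r" for i
    proof -
      have "(\<Sum>k<m. E i k * s k) = (\<Sum>k<m. E i k * (\<Sum>l<p. E' k l * d l))"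
        using d by simp
      also have "\<dots> = (\<Sum>l<p. (\<Sum>k<m. E i k * E' k l) * d l)" by (rule sum_assoc)
      also have "\<dots> = 0" using g_syzygy hp that by (simp add: E'_def)
      finally show ?thesis .
    qed
    then show "\<forall>i<r. (\<Sum>k<m. E i k * s k) = 0" by blast
  qed
  ultimately show ?thesis using that by blast
qed

end

section \<open>Linear resolutions and uniqueness of minimal covers\<close>

definition fr :: "nat \<Rightarrow> nat \<Rightarrow> (nat \<Rightarrow> 'k::field mpoly) set" where
  "fr N r = {..<r} \<rightarrow>\<^sub>E carrier (PR N)"

text \<open>Matrix maps are restricted to the index set, as in
  \<open>min_graded_free_resolution\<close>, so that exactness there becomes an equality between
  \<open>mat_kernel\<close> and an image.\<close>

definition mv :: "nat \<Rightarrow> nat \<Rightarrow> (nat \<Rightarrow> nat \<Rightarrow> 'k::field mpoly) \<Rightarrow> (nat \<Rightarrow> 'k mpoly) \<Rightarrow> nat \<Rightarrow> 'k mpoly" where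
  "mv r p E c = (\<lambda>k\<in>{..<r}. \<Sum>l<p. E k l * c l)"

definition mat_kernel :: "nat \<Rightarrow> nat \<Rightarrow> nat \<Rightarrow> (nat \<Rightarrow> nat \<Rightarrow> 'k::field mpoly) \<Rightarrow> (nat \<Rightarrow> 'k mpoly) set" where
  "mat_kernel N r p E = {c \<in> fr N p. mv r p E c = (\<lambda>k\<in>{..<r}. 0)}"

lemma fr_carrier: "c \<in> fr N r \<Longrightarrow> k < r \<Longrightarrow> c k \<in> carrier (PR N)"
  by (auto simp: fr_def)

lemma restrict_fr: "(\<And>k. k < r \<Longrightarrow> c k \<in> carrier (PR N)) \<Longrightarrow> (\<lambda>k\<in>{..<r}. c k) \<in> fr N r"
  by (auto simp: fr_def)

lemma frI: "c \<in> extensional {..<r} \<Longrightarrow> (\<And>k. k < r \<Longrightarrow> c k \<in> carrier (PR N)) \<Longrightarrow> c \<in> fr N r"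
  by (auto simp: fr_def PiE_def)

lemma mem_mat_kernel: "c \<in> mat_kernel N r p E \<longleftrightarrow> c \<in> fr N p \<and> (\<forall>k<r. (\<Sum>l<p. E k l * c l) = 0)"
  by (auto simp: mat_kernel_def mv_def fun_eq_iff restrict_def split: if_splits)

lemma mem_mv_image:
  "(c \<in> mv r p E ` fr N p) \<longleftrightarrow>
     c \<in> extensional {..<r} \<and> (\<exists>d. (\<forall>l<p. d l \<in> carrier (PR N)) \<and> (\<forall>k<r. c k = (\<Sum>l<p. E k l * d l)))"
proof
  assume "c \<in> mv r p E ` fr N p"
  then show "c \<in> extensional {..<r} \<and> (\<exists>d. (\<forall>l<p. d l \<in> carrier (PR N)) \<and> (\<forall>k<r. c k = (\<Sum>l<p. E k l * d l)))"
    using fr_carrier by (fastforce simp: mv_def)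
next
  assume "c \<in> extensional {..<r} \<and> (\<exists>d. (\<forall>l<p. d l \<in> carrier (PR N)) \<and> (\<forall>k<r. c k = (\<Sum>l<p. E k l * d l)))"
  then obtain d where c: "c \<in> extensional {..<r}" and d: "\<And>l. l < p \<Longrightarrow> d l \<in> carrier (PR N)"
    "\<And>k. k < r \<Longrightarrow> c k = (\<Sum>l<p. E k l * d l)" by blast
  have "c = mv r p E (\<lambda>l\<in>{..<p}. d l)"
    using c d(2) by (auto simp: mv_def fun_eq_iff extensional_def restrict_def)
  then show "c \<in> mv r p E ` fr N p" using restrict_fr[of p d N] d(1) by blast
qed

lemma fr_extensional: "c \<in> fr N r \<Longrightarrow> c \<in> extensional {..<r}"
  by (auto simp: fr_def PiE_def)

text \<open>\<open>Z\<close> has a, possibly infinite, free resolution all of whose matrices are linear.\<close>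

coinductive linear_resolution :: "nat \<Rightarrow> nat \<Rightarrow> (nat \<Rightarrow> 'k::field mpoly) set \<Rightarrow> bool" for N where
  "(\<And>k l. k < r \<Longrightarrow> l < p \<Longrightarrow> E k l \<in> homog N 1) \<Longrightarrow> Z = mv r p E ` fr N p \<Longrightarrow>
   linear_resolution N p (mat_kernel N r p E) \<Longrightarrow> linear_resolution N r Z"

text \<open>Coinduction with the invariant that the module is the kernel of a matrix carrying
  Stanley data; \<open>syzygy_step\<close> covers this kernel by a linear matrix of the same
  kind.\<close>

lemma stanley_gens_linear_resolution:
  fixes E :: "nat \<Rightarrow> nat \<Rightarrow> 'k::field mpoly"
  assumes "stanley_gens N r m \<delta> E L wt \<omega>"
  shows "linear_resolution N m (mat_kernel N r m E)"
proof -
  define X where "X = (\<lambda>m (Z :: (nat \<Rightarrow> 'k mpoly) set). \<exists>r \<delta> E L wt \<omega>. stanley_gens N r m \<delta> E L wt \<omega> \<and> Z = mat_kernel N r m E)"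
  have "X m (mat_kernel N r m E)" unfolding X_def using assms by blast
  then show ?thesis
  proof (coinduction arbitrary: m E r rule: linear_resolution.coinduct)
    case linear_resolution
    then obtain r' \<delta> E0 L wt \<omega> where S: "stanley_gens N r' m \<delta> E0 L wt \<omega>" and Z: "mat_kernel N r m E = mat_kernel N r' m E0"
      by (auto simp: X_def)
    interpret stanley_gens N r' m \<delta> E0 L wt \<omega> by (rule S)
    obtain p E' L' wt' \<omega>' where S': "stanley_gens N m p 1 E' L' wt' \<omega>'"
      and ex: "\<And>s. (\<And>k. k < m \<Longrightarrow> s k \<in> carrier (PR N)) \<Longrightarrow>
        (\<forall>i<r'. (\<Sum>k<m. E0 i k * s k) = 0) \<longleftrightarrow>
        (\<exists>d. (\<forall>l<p. d l \<in> carrier (PR N)) \<and> (\<forall>k<m. s k = (\<Sum>l<p. E' k l * d l)))"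
      using syzygy_step by blast
    have hom: "E' k l \<in> homog N 1" if "k < m" "l < p" for k l
      using stanley_gens.E_homog[OF S'] that by blast
    have "mat_kernel N r' m E0 = mv m p E' ` fr N p"
    proof (rule Set.set_eqI)
      fix c
      show "c \<in> mat_kernel N r' m E0 \<longleftrightarrow> c \<in> mv m p E' ` fr N p"
      proof
        assume "c \<in> mat_kernel N r' m E0"
        then show "c \<in> mv m p E' ` fr N p" unfolding mem_mat_kernel mem_mv_image
          using ex[of c] fr_carrier fr_extensional by blast
      next
        assume c: "c \<in> mv m p E' ` fr N p"
        then obtain d where d: "\<And>l. l < p \<Longrightarrow> d l \<in> carrier (PR N)" "\<And>k. k < m \<Longrightarrow> c k = (\<Sum>l<p. E' k l * d l)"
          and ce: "c \<in> extensional {..<m}"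
          unfolding mem_mv_image by blast
        have cc: "c k \<in> carrier (PR N)" if "k < m" for k
          unfolding d(2)[OF that] by (intro PR_sum PR_mult d homog_carrier[OF hom]) (use that in auto)
        then have "c \<in> fr N m" using ce by (intro frI)
        then show "c \<in> mat_kernel N r' m E0" unfolding mem_mat_kernel using ex[of c] cc d by blast
      qed
    qed
    then show ?case using Z hom S' unfolding X_def
      by (intro exI[of _ m] exI[of _ p] exI[of _ E'] exI[of _ "mat_kernel N r m E"]) blast
  qed
qed

lemma homog_lookup_0:
  assumes "p \<in> homog N j" "j \<noteq> 0"
  shows "lookup p 0 = 0"
proof (rule ccontr)
  assume "lookup p 0 \<noteq> 0"
  then have "0 \<in> keys p" by (simp add: in_keys_iff)
  then show False using assms by (fastforce simp: homog_iff)
qed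

text \<open>Elements of \<open>Z\<close> are combinations of columns of linear forms, so a cover
  with kernel \<open>Z\<close> is minimal.\<close>

lemma linear_resolution_irrelevant:
  assumes "linear_resolution N r Z" "c \<in> Z" "k < r"
  shows "lookup (c k) 0 = 0"
  using assms(1)
proof cases
  case (1 p E)
  obtain d where d: "c k = (\<Sum>l<p. E k l * d l)"
    using assms(2,3) unfolding 1(2) mem_mv_image by blast
  have "lookup (E k l) 0 = 0" if "l < p" for l
    using homog_lookup_0[OF 1(1)[OF assms(3) that]] by simp
  then show ?thesis unfolding d lookup_sum lookup_mult_0 by simp
qed

text \<open>Each coefficient may be replaced by its component of degree
  \<open>\<delta> - \<beta> l\<close>. For a negative degree this component is 0, which later
  excludes unequal shifts.\<close>

lemma homog_coeffs:
  fixes x :: "nat \<Rightarrow> 'k::field mpoly"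
  assumes "\<And>k. k < r \<Longrightarrow> x k \<in> homog N \<delta>" "\<And>k l. k < r \<Longrightarrow> l < p \<Longrightarrow> D k l \<in> homog N (\<beta> l)"
    "x' \<in> mv r p D ` fr N p" "\<And>k. k < r \<Longrightarrow> x' k = x k"
  shows "\<exists>c. (\<forall>l<p. c l \<in> homog N (\<delta> - \<beta> l)) \<and> (\<forall>k<r. x k = (\<Sum>l<p. D k l * c l))"
proof -
  obtain c where c: "\<And>l. l < p \<Longrightarrow> c l \<in> carrier (PR N)" "\<And>k. k < r \<Longrightarrow> x k = (\<Sum>l<p. D k l * c l)"
    using assms(3,4) unfolding mem_mv_image by auto
  show ?thesis
  proof (intro exI[of _ "\<lambda>l. hcomp (\<delta> - \<beta> l) (c l)"] conjI allI impI)
    fix k assume k: "k < r"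
    have "x k = hcomp \<delta> (\<Sum>l<p. D k l * c l)" using hcomp_same[OF assms(1)[OF k]] c(2)[OF k] by simp
    also have "\<dots> = (\<Sum>l<p. D k l * hcomp (\<delta> - \<beta> l) (c l))"
      unfolding hcomp_sum
    proof (intro sum.cong refl)
      fix l assume "l \<in> {..<p}"
      then show "hcomp \<delta> (D k l * c l) = D k l * hcomp (\<delta> - \<beta> l) (c l)"
        using hcomp_mult_homog[OF assms(2)[OF k], of l \<delta> "c l"] by (simp add: mult.commute)
    qed
    finally show "x k = (\<Sum>l<p. D k l * hcomp (\<delta> - \<beta> l) (c l))" .
  qed (use c hcomp_homog in blast)
qed

lemma sum_delta_left:
  fixes c :: "nat \<Rightarrow> 'a::comm_ring_1"
  shows "l < p \<Longrightarrow> (\<Sum>i<p. (if i = l then 1 else 0) * c i) = c l" "l < p \<Longrightarrow> (\<Sum>i<p. c i * (if i = l then 1 else 0)) = c l"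
    "l < p \<Longrightarrow> (\<Sum>i<p. (if l = i then 1 else 0) * c i) = c l"
  by (simp_all add: if_distrib if_distribR cong: if_cong)

lemma column_in_image:
  assumes "l < p" shows "mv r p D (\<lambda>j\<in>{..<p}. if j = l then 1 else 0) \<in> mv r p D ` fr N p"
    and "k < r \<Longrightarrow> mv r p D (\<lambda>j\<in>{..<p}. if j = l then 1 else 0) k = D k l"
proof -
  show "mv r p D (\<lambda>j\<in>{..<p}. if j = l then 1 else 0) \<in> mv r p D ` fr N p"
    by (intro imageI restrict_fr) (auto intro: PR_0 PR_1)
  assume "k < r"
  then show "mv r p D (\<lambda>j\<in>{..<p}. if j = l then 1 else 0) k = D k l"
    using sum_delta_left(2)[OF assms, of "D k"] by (simp add: mv_def)
qed

text \<open>
  Two minimal covers of the same module differ by mutually inverse scalar matrices, so linearity of one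
  cover and of the resolution of its kernel carries over to the other.
\<close>

lemma minimal_cover_unique:
  fixes E D :: "nat \<Rightarrow> nat \<Rightarrow> 'k::field mpoly"
  assumes E: "\<And>k l. k < r \<Longrightarrow> l < p \<Longrightarrow> E k l \<in> homog N \<delta>"
    and D: "\<And>k l. k < r \<Longrightarrow> l < p' \<Longrightarrow> D k l \<in> homog N (\<beta> l)"
    and im: "mv r p E ` fr N p = mv r p' D ` fr N p'"
    and kerE: "linear_resolution N p (mat_kernel N r p E)"
    and kerD: "\<And>c l. c \<in> mat_kernel N r p' D \<Longrightarrow> l < p' \<Longrightarrow> lookup (c l) 0 = 0"
  shows "(\<forall>l<p'. \<beta> l = \<delta>) \<and> linear_resolution N p' (mat_kernel N r p' D)"
proof -
  have "\<exists>c. (\<forall>j<p'. c j \<in> homog N (\<delta> - \<beta> j)) \<and> (\<forall>k<r. E k l = (\<Sum>j<p'. D k j * c j))" if l: "l < p" for l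
  proof (rule homog_coeffs[where x' = "mv r p E (\<lambda>j\<in>{..<p}. if j = l then 1 else 0)"])
    show "mv r p E (\<lambda>j\<in>{..<p}. if j = l then 1 else 0) \<in> mv r p' D ` fr N p'"
      unfolding im[symmetric] by (rule column_in_image(1)[OF l])
  qed (use E D l column_in_image(2)[OF l, where r = r and D = E] in auto)
  then have "\<forall>l\<in>{..<p}. \<exists>c. (\<forall>j<p'. c j \<in> homog N (\<delta> - \<beta> j)) \<and> (\<forall>k<r. E k l = (\<Sum>j<p'. D k j * c j))"
    by blast
  from bchoice[OF this] obtain cc' where
    "\<forall>l\<in>{..<p}. (\<forall>j<p'. cc' l j \<in> homog N (\<delta> - \<beta> j)) \<and> (\<forall>k<r. E k l = (\<Sum>j<p'. D k j * cc' l j))"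
    by blast
  moreover define cc where "cc j l = cc' l j" for j l
  ultimately have cc: "\<And>l j. l < p \<Longrightarrow> j < p' \<Longrightarrow> cc j l \<in> homog N (\<delta> - \<beta> j)"
    "\<And>l k. l < p \<Longrightarrow> k < r \<Longrightarrow> E k l = (\<Sum>j<p'. D k j * cc j l)"
    by auto
  have "\<exists>c. (\<forall>j<p. c j \<in> homog N (\<beta> l - \<delta>)) \<and> (\<forall>k<r. D k l = (\<Sum>j<p. E k j * c j))" if l: "l < p'" for l
  proof (rule homog_coeffs[where x' = "mv r p' D (\<lambda>j\<in>{..<p'}. if j = l then 1 else 0)"])
    show "mv r p' D (\<lambda>j\<in>{..<p'}. if j = l then 1 else 0) \<in> mv r p E ` fr N p"
      unfolding im by (rule column_in_image(1)[OF l])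
  qed (use E D l column_in_image(2)[OF l, where r = r and D = D] in auto)
  then have "\<forall>l\<in>{..<p'}. \<exists>c. (\<forall>j<p. c j \<in> homog N (\<beta> l - \<delta>)) \<and> (\<forall>k<r. D k l = (\<Sum>j<p. E k j * c j))"
    by blast
  from bchoice[OF this] obtain bb' where
    "\<forall>l\<in>{..<p'}. (\<forall>j<p. bb' l j \<in> homog N (\<beta> l - \<delta>)) \<and> (\<forall>k<r. D k l = (\<Sum>j<p. E k j * bb' l j))"
    by blast
  moreover define bb where "bb j l = bb' l j" for j l
  ultimately have bb: "\<And>l j. l < p' \<Longrightarrow> j < p \<Longrightarrow> bb j l \<in> homog N (\<beta> l - \<delta>)"
    "\<And>l k. l < p' \<Longrightarrow> k < r \<Longrightarrow> D k l = (\<Sum>j<p. E k j * bb j l)"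
    by auto
  note carr = cc(1)[THEN homog_carrier] bb(1)[THEN homog_carrier]
  \<comment> \<open>The columns of the product of \<open>cc\<close> and \<open>bb\<close> minus the
    identity lie in the kernel of \<open>D\<close>, and kernel elements have no constant
    coefficients.\<close>
  have cb: "lookup (\<Sum>j<p. cc i j * bb j l) 0 = (if i = l then 1 else 0)" if i: "i < p'" and l: "l < p'" for i l
  proof -
    define x where "x i = (\<Sum>j<p. cc i j * bb j l) - (if i = l then 1 else 0)" for i
    have "x i \<in> carrier (PR N)" if "i < p'" for i
      unfolding x_def by (intro PR_diff PR_sum PR_mult) (use carr l that PR_0 PR_1 in auto)
    moreover have "(\<Sum>i<p'. D k i * x i) = 0" if k: "k < r" for k
    proof -
      have "(\<Sum>i<p'. D k i * x i) = (\<Sum>i<p'. D k i * (\<Sum>j<p. cc i j * bb j l)) - D k l"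
        using sum_delta_left(2)[OF l, of "D k"] by (simp add: x_def right_diff_distrib sum_subtractf)
      also have "(\<Sum>i<p'. D k i * (\<Sum>j<p. cc i j * bb j l)) = (\<Sum>j<p. E k j * bb j l)"
        unfolding sum_assoc using cc(2) k by simp
      finally show ?thesis using bb(2)[OF l k] by simp
    qed
    ultimately have "(\<lambda>i\<in>{..<p'}. x i) \<in> mat_kernel N r p' D"
      unfolding mem_mat_kernel by (auto intro: restrict_fr)
    from kerD[OF this i] have "lookup (x i) 0 = 0" using i by simp
    then show ?thesis by (auto simp: x_def lookup_minus split: if_splits)
  qed
  have bc: "lookup (\<Sum>j<p'. bb i j * cc j l) 0 = (if i = l then 1 else 0)" if i: "i < p" and l: "l < p" for i l
  proof -
    define x where "x i = (\<Sum>j<p'. bb i j * cc j l) - (if i = l then 1 else 0)" for i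
    have "x i \<in> carrier (PR N)" if "i < p" for i
      unfolding x_def by (intro PR_diff PR_sum PR_mult) (use carr l that PR_0 PR_1 in auto)
    moreover have "(\<Sum>i<p. E k i * x i) = 0" if k: "k < r" for k
    proof -
      have "(\<Sum>i<p. E k i * x i) = (\<Sum>i<p. E k i * (\<Sum>j<p'. bb i j * cc j l)) - E k l"
        using sum_delta_left(2)[OF l, of "E k"] by (simp add: x_def right_diff_distrib sum_subtractf)
      also have "(\<Sum>i<p. E k i * (\<Sum>j<p'. bb i j * cc j l)) = (\<Sum>j<p'. D k j * cc j l)"
        unfolding sum_assoc using bb(2) k by simp
      finally show ?thesis using cc(2)[OF l k] by simp
    qed
    ultimately have "(\<lambda>i\<in>{..<p}. x i) \<in> mat_kernel N r p E"
      unfolding mem_mat_kernel by (auto intro: restrict_fr)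
    from linear_resolution_irrelevant[OF kerE this i] have "lookup (x i) 0 = 0" using i by simp
    then show ?thesis by (auto simp: x_def lookup_minus split: if_splits)
  qed
  \<comment> \<open>A diagonal entry of the product has constant coefficient 1, so some pair of
    factors is nonzero. Their degrees are negatives of each other, hence both are 0.\<close>
  have \<beta>: "\<beta> l = \<delta>" if l: "l < p'" for l
  proof -
    have "(\<Sum>j<p. cc l j * bb j l) \<noteq> 0" using cb[OF l l] by auto
    then obtain j where j: "j < p" "cc l j * bb j l \<noteq> 0"
      by (meson lessThan_iff sum.not_neutral_contains_not_neutral)
    then have "\<not> \<delta> - \<beta> l < 0" "\<not> \<beta> l - \<delta> < 0"
      using homog_neg[OF cc(1)[OF j(1) l]] homog_neg[OF bb(1)[OF l j(1)]] by auto
    then show ?thesis by simp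
  qed
  have cc0: "cc j l \<in> homog N 0" if "l < p" "j < p'" for l j
    using cc(1)[OF that] \<beta> that by simp
  have bb0: "bb j l \<in> homog N 0" if "l < p'" "j < p" for l j
    using bb(1)[OF that] \<beta> that by simp
  have h0: "a * b \<in> homog N 0" if "a \<in> homog N 0" "b \<in> homog N 0" for a b :: "'k mpoly"
    using homog_mult[OF that] by simp
  have cb1: "(\<Sum>j<p. cc i j * bb j l) = (if i = l then 1 else 0)" if i: "i < p'" and l: "l < p'" for i l
  proof -
    have "(\<Sum>j<p. cc i j * bb j l) \<in> homog N 0"
      by (intro homog_sum h0 cc0 bb0) (use that in auto)
    from homog_0D[OF this] show ?thesis unfolding cb[OF that] by (simp add: const_simps)
  qed
  have bc1: "(\<Sum>j<p'. bb i j * cc j l) = (if i = l then 1 else 0)" if i: "i < p" and l: "l < p" for i l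
  proof -
    have "(\<Sum>j<p'. bb i j * cc j l) \<in> homog N 0"
      by (intro homog_sum h0 cc0 bb0) (use that in auto)
    from homog_0D[OF this] show ?thesis unfolding bc[OF that] by (simp add: const_simps)
  qed
  from kerE obtain p2 E' where E': "\<And>k l. k < p \<Longrightarrow> l < p2 \<Longrightarrow> E' k l \<in> homog N 1"
    "mat_kernel N r p E = mv p p2 E' ` fr N p2" "linear_resolution N p2 (mat_kernel N p p2 E')"
    by (cases rule: linear_resolution.cases) blast
  \<comment> \<open>The linear cover of the kernel of \<open>E\<close>, transported to the kernel of
    \<open>D\<close> by the invertible scalar matrix \<open>cc\<close>.\<close>
  define E2 where "E2 i t = (\<Sum>j<p. cc i j * E' j t)" for i t
  have E2: "E2 i t \<in> homog N 1" if "i < p'" "t < p2" for i t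
    unfolding E2_def using homog_mult[OF cc0 E'(1)] that by (intro homog_sum) force
  have "mat_kernel N r p' D = mv p' p2 E2 ` fr N p2"
  proof (intro Set.set_eqI iffI)
    fix s assume s: "s \<in> mat_kernel N r p' D"
    define y where "y j = (\<Sum>l<p'. bb j l * s l)" for j
    have sc: "s l \<in> carrier (PR N)" if "l < p'" for l using s that by (auto simp: mem_mat_kernel fr_def)
    have "(\<lambda>j\<in>{..<p}. y j) \<in> mat_kernel N r p E"
      unfolding mem_mat_kernel
    proof (intro conjI allI impI restrict_fr)
      fix j assume "j < p"
      then show "y j \<in> carrier (PR N)" unfolding y_def by (intro PR_sum PR_mult) (use carr sc in auto)
    next
      fix k assume k: "k < r"
      have "(\<Sum>l<p. E k l * y l) = (\<Sum>l<p'. D k l * s l)"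
        unfolding y_def sum_assoc using bb(2)[OF _ k] by simp
      then show "(\<Sum>l<p. E k l * (\<lambda>j\<in>{..<p}. y j) l) = 0" using s k by (simp add: mem_mat_kernel)
    qed
    then obtain d where d: "\<And>l. l < p2 \<Longrightarrow> d l \<in> carrier (PR N)" "\<And>j. j < p \<Longrightarrow> y j = (\<Sum>t<p2. E' j t * d t)"
      unfolding E'(2) mem_mv_image by auto
    have "s i = (\<Sum>t<p2. E2 i t * d t)" if i: "i < p'" for i
    proof -
      have "(\<Sum>t<p2. E2 i t * d t) = (\<Sum>j<p. cc i j * y j)"
        unfolding E2_def sum_assoc[symmetric] using d(2) by simp
      also have "\<dots> = (\<Sum>l<p'. (if i = l then 1 else 0) * s l)"
        unfolding y_def sum_assoc using cb1[OF i] by simp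
      finally show ?thesis using sum_delta_left(3)[OF i, of s] by simp
    qed
    then show "s \<in> mv p' p2 E2 ` fr N p2"
      unfolding mem_mv_image using d s fr_extensional by (auto simp: mem_mat_kernel)
  next
    fix s assume s: "s \<in> mv p' p2 E2 ` fr N p2"
    then obtain d where d: "\<And>l. l < p2 \<Longrightarrow> d l \<in> carrier (PR N)" "\<And>i. i < p' \<Longrightarrow> s i = (\<Sum>t<p2. E2 i t * d t)"
      and se: "s \<in> extensional {..<p'}" unfolding mem_mv_image by auto
    have "s i \<in> carrier (PR N)" if "i < p'" for i
      unfolding d(2)[OF that] by (intro PR_sum PR_mult d homog_carrier[OF E2]) (use that in auto)
    moreover have "(\<Sum>i<p'. D k i * s i) = 0" if k: "k < r" for k
    proof -
      define y where "y = (\<lambda>j\<in>{..<p}. \<Sum>t<p2. E' j t * d t)"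
      have "y \<in> mat_kernel N r p E" unfolding E'(2) mem_mv_image y_def using d by auto
      have "(\<Sum>i<p'. D k i * s i) = (\<Sum>i<p'. D k i * (\<Sum>j<p. cc i j * y j))"
        using d(2) unfolding E2_def sum_assoc[symmetric] by (auto simp: y_def intro!: sum.cong)
      also have "\<dots> = (\<Sum>j<p. E k j * y j)"
        unfolding sum_assoc using cc(2)[OF _ k] by simp
      also have "\<dots> = 0" using \<open>y \<in> mat_kernel N r p E\<close> k by (simp add: mem_mat_kernel)
      finally show ?thesis .
    qed
    ultimately show "s \<in> mat_kernel N r p' D" using se by (auto simp: mem_mat_kernel intro: frI)
  qed
  \<comment> \<open>Multiplying \<open>E'\<close> by an invertible matrix on the left does not
    change its kernel, so the rest of the linear resolution can be kept.\<close>
  moreover have "mat_kernel N p' p2 E2 = mat_kernel N p p2 E'"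
  proof (rule Set.set_eqI)
    fix d
    define X where "X j = (\<Sum>t<p2. E' j t * d t)" for j
    define Y where "Y i = (\<Sum>t<p2. E2 i t * d t)" for i
    have Y: "Y i = (\<Sum>j<p. cc i j * X j)" for i
      unfolding Y_def E2_def X_def sum_assoc ..
    have X: "X j = (\<Sum>i<p'. bb j i * Y i)" if j: "j < p" for j
    proof -
      have "(\<Sum>i<p'. bb j i * Y i) = (\<Sum>l<p. (\<Sum>i<p'. bb j i * cc i l) * X l)"
        unfolding Y by (rule sum_assoc)
      also have "\<dots> = (\<Sum>l<p. (if j = l then 1 else 0) * X l)" using bc1[OF j] by simp
      finally show ?thesis using sum_delta_left(3)[OF j, of X] by simp
    qed
    have "(\<forall>i<p'. Y i = 0) \<longleftrightarrow> (\<forall>j<p. X j = 0)"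
    proof
      assume "\<forall>i<p'. Y i = 0"
      then show "\<forall>j<p. X j = 0" using X by simp
    next
      assume "\<forall>j<p. X j = 0"
      then show "\<forall>i<p'. Y i = 0" using Y by simp
    qed
    then show "d \<in> mat_kernel N p' p2 E2 \<longleftrightarrow> d \<in> mat_kernel N p p2 E'"
      unfolding mem_mat_kernel X_def Y_def by simp
  qed
  ultimately have "linear_resolution N p' (mat_kernel N r p' D)"
    using linear_resolution.intros[of p' p2 E2 N "mat_kernel N r p' D"] E2 E'(3) by simp
  then show ?thesis using \<beta> by blast
qed

section \<open>Quotient rings and regularity\<close>

lemma PR_a_inv: "b \<in> carrier (PR N) \<Longrightarrow> \<ominus>\<^bsub>PR N\<^esub> b = - b"
  using PR_uminus[of b N] by (intro abelian_group.minus_equality[OF ring.is_abelian_group[OF ring_PR]]) auto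

lemma PR_minus: "b \<in> carrier (PR N) \<Longrightarrow> a \<ominus>\<^bsub>PR N\<^esub> b = a - b"
  by (simp add: a_minus_def PR_a_inv)

context
  fixes J and N :: nat
  assumes J: "ideal J (PR N :: 'k::field mpoly ring)"
begin

abbreviation cls where "cls p \<equiv> J +>\<^bsub>PR N\<^esub> p"

lemma q_eq_iff: "a \<in> carrier (PR N) \<Longrightarrow> b \<in> carrier (PR N) \<Longrightarrow> cls a = cls b \<longleftrightarrow> a - b \<in> J"
  using ring.quotient_eq_iff_same_a_r_cos[OF ring_PR J, of a b] PR_minus[of b N a] by simp

lemma q_eq_0_iff: "a \<in> carrier (PR N) \<Longrightarrow> cls a = cls 0 \<longleftrightarrow> a \<in> J"
  using q_eq_iff[of a 0] PR_0[of N] by simp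

lemma q_hom: "(\<lambda>p. cls p) \<in> ring_hom (PR N) (PR N Quot J)"
  using ideal.rcos_ring_hom[OF J] .

lemma q_add: "a \<in> carrier (PR N) \<Longrightarrow> b \<in> carrier (PR N) \<Longrightarrow> cls a \<oplus>\<^bsub>PR N Quot J\<^esub> cls b = cls (a + b)"
  using ring_hom_add[OF q_hom, of a b] by simp

lemma q_mult: "a \<in> carrier (PR N) \<Longrightarrow> b \<in> carrier (PR N) \<Longrightarrow> cls a \<otimes>\<^bsub>PR N Quot J\<^esub> cls b = cls (a * b)"
  using ring_hom_mult[OF q_hom, of a b] by simp

lemma q_carrier: "carrier (PR N Quot J) = (\<lambda>p. cls p) ` carrier (PR N)"
  by (auto simp: FactRing_def A_RCOSETS_def' image_def)

lemma q_zero: "\<zero>\<^bsub>PR N Quot J\<^esub> = cls 0"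
  using ring_hom_zero[OF q_hom ring_PR ideal.quotient_is_ring[OF J]] by simp

lemma q_one: "\<one>\<^bsub>PR N Quot J\<^esub> = cls 1"
  using ring_hom_one[OF q_hom] by simp

lemma cring_quot: "cring (PR N Quot J)"
  by (rule ideal.quotient_is_cring[OF J cring_PR])

lemma q_closed: "a \<in> carrier (PR N) \<Longrightarrow> cls a \<in> carrier (PR N Quot J)"
  unfolding q_carrier by blast

lemma quot_module_simps:
  "carrier (quot_module N J) = carrier (PR N Quot J)"
  "zero (quot_module N J) = cls 0"
  "add (quot_module N J) = add (PR N Quot J)"
  "smult (quot_module N J) s x = cls s \<otimes>\<^bsub>PR N Quot J\<^esub> x"
  by (simp_all add: quot_module_def ring.extend_def module.fields_def q_zero)

lemma quot_module_finsum:
  fixes r :: nat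
  assumes "\<And>k. k < r \<Longrightarrow> c k \<in> carrier (PR N)" "\<And>k. k < r \<Longrightarrow> s k \<in> carrier (PR N)"
    "\<And>k. k < r \<Longrightarrow> e k = cls (s k)"
  shows "(\<Oplus>\<^bsub>quot_module N J\<^esub>k\<in>{..<r}. c k \<odot>\<^bsub>quot_module N J\<^esub> e k) = cls (\<Sum>k<r. c k * s k)"
proof -
  interpret Q: cring "PR N Quot J" by (rule cring_quot)
  interpret M: abelian_monoid "quot_module N J"
    by (rule abelian_monoidI) (auto simp: quot_module_simps Q.a_ac Q.l_zero simp flip: q_zero)
  show ?thesis
    using assms
  proof (induction r)
    case 0
    then show ?case by (simp add: quot_module_simps)
  next
    case (Suc r)
    have "(\<Sum>k<r. c k * s k) \<in> carrier (PR N)" using Suc(2,3) by (intro PR_sum PR_mult) auto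
    moreover have "c r * s r \<in> carrier (PR N)" using Suc(2,3) by (intro PR_mult) auto
    moreover have "finsum (quot_module N J) (\<lambda>k. c k \<odot>\<^bsub>quot_module N J\<^esub> e k) (insert r {..<r}) =
        (c r \<odot>\<^bsub>quot_module N J\<^esub> e r) \<oplus>\<^bsub>quot_module N J\<^esub>
        finsum (quot_module N J) (\<lambda>k. c k \<odot>\<^bsub>quot_module N J\<^esub> e k) {..<r}"
      using Suc by (intro M.finsum_insert) (auto simp: quot_module_simps q_mult intro!: q_closed PR_mult)
    ultimately show ?case
      using Suc by (simp add: lessThan_Suc q_mult q_add quot_module_simps add.commute)
  qed
qed

lemma quot_comp_D: "x \<in> quot_comp N J j \<Longrightarrow> \<exists>s\<in>homog N j. x = cls s"
  by (auto simp: quot_comp_def)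

end

text \<open>Unrolls the coinductive predicate by successive choices. The recursion carries the
  current rank together with the module still to be covered.\<close>

lemma linear_resolution_matrices:
  assumes "linear_resolution N r0 (Z0 :: (nat \<Rightarrow> 'k::field mpoly) set)"
  obtains r :: "nat \<Rightarrow> nat" and E where "r 0 = r0"
    and "\<And>i k l. k < r i \<Longrightarrow> l < r (Suc i) \<Longrightarrow> E i k l \<in> homog N 1"
    and "Z0 = mv (r 0) (r 1) (E 0) ` fr N (r 1)"
    and "\<And>i. mat_kernel N (r i) (r (Suc i)) (E i) = mv (r (Suc i)) (r (Suc (Suc i))) (E (Suc i)) ` fr N (r (Suc (Suc i)))"
proof -
  define good where "good r Z p E \<longleftrightarrow> (\<forall>k<r. \<forall>l<p. E k l \<in> homog N 1) \<and> Z = mv r p E ` fr N p \<and>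
    linear_resolution N p (mat_kernel N r p E)" for r p and Z :: "(nat \<Rightarrow> 'k mpoly) set" and E
  have ex: "\<exists>pE. good r Z (fst pE) (snd pE)" if "linear_resolution N r Z" for r and Z :: "(nat \<Rightarrow> 'k mpoly) set"
    using that
  proof cases
    case (1 p E)
    then have "good r Z (fst (p, E)) (snd (p, E))" by (simp add: good_def)
    then show ?thesis ..
  qed
  have good: "good r Z (fst (SOME pE. good r Z (fst pE) (snd pE))) (snd (SOME pE. good r Z (fst pE) (snd pE)))"
    if "linear_resolution N r Z" for r and Z :: "(nat \<Rightarrow> 'k mpoly) set"
    by (rule someI_ex[OF ex[OF that]])
  define P where "P r Z = fst (SOME pE. good r Z (fst pE) (snd pE))" for r Z
  define F where "F r Z = snd (SOME pE. good r Z (fst pE) (snd pE))" for r Z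
  have PF: "(\<forall>k<r. \<forall>l<P r Z. F r Z k l \<in> homog N 1) \<and> Z = mv r (P r Z) (F r Z) ` fr N (P r Z) \<and>
      linear_resolution N (P r Z) (mat_kernel N r (P r Z) (F r Z))" if "linear_resolution N r Z" for r Z
    using good[OF that] by (simp add: P_def F_def good_def)
  define st where "st = rec_nat (r0, Z0) (\<lambda>_ (r, Z). (P r Z, mat_kernel N r (P r Z) (F r Z)))"
  have st0: "st 0 = (r0, Z0)" by (simp add: st_def)
  have stS: "st (Suc i) = (P (fst (st i)) (snd (st i)), mat_kernel N (fst (st i)) (P (fst (st i)) (snd (st i))) (F (fst (st i)) (snd (st i))))" for i
    by (simp add: st_def split_beta)
  have lin: "linear_resolution N (fst (st i)) (snd (st i))" for i
  proof (induction i)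
    case 0
    then show ?case using assms by (simp add: st0)
  next
    case (Suc i)
    then show ?case using PF[OF Suc] by (simp add: stS)
  qed
  show ?thesis
  proof (rule that[of "\<lambda>i. fst (st i)" "\<lambda>i. F (fst (st i)) (snd (st i))"])
    show "fst (st 0) = r0" by (simp add: st0)
    show "F (fst (st i)) (snd (st i)) k l \<in> homog N 1" if "k < fst (st i)" "l < fst (st (Suc i))" for i k l
      using PF[OF lin[of i]] that by (simp add: stS)
    show "Z0 = mv (fst (st 0)) (fst (st 1)) (F (fst (st 0)) (snd (st 0))) ` fr N (fst (st 1))"
      using PF[OF lin[of 0]] by (simp add: stS st0)
    show "mat_kernel N (fst (st i)) (fst (st (Suc i))) (F (fst (st i)) (snd (st i))) =
      mv (fst (st (Suc i))) (fst (st (Suc (Suc i)))) (F (fst (st (Suc i))) (snd (st (Suc i)))) ` fr N (fst (st (Suc (Suc i))))" for i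
      using PF[OF lin[of "Suc i"]] by (simp add: stS)
  qed
qed

section \<open>Minimal resolutions of a quotient and their shifts\<close>

lemma min_res_iff:
  "min_graded_free_resolution N M C a e D \<longleftrightarrow>
     (let r = \<lambda>i. length (a i); aug = \<lambda>c. \<Oplus>\<^bsub>M\<^esub>k\<in>{..<r 0}. c k \<odot>\<^bsub>M\<^esub> e k in
      (\<forall>k<r 0. e k \<in> C (a 0 ! k)) \<and>
      (\<forall>i. \<forall>k<r i. \<forall>l<r (Suc i). D i k l \<in> homog N (a (Suc i) ! l - a i ! k)) \<and>
      aug ` fr N (r 0) = carrier M \<and>
      {c \<in> fr N (r 0). aug c = \<zero>\<^bsub>M\<^esub>} = mv (r 0) (r 1) (D 0) ` fr N (r 1) \<and>
      (\<forall>i. mat_kernel N (r i) (r (Suc i)) (D i) = mv (r (Suc i)) (r (Suc (Suc i))) (D (Suc i)) ` fr N (r (Suc (Suc i)))) \<and>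
      (\<forall>i. \<forall>k<r i. \<forall>l<r (Suc i). D i k l \<in> irrelevant_ideal N))"
  unfolding min_graded_free_resolution_def Let_def fr_def mat_kernel_def mv_def by simp

text \<open>Homological degree 0 contributes the value 0, and every basis element in a later degree
  contributes exactly 1. The first syzygy module is nonzero, so the value 1 is attained.\<close>

lemma ereal_Sup_shifts:
  assumes "length (a 0) = 1" "a 0 ! 0 = (0::int)" "length (a 1) \<ge> 1"
    "\<And>i l. l < length (a (Suc i)) \<Longrightarrow> a (Suc i) ! l = int i + 2"
  shows "Sup {ereal (of_int (a i ! k - int i)) | i k. k < length (a i)} = 1"
proof (rule antisym)
  show "Sup {ereal (of_int (a i ! k - int i)) | i k. k < length (a i)} \<le> 1"
  proof (rule Sup_least)
    fix x assume "x \<in> {ereal (of_int (a i ! k - int i)) | i k. k < length (a i)}"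
    then obtain i k where x: "x = ereal (of_int (a i ! k - int i))" "k < length (a i)" by blast
    show "x \<le> 1" using x assms by (cases i) auto
  qed
  have "ereal (of_int (a 1 ! 0 - int 1)) = 1" using assms(3) assms(4)[of 0 0] by (cases "a 1") auto
  then show "1 \<le> Sup {ereal (of_int (a i ! k - int i)) | i k. k < length (a i)}"
    using assms(3) by (intro Sup_upper) (metis (mono_tags, lifting) One_nat_def Suc_le_lessD mem_Collect_eq)
qed

text \<open>An ideal generated by quadrics with Stanley data, regarded as a matrix with one row. The
  condition on \<open>z 0\<close> makes \<open>J\<close> nonzero; for the zero ideal the regularity
  would be 0.\<close>

locale linear_quotient = stanley_gens N 1 m 2 "\<lambda>_. z" L wt \<omega>
  for N m and z :: "nat \<Rightarrow> 'k::field mpoly" and L wt \<omega> +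
  fixes J :: "'k mpoly set"
  assumes J_ideal: "ideal J (PR N)"
    and J_gen: "p \<in> J \<longleftrightarrow> (\<exists>d. (\<forall>l<m. d l \<in> carrier (PR N)) \<and> p = (\<Sum>l<m. z l * d l))"
    and z_nz: "0 < m" "z 0 \<noteq> 0"
begin

lemma J_const: "p \<in> J \<Longrightarrow> lookup p 0 = 0"
proof -
  assume "p \<in> J"
  then obtain d where "p = (\<Sum>l<m. z l * d l)" using J_gen by blast
  moreover have "lookup (z l) 0 = 0" if "l < m" for l
    using homog_lookup_0[OF E_homog[of 0 l]] that by simp
  ultimately show "lookup p 0 = 0" by (simp add: lookup_sum lookup_mult_0)
qed

lemma z_in_J: "z 0 \<in> J"
  unfolding J_gen
proof (intro exI[of _ "\<lambda>l. if l = 0 then 1 else 0"] conjI allI impI)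
  show "z 0 = (\<Sum>l<m. z l * (if l = 0 then 1 else 0))"
    using sum_delta_left(2)[OF z_nz(1), of z] by simp
qed (use PR_0 PR_1 in auto)

lemma image_z: "mv 1 m (\<lambda>_. z) ` fr N m = {c \<in> fr N 1. c 0 \<in> J}"
proof (intro Set.set_eqI iffI)
  fix c assume "c \<in> mv 1 m (\<lambda>_. z) ` fr N m"
  then have "c \<in> extensional {..<1}" "c 0 \<in> J" unfolding mem_mv_image J_gen by auto
  then show "c \<in> {c \<in> fr N 1. c 0 \<in> J}"
    using ideal_PR_carrier[OF J_ideal] by (auto simp: fr_def PiE_def)
next
  fix c assume "c \<in> {c \<in> fr N 1. c 0 \<in> J}"
  then show "c \<in> mv 1 m (\<lambda>_. z) ` fr N m"
    unfolding mem_mv_image J_gen using fr_extensional by auto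
qed

lemma kernel_linear_resolution: "linear_resolution N m (mat_kernel N 1 m (\<lambda>_. z))"
  using stanley_gens_linear_resolution stanley_gens_axioms by blast

abbreviation cls where "cls p \<equiv> J +>\<^bsub>PR N\<^esub> p"

lemma resolution_exists: "\<exists>a e D. min_graded_free_resolution N (quot_module N J) (quot_comp N J) a e D"
proof -
  obtain r E where r0: "r 0 = m" and E: "\<And>i k l. k < r i \<Longrightarrow> l < r (Suc i) \<Longrightarrow> E i k l \<in> homog N 1"
    and ex0: "mat_kernel N 1 m (\<lambda>_. z) = mv (r 0) (r 1) (E 0) ` fr N (r 1)"
    and ex: "\<And>i. mat_kernel N (r i) (r (Suc i)) (E i) = mv (r (Suc i)) (r (Suc (Suc i))) (E (Suc i)) ` fr N (r (Suc (Suc i)))"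
    using linear_resolution_matrices[OF kernel_linear_resolution] by blast
  \<comment> \<open>The shifts are 0 for the unit, 2 for the quadrics, and then grow by one at each
    linear matrix.\<close>
  define a where "a i = (case i of 0 \<Rightarrow> [0] | Suc i \<Rightarrow> replicate (r i) (int i + 2))" for i
  define D where "D i = (case i of 0 \<Rightarrow> (\<lambda>_. z) | Suc i \<Rightarrow> E i)" for i
  define e where "e k = cls 1" for k :: nat
  have a0: "a 0 = [0]" and aS: "a (Suc i) = replicate (r i) (int i + 2)" for i by (simp_all add: a_def)
  have D0: "D 0 = (\<lambda>_. z)" and DS: "D (Suc i) = E i" for i by (simp_all add: D_def)
  have hom: "D i k l \<in> homog N (a (Suc i) ! l - a i ! k)" "a (Suc i) ! l - a i ! k > 0"
    if "k < length (a i)" "l < length (a (Suc i))" for i k l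
  proof -
    have "D i k l \<in> homog N (a (Suc i) ! l - a i ! k) \<and> a (Suc i) ! l - a i ! k > 0"
    proof (cases i)
      case 0
      then show ?thesis using that E_homog[of 0 l] by (simp add: a0 aS D0 r0)
    next
      case (Suc i')
      then show ?thesis using that E[of k i' l] by (simp add: aS DS)
    qed
    then show "D i k l \<in> homog N (a (Suc i) ! l - a i ! k)" "a (Suc i) ! l - a i ! k > 0" by auto
  qed
  have aug: "(\<Oplus>\<^bsub>quot_module N J\<^esub>k\<in>{..<length (a 0)}. c k \<odot>\<^bsub>quot_module N J\<^esub> e k) = cls (c 0)"
    if "c \<in> fr N 1" for c
    using quot_module_finsum[OF J_ideal, of "length (a 0)" c "\<lambda>_. 1" e] that PR_1[of N] fr_carrier[of c N 1]
    by (simp add: a0 e_def)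
  have deg: "\<forall>k<length (a 0). e k \<in> quot_comp N J (a 0 ! k)"
  proof (intro allI impI)
    show "e k \<in> quot_comp N J (a 0 ! k)" if "k < length (a 0)" for k
      unfolding quot_comp_def e_def using that homog_const[of 1 N] by (intro imageI) (simp add: a0 const_simps)
  qed
  have homs: "\<forall>i. \<forall>k<length (a i). \<forall>l<length (a (Suc i)). D i k l \<in> homog N (a (Suc i) ! l - a i ! k)"
    using hom(1) by blast
  have irr: "\<forall>i. \<forall>k<length (a i). \<forall>l<length (a (Suc i)). D i k l \<in> irrelevant_ideal N"
  proof (intro allI impI)
    show "D i k l \<in> irrelevant_ideal N" if "k < length (a i)" "l < length (a (Suc i))" for i k l
      using homog_lookup_0[OF hom(1)[OF that]] homog_carrier[OF hom(1)[OF that]] hom(2)[OF that]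
      unfolding irrelevant_ideal_eq by auto
  qed
  have "(\<lambda>c. \<Oplus>\<^bsub>quot_module N J\<^esub>k\<in>{..<length (a 0)}. c k \<odot>\<^bsub>quot_module N J\<^esub> e k) ` fr N (length (a 0)) =
      (\<lambda>c. cls (c 0)) ` fr N 1"
    using aug by (intro image_cong) (auto simp: a0)
  also have "\<dots> = cls ` ((\<lambda>c. c 0) ` fr N 1)" by (simp add: image_image)
  also have "(\<lambda>c. c 0) ` fr N 1 = carrier (PR N :: 'k mpoly ring)"
  proof (intro Set.set_eqI iffI)
    fix p assume "p \<in> carrier (PR N :: 'k mpoly ring)"
    then have "(\<lambda>k\<in>{..<1}. p) \<in> fr N 1" by (intro restrict_fr)
    then show "p \<in> (\<lambda>c. c 0) ` fr N 1" by (rule rev_image_eqI) simp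
  qed (auto simp: fr_def)
  also have "cls ` carrier (PR N) = carrier (quot_module N J)"
    unfolding quot_module_simps[OF J_ideal] q_carrier[OF J_ideal] ..
  finally have surj: "(\<lambda>c. \<Oplus>\<^bsub>quot_module N J\<^esub>k\<in>{..<length (a 0)}. c k \<odot>\<^bsub>quot_module N J\<^esub> e k) ` fr N (length (a 0)) =
      carrier (quot_module N J)" .
  have "{c \<in> fr N (length (a 0)). (\<Oplus>\<^bsub>quot_module N J\<^esub>k\<in>{..<length (a 0)}. c k \<odot>\<^bsub>quot_module N J\<^esub> e k) = \<zero>\<^bsub>quot_module N J\<^esub>} =
      {c \<in> fr N 1. c 0 \<in> J}"
    using aug q_eq_0_iff[OF J_ideal] fr_carrier[of _ N 1 0] by (auto simp: a0 quot_module_simps[OF J_ideal])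
  then have ker0: "{c \<in> fr N (length (a 0)). (\<Oplus>\<^bsub>quot_module N J\<^esub>k\<in>{..<length (a 0)}. c k \<odot>\<^bsub>quot_module N J\<^esub> e k) = \<zero>\<^bsub>quot_module N J\<^esub>} =
      mv (length (a 0)) (length (a 1)) (D 0) ` fr N (length (a 1))"
    using image_z by (simp add: a0 aS D0 r0)
  have kerS: "\<forall>i. mat_kernel N (length (a i)) (length (a (Suc i))) (D i) =
      mv (length (a (Suc i))) (length (a (Suc (Suc i)))) (D (Suc i)) ` fr N (length (a (Suc (Suc i))))"
  proof
    show "mat_kernel N (length (a i)) (length (a (Suc i))) (D i) =
      mv (length (a (Suc i))) (length (a (Suc (Suc i)))) (D (Suc i)) ` fr N (length (a (Suc (Suc i))))" for i
      using ex0 ex by (cases i) (simp_all add: a0 aS D0 DS r0)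
  qed
  have "min_graded_free_resolution N (quot_module N J) (quot_comp N J) a e D"
    unfolding min_res_iff Let_def
    by (intro conjI deg homs surj ker0 kerS irr)
  then show ?thesis by blast
qed

text \<open>Minimality first forces the module in degree 0 to have rank one and shift 0. From there
  on each module of the given resolution is a minimal cover of a kernel that also has a linear
  cover, and \<open>minimal_cover_unique\<close> is applied by induction.\<close>

lemma resolution_unique:
  assumes res: "min_graded_free_resolution N (quot_module N J) (quot_comp N J) a e D"
  shows "Sup {ereal (of_int (a i ! k - int i)) | i k. k < length (a i)} = 1"
proof -
  define r where "r i = length (a i)" for i
  note res' = res[unfolded min_res_iff Let_def, folded r_def]
  note R1 = conjunct1[OF res'] and R2 = conjunct1[OF conjunct2[OF res']] and R3 = conjunct1[OF conjunct2[OF conjunct2[OF res']]]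
    and R4 = conjunct1[OF conjunct2[OF conjunct2[OF conjunct2[OF res']]]] and R5 = conjunct1[OF conjunct2[OF conjunct2[OF conjunct2[OF conjunct2[OF res']]]]]
    and R6 = conjunct2[OF conjunct2[OF conjunct2[OF conjunct2[OF conjunct2[OF res']]]]]
  have "\<exists>s. k < r 0 \<longrightarrow> s \<in> homog N (a 0 ! k) \<and> e k = cls s" for k
  proof (cases "k < r 0")
    case True
    then show ?thesis using quot_comp_D[OF J_ideal R1[rule_format, OF True]] by blast
  qed auto
  then have "\<forall>k. \<exists>s. k < r 0 \<longrightarrow> s \<in> homog N (a 0 ! k) \<and> e k = cls s" by (rule allI)
  from choice[OF this] obtain s where "\<forall>k. k < r 0 \<longrightarrow> s k \<in> homog N (a 0 ! k) \<and> e k = cls (s k)" ..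
  then have s: "\<And>k. k < r 0 \<Longrightarrow> s k \<in> homog N (a 0 ! k)" "\<And>k. k < r 0 \<Longrightarrow> e k = cls (s k)"
    by simp_all
  have hom: "D i k l \<in> homog N (a (Suc i) ! l - a i ! k)" if "k < r i" "l < r (Suc i)" for i k l
    using R2 that by simp
  have min: "lookup (D i k l) 0 = 0" if "k < r i" "l < r (Suc i)" for i k l
    using R6[rule_format, OF that] by (simp add: irrelevant_ideal_eq)
  have ex: "mat_kernel N (r i) (r (Suc i)) (D i) = mv (r (Suc i)) (r (Suc (Suc i))) (D (Suc i)) ` fr N (r (Suc (Suc i)))" for i
    using R5 by (rule spec)
  note sc = s(1)[THEN homog_carrier]
  have aug: "(\<Oplus>\<^bsub>quot_module N J\<^esub>k\<in>{..<r 0}. c k \<odot>\<^bsub>quot_module N J\<^esub> e k) = cls (\<Sum>k<r 0. c k * s k)"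
    if "\<And>k. k < r 0 \<Longrightarrow> c k \<in> carrier (PR N)" for c
    by (rule quot_module_finsum[OF J_ideal]) (use that sc s(2) in auto)
  have sumc: "(\<Sum>k<r 0. c k * s k) \<in> carrier (PR N)"
    if "\<And>k. k < r 0 \<Longrightarrow> c k \<in> carrier (PR N)" for c
    by (intro PR_sum PR_mult) (use that sc in auto)
  have augz: "(\<Oplus>\<^bsub>quot_module N J\<^esub>k\<in>{..<r 0}. c k \<odot>\<^bsub>quot_module N J\<^esub> e k) = \<zero>\<^bsub>quot_module N J\<^esub> \<longleftrightarrow>
      (\<Sum>k<r 0. c k * s k) \<in> J" if "c \<in> fr N (r 0)" for c
  proof -
    have c: "c k \<in> carrier (PR N)" if "k < r 0" for k
      using fr_carrier[OF \<open>c \<in> fr N (r 0)\<close> that] .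
    have A: "(\<Oplus>\<^bsub>quot_module N J\<^esub>k\<in>{..<r 0}. c k \<odot>\<^bsub>quot_module N J\<^esub> e k) = cls (\<Sum>k<r 0. c k * s k)"
      by (rule aug) (rule c)
    have B: "(\<Sum>k<r 0. c k * s k) \<in> carrier (PR N)" by (rule sumc) (rule c)
    show ?thesis unfolding A quot_module_simps(2)[OF J_ideal] using q_eq_0_iff[OF J_ideal B] .
  qed
  have "{c \<in> fr N (r 0). (\<Oplus>\<^bsub>quot_module N J\<^esub>k\<in>{..<r 0}. c k \<odot>\<^bsub>quot_module N J\<^esub> e k) = \<zero>\<^bsub>quot_module N J\<^esub>} =
      {c \<in> fr N (r 0). (\<Sum>k<r 0. c k * s k) \<in> J}"
    by (intro Collect_cong conj_cong refl augz)
  then have ex0: "{c \<in> fr N (r 0). (\<Sum>k<r 0. c k * s k) \<in> J} = mv (r 0) (r 1) (D 0) ` fr N (r 1)"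
    unfolding R4 by (rule sym)
  have minker: "lookup (c l) 0 = 0"
    if c: "c \<in> mv (r i) (r (Suc i)) (D i) ` fr N (r (Suc i))" and l: "l < r i" for i c l
  proof -
    obtain d where "c l = (\<Sum>t<r (Suc i). D i l t * d t)" using c l unfolding mem_mv_image by blast
    then show ?thesis using min[OF l] by (simp add: lookup_sum lookup_mult_0)
  qed
  \<comment> \<open>By exactness a relation among the generators modulo \<open>J\<close> is a
    combination of columns of \<open>D 0\<close>, whose constant coefficients vanish. Producing a
    relation with a nonzero constant coefficient is the source of all contradictions below.\<close>
  have K: "lookup (c k) 0 = 0"
    if c: "\<And>k. k < r 0 \<Longrightarrow> c k \<in> carrier (PR N)" and cJ: "(\<Sum>k<r 0. c k * s k) \<in> J" and k: "k < r 0" for c k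
  proof -
    have "(\<lambda>k\<in>{..<r 0}. c k) \<in> {c \<in> fr N (r 0). (\<Sum>k<r 0. c k * s k) \<in> J}"
      using c cJ by (auto intro: restrict_fr)
    then show ?thesis using minker[of "\<lambda>k\<in>{..<r 0}. c k" 0 k] k unfolding ex0 by simp
  qed
  have "cls 1 \<in> carrier (quot_module N J)"
    using q_closed[OF J_ideal PR_1] by (simp add: quot_module_simps[OF J_ideal])
  then obtain c where c: "c \<in> fr N (r 0)" "cls 1 = (\<Oplus>\<^bsub>quot_module N J\<^esub>k\<in>{..<r 0}. c k \<odot>\<^bsub>quot_module N J\<^esub> e k)"
    using R3 by (metis (no_types, lifting) imageE)
  have cc: "c k \<in> carrier (PR N)" if "k < r 0" for k using fr_carrier[OF c(1) that] .
  have c1: "1 - (\<Sum>k<r 0. c k * s k) \<in> J"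
  proof -
    have A: "(\<Oplus>\<^bsub>quot_module N J\<^esub>k\<in>{..<r 0}. c k \<odot>\<^bsub>quot_module N J\<^esub> e k) = cls (\<Sum>k<r 0. c k * s k)"
      by (rule aug) (rule cc)
    have B: "(\<Sum>k<r 0. c k * s k) \<in> carrier (PR N)" by (rule sumc) (rule cc)
    show ?thesis using q_eq_iff[OF J_ideal PR_1 B] c(2) unfolding A by simp
  qed
  \<comment> \<open>A negative shift gives \<open>s k = 0\<close>, so the \<open>k\<close>-th basis
    vector is a relation. For a positive shift, subtracting \<open>s k\<close> times the
    representation \<open>c\<close> of 1 from that basis vector gives a relation with constant
    coefficient 1 in position \<open>k\<close>.\<close>
  have a0: "a 0 ! k = 0" if k: "k < r 0" for k
  proof (rule ccontr)
    assume "a 0 ! k \<noteq> 0"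
    then consider "a 0 ! k < 0" | "a 0 ! k > 0" by linarith
    then show False
    proof cases
      case 1
      then have sk: "s k = 0" using homog_neg s(1)[OF k] by blast
      have "(\<Sum>i<r 0. (if i = k then 1 else 0) * s i) = 0"
        using sum_delta_left(1)[OF k, of s] sk by simp
      then have "lookup (if k = k then 1 else 0 :: 'k mpoly) 0 = 0"
        by (intro K[of "\<lambda>i. if i = k then 1 else 0"]) (use PR_0 PR_1 k ideal_PR_0[OF J_ideal] in auto)
      then show False by simp
    next
      case 2
      have "(\<Sum>i<r 0. ((if i = k then 1 else 0) - s k * c i) * s i) = s k * (1 - (\<Sum>k<r 0. c k * s k))"
        using sum_delta_left(1)[OF k, of s]
        by (simp add: left_diff_distrib sum_subtractf right_diff_distrib sum_distrib_left mult.assoc)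
      also have "\<dots> \<in> J" using ideal_PR_mult[OF J_ideal c1 sc[OF k]] .
      finally have "lookup ((if k = k then 1 else 0) - s k * c k) 0 = 0"
        by (intro K[of "\<lambda>i. (if i = k then 1 else 0) - s k * c i"]) (use PR_0 PR_1 k cc sc in \<open>auto intro!: PR_diff PR_mult PR_uminus\<close>)
      moreover have "lookup (s k) 0 = 0" using homog_lookup_0[OF s(1)[OF k]] 2 by simp
      ultimately show False by (simp add: lookup_minus lookup_mult_0)
    qed
  qed
  define t where "t k = lookup (s k) 0" for k
  have st: "s k = const (t k)" if "k < r 0" for k
    using homog_0D[of "s k" N] s(1)[OF that] a0[OF that] by (simp add: t_def)
  have t0: "t k \<noteq> 0" if k: "k < r 0" for k
  proof
    assume "t k = 0"
    then have sk: "s k = 0" using st[OF k] by (simp add: const_simps)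
    have "(\<Sum>i<r 0. (if i = k then 1 else 0) * s i) = 0"
      using sum_delta_left(1)[OF k, of s] sk by simp
    then have "lookup (if k = k then 1 else 0 :: 'k mpoly) 0 = 0"
      by (intro K[of "\<lambda>i. if i = k then 1 else 0"]) (use PR_0 PR_1 k ideal_PR_0[OF J_ideal] in auto)
    then show False by simp
  qed
  have "r 0 \<noteq> 0"
  proof
    assume "r 0 = 0"
    then have "1 \<in> J" using c1 by simp
    then show False using J_const by fastforce
  qed
  \<comment> \<open>Two generators that are nonzero constants satisfy the relation with coefficients
    \<open>s 1\<close> and \<open>- s 0\<close>, which are units.\<close>
  moreover have "\<not> r 0 \<ge> 2"
  proof
    assume r2: "r 0 \<ge> 2"
    then have k: "0 < r 0" "1 < r 0" by auto
    define v where "v i = (if i = 0 then 1 else 0) * s 1 - (if i = 1 then 1 else 0) * s 0" for i :: nat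
    have ring: "(a * x - b * y) * z = x * (a * z) - y * (b * z)" for a b x y z :: "'k mpoly"
      by (simp add: algebra_simps)
    have "(\<Sum>i<r 0. v i * s i) = s 1 * (\<Sum>i<r 0. (if i = 0 then 1 else 0) * s i) - s 0 * (\<Sum>i<r 0. (if i = 1 then 1 else 0) * s i)"
      unfolding v_def sum_distrib_left sum_subtractf[symmetric]
      by (intro sum.cong refl ring)
    then have "(\<Sum>i<r 0. v i * s i) = 0"
      using sum_delta_left(1)[OF k(1), of s] sum_delta_left(1)[OF k(2), of s] by simp
    then have "lookup (v 0) 0 = 0"
      by (intro K[of v 0]) (use PR_0 PR_1 k sc ideal_PR_0[OF J_ideal] in \<open>auto simp: v_def intro!: PR_diff PR_mult PR_uminus\<close>)
    then show False using t0[OF k(2)] by (simp add: v_def t_def)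
  qed
  ultimately have r0: "r 0 = 1" by linarith
  \<comment> \<open>Up to the nonzero constant \<open>s 0\<close>, the first matrix is a cover of
    \<open>J\<close>, as is the row of quadrics.\<close>
  have im0: "mv 1 m (\<lambda>_. z) ` fr N m = mv 1 (r 1) (D 0) ` fr N (r 1)"
  proof -
    have "c * s 0 \<in> J \<longleftrightarrow> c \<in> J" for c
    proof
      assume "c * s 0 \<in> J"
      from ideal_PR_mult[OF J_ideal this PR_const[of "inverse (t 0)"]]
      have "const (inverse (t 0) * t 0) * c \<in> J" using st[of 0] r0 by (simp add: const_simps mult_ac)
      then show "c \<in> J" using t0[of 0] r0 by (simp add: const_simps)
    next
      assume "c \<in> J"
      then show "c * s 0 \<in> J" using ideal_PR_mult[OF J_ideal _ sc[of 0], of c] r0 by (simp add: mult.commute)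
    qed
    then show ?thesis unfolding image_z using ex0 by (simp add: r0)
  qed
  have step0: "(\<forall>l<r 1. a 1 ! l = 2) \<and> linear_resolution N (r 1) (mat_kernel N (r 0) (r 1) (D 0))"
    unfolding r0
  proof (rule minimal_cover_unique[where \<beta> = "\<lambda>l. a 1 ! l", OF _ _ im0 kernel_linear_resolution])
    show "z l \<in> homog N 2" if "l < m" for l using E_homog[of 0 l] that by simp
    show "D 0 k l \<in> homog N (a 1 ! l)" if "k < 1" "l < r 1" for k l
      using hom[of k 0 l] that a0[of k] r0 by simp
    show "lookup (c l) 0 = 0" if "c \<in> mat_kernel N 1 (r 1) (D 0)" "l < r 1" for c l
      using ex[of 0] minker[of c 1 l] that r0 by simp
  qed
  have "(\<forall>l<r (Suc i). a (Suc i) ! l = int i + 2) \<and> linear_resolution N (r (Suc i)) (mat_kernel N (r i) (r (Suc i)) (D i))" for i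
  proof (induction i)
    case 0
    then show ?case using step0 by simp
  next
    case (Suc i)
    from conjunct2[OF Suc] obtain p E where E: "\<And>k l. k < r (Suc i) \<Longrightarrow> l < p \<Longrightarrow> E k l \<in> homog N 1"
      "mat_kernel N (r i) (r (Suc i)) (D i) = mv (r (Suc i)) p E ` fr N p" "linear_resolution N p (mat_kernel N (r (Suc i)) p E)"
      by (cases rule: linear_resolution.cases) blast
    \<comment> \<open>Degrees are measured relative to the common shift \<open>int i + 2\<close> of
      the previous module, so that the linear cover has degree 1.\<close>
    have "(\<forall>l<r (Suc (Suc i)). a (Suc (Suc i)) ! l - (int i + 2) = 1) \<and>
        linear_resolution N (r (Suc (Suc i))) (mat_kernel N (r (Suc i)) (r (Suc (Suc i))) (D (Suc i)))"
    proof (rule minimal_cover_unique[OF E(1) _ _ E(3)])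
      show "D (Suc i) k l \<in> homog N (a (Suc (Suc i)) ! l - (int i + 2))" if "k < r (Suc i)" "l < r (Suc (Suc i))" for k l
        using hom[OF that] Suc that by simp
      show "mv (r (Suc i)) p E ` fr N p = mv (r (Suc i)) (r (Suc (Suc i))) (D (Suc i)) ` fr N (r (Suc (Suc i)))"
        using E(2) ex by simp
      show "lookup (c l) 0 = 0" if "c \<in> mat_kernel N (r (Suc i)) (r (Suc (Suc i))) (D (Suc i))" "l < r (Suc (Suc i))" for c l
        using ex[of "Suc i"] minker[of c "Suc (Suc i)" l] that by simp
    qed
    then show ?case by auto
  qed
  moreover have "r 1 \<ge> 1"
  proof (rule ccontr)
    assume "\<not> r 1 \<ge> 1"
    then have "r 1 = 0" by simp
    then have c0: "c 0 = 0" if "c \<in> mv 1 (r 1) (D 0) ` fr N (r 1)" for c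
      using that unfolding mem_mv_image by simp
    have "(\<lambda>k\<in>{..<1}. z 0) \<in> {c \<in> fr N 1. c 0 \<in> J}"
    proof (rule CollectI, rule conjI)
      show "(\<lambda>k\<in>{..<1}. z 0) \<in> fr N 1"
        by (rule restrict_fr) (rule ideal_PR_carrier[OF J_ideal z_in_J])
      show "(\<lambda>k\<in>{..<1::nat}. z 0) 0 \<in> J" using z_in_J by simp
    qed
    then have "(\<lambda>k\<in>{..<1}. z 0) \<in> mv 1 (r 1) (D 0) ` fr N (r 1)"
      unfolding image_z[symmetric] im0 .
    from c0[OF this] show False using z_nz(2) by simp
  qed
  ultimately show ?thesis
  proof (intro ereal_Sup_shifts)
    show "length (a 0) = 1" using r0 unfolding r_def .
    show "a 0 ! 0 = 0" using a0[of 0] r0 by simp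
  qed (unfold r_def, blast+)
qed

lemma regularity_eq_1: "quot_reg N J = 1"
  unfolding quot_reg_def regularity_def
proof (rule the_equality)
  obtain a e D where res: "min_graded_free_resolution N (quot_module N J) (quot_comp N J) a e D"
    using resolution_exists by blast
  show "\<exists>a e D. min_graded_free_resolution N (quot_module N J) (quot_comp N J) a e D \<and>
      1 = Sup {ereal (of_int (a i ! k - int i)) | i k. k < length (a i)}"
    by (intro exI conjI, rule res) (rule resolution_unique[OF res, symmetric])
next
  fix \<rho>
  assume "\<exists>a e D. min_graded_free_resolution N (quot_module N J) (quot_comp N J) a e D \<and>
      \<rho> = Sup {ereal (of_int (a i ! k - int i)) | i k. k < length (a i)}"
  then obtain a e D where "min_graded_free_resolution N (quot_module N J) (quot_comp N J) a e D"
    and \<rho>: "\<rho> = Sup {ereal (of_int (a i ! k - int i)) | i k. k < length (a i)}" by (elim exE conjE)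
  then show "\<rho> = 1" using resolution_unique by simp
qed

end

section \<open>The kernel of the Rees map\<close>

text \<open>The linear extension of an arbitrary map of monomials; it is applied to a choice of one
  representative in each fibre of \<open>mext g\<close>.\<close>

definition map_monomials :: "(pp \<Rightarrow> pp) \<Rightarrow> 'k::field mpoly \<Rightarrow> 'k mpoly" where
  "map_monomials R p = (\<Sum>m\<in>keys p. single (R m) (lookup p m))"

lemma map_monomials_add: "map_monomials R (p + r) = map_monomials R p + map_monomials R r"
  unfolding map_monomials_def by (rule setsum_keys_plus_distrib) (auto simp: single_add)

lemma map_monomials_0 [simp]: "map_monomials R 0 = 0"
  by (simp add: map_monomials_def)

lemma map_monomials_single: "map_monomials R (single m c) = single (R m) c"
  by (cases "c = 0") (auto simp: map_monomials_def)

lemma map_monomials_sum: "map_monomials R (sum f A) = (\<Sum>x\<in>A. map_monomials R (f x))"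
  by (induction A rule: infinite_finite_induct) (auto simp: map_monomials_add)

lemma map_monomials_psub: "map_monomials R (psub g p) = (\<Sum>m\<in>keys p. single (R (mext g m)) (lookup p m))"
  by (simp add: psub_def map_monomials_sum map_monomials_single)

text \<open>Replacing every monomial of \<open>p\<close> by the representative of its fibre gives
  the image of \<open>psub g p = 0\<close> under a linear map. Hence \<open>p\<close> is the sum of
  the differences between its terms and their representatives, that is, a combination of binomials
  within fibres.\<close>

lemma pker_subset:
  fixes I :: "'k::field mpoly set"
  assumes I: "ideal I (PR N)"
    and fib: "\<And>u u'. u \<in> monomials N \<Longrightarrow> u' \<in> monomials N \<Longrightarrow> mext g u = mext g u' \<Longrightarrow> mpmon u - mpmon u' \<in> I"
  shows "pker N g \<subseteq> I"
proof
  fix p :: "'k mpoly" assume "p \<in> pker N g"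
  then have p: "keys p \<subseteq> monomials N" "psub g p = 0" by (auto simp: pker_def PR_carrier)
  define R where "R w = (SOME u. u \<in> monomials N \<and> mext g u = w)" for w
  have R: "R (mext g u) \<in> monomials N" "mext g (R (mext g u)) = mext g u" if "u \<in> monomials N" for u
    using someI[of "\<lambda>u'. u' \<in> monomials N \<and> mext g u' = mext g u" u] that by (simp_all add: R_def)
  have "(\<Sum>u\<in>keys p. single (R (mext g u)) (lookup p u)) = 0"
    using map_monomials_psub[of R g p] p(2) by simp
  then have "p = (\<Sum>u\<in>keys p. single u (lookup p u) - single (R (mext g u)) (lookup p u))"
    using mpoly_expand[of p] by (simp add: sum_subtractf)
  also have "\<dots> \<in> I"
  proof (rule ideal_PR_sum[OF I])
    fix u assume "u \<in> keys p"
    then have u: "u \<in> monomials N" using p by blast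
    have "const (lookup p u) * (mpmon u - mpmon (R (mext g u))) \<in> I"
      by (intro ideal_PR_mult[OF I] fib PR_const) (use u R in auto)
    then show "single u (lookup p u) - single (R (mext g u)) (lookup p u) \<in> I"
      by (simp add: single_eq_const_mult right_diff_distrib)
  qed
  finally show "p \<in> I" .
qed

lemma ideal_combinations:
  fixes z :: "nat \<Rightarrow> 'k::field mpoly"
  assumes z: "\<And>l. l < m \<Longrightarrow> z l \<in> carrier (PR N)"
  shows "ideal {p. \<exists>d. (\<forall>l<m. d l \<in> carrier (PR N)) \<and> p = (\<Sum>l<m. z l * d l)} (PR N)" (is "ideal ?I _")
proof -
  have memI: "(\<Sum>l<m. z l * d l) \<in> ?I" if "\<And>l. l < m \<Longrightarrow> d l \<in> carrier (PR N)" for d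
    using that by blast
  have memE: "\<exists>d. (\<forall>l<m. d l \<in> carrier (PR N)) \<and> p = (\<Sum>l<m. z l * d l)" if "p \<in> ?I" for p
    using that by (rule CollectD)
  have carr: "p \<in> carrier (PR N)" if p: "p \<in> ?I" for p
  proof -
    obtain d where d: "\<forall>l<m. d l \<in> carrier (PR N)" "p = (\<Sum>l<m. z l * d l)" using memE[OF p] by (elim exE conjE)
    show ?thesis unfolding d(2) by (intro PR_sum PR_mult z) (use d(1) in auto)
  qed
  have zero: "0 \<in> ?I" using memI[of "\<lambda>_. 0"] PR_0[of N] by simp
  have add: "a + b \<in> ?I" if a: "a \<in> ?I" and b: "b \<in> ?I" for a b
  proof -
    obtain d where d: "\<forall>l<m. d l \<in> carrier (PR N)" "a = (\<Sum>l<m. z l * d l)" using memE[OF a] by (elim exE conjE)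
    obtain d' where d': "\<forall>l<m. d' l \<in> carrier (PR N)" "b = (\<Sum>l<m. z l * d' l)" using memE[OF b] by (elim exE conjE)
    have "a + b = (\<Sum>l<m. z l * (d l + d' l))" unfolding d(2) d'(2) by (simp add: distrib_left sum.distrib)
    moreover have "(\<Sum>l<m. z l * (d l + d' l)) \<in> ?I" by (rule memI) (use d(1) d'(1) PR_add in blast)
    ultimately show ?thesis by (simp only:)
  qed
  have mult: "x * a \<in> ?I" if a: "a \<in> ?I" and x: "x \<in> carrier (PR N)" for a x
  proof -
    obtain d where d: "\<forall>l<m. d l \<in> carrier (PR N)" "a = (\<Sum>l<m. z l * d l)" using memE[OF a] by (elim exE conjE)
    have "x * a = (\<Sum>l<m. z l * (x * d l))" unfolding d(2) by (simp add: sum_distrib_left mult.left_commute)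
    moreover have "(\<Sum>l<m. z l * (x * d l)) \<in> ?I" by (rule memI) (use d(1) x PR_mult in blast)
    ultimately show ?thesis by (simp only:)
  qed
  show ?thesis
    unfolding ideal_PR_iff by (intro conjI ballI subsetI zero) (rule carr add mult; assumption)+
qed

lemma ideal_combinations_self:
  fixes z :: "nat \<Rightarrow> 'k::field mpoly"
  assumes "l < m"
  shows "\<exists>d. (\<forall>l<m. d l \<in> carrier (PR N)) \<and> z l = (\<Sum>l<m. z l * d l)"
proof (intro exI[of _ "\<lambda>i. if i = l then 1 else 0"] conjI allI impI)
  show "z l = (\<Sum>i<m. z i * (if i = l then 1 else 0))"
    using sum_delta_left(2)[OF assms, of z] by simp
  show "(if i = l then 1 else 0) \<in> carrier (PR N :: 'k mpoly ring)" for i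
    by (simp add: PR_0 PR_1)
qed

text \<open>The variable \<open>t\<close> of the Rees algebra is the variable with index \<open>n + 1\<close> of \<open>PR (n + 1)\<close>.\<close>

locale rees =
  fixes n q :: nat and s :: "nat \<Rightarrow> nat"
  assumes s_inj: "inj_on s {1..q}" and s_range: "s ` {1..q} \<subseteq> {1..n}"
begin

definition rg :: "nat \<Rightarrow> pp" where
  "rg v = (if v \<le> n then single v 1 else single (s (v - n)) 1 + single (n + 1) 1)"

definition minor :: "nat \<Rightarrow> nat \<Rightarrow> 'k::field mpoly" where
  "minor i j = var (s i) * var (n + j) - var (s j) * var (n + i)"

lemma s_bounds: "i \<in> {1..q} \<Longrightarrow> 1 \<le> s i \<and> s i \<le> n"
  using subsetD[OF s_range imageI[of i "{1..q}" s]] by simp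

lemma s_eq_iff: "i \<in> {1..q} \<Longrightarrow> j \<in> {1..q} \<Longrightarrow> s i = s j \<longleftrightarrow> i = j"
  using inj_on_eq_iff[OF s_inj] .

lemma rg_X: "v \<le> n \<Longrightarrow> rg v = single v 1"
  by (simp add: rg_def)

lemma rg_T: "i \<in> {1..q} \<Longrightarrow> rg (n + i) = single (s i) 1 + single (n + 1) 1"
  by (simp add: rg_def)

lemma minor_carrier: "i \<in> {1..q} \<Longrightarrow> j \<in> {1..q} \<Longrightarrow> minor i j \<in> carrier (PR (n + q))"
  unfolding minor_def using s_bounds[of i] s_bounds[of j]
  by (intro PR_diff PR_mult PR_var) auto

lemma psub_minor: "i \<in> {1..q} \<Longrightarrow> j \<in> {1..q} \<Longrightarrow> psub rg (minor i j :: 'k::field mpoly) = 0"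
  using s_bounds[of i] s_bounds[of j] unfolding minor_def
  by (simp add: psub_diff psub_mult rg_X rg_T mpmon_add[symmetric]) (simp add: add_ac)

lemma minor_in_pker: "i \<in> {1..q} \<Longrightarrow> j \<in> {1..q} \<Longrightarrow> minor i j \<in> pker (n + q) rg"
  by (simp add: pker_def minor_carrier psub_minor)

lemma mext_rg_X: "keys u \<subseteq> {..n} \<Longrightarrow> mext rg u = u"
  using mext_cong[of u rg "\<lambda>v. single v 1"] rg_X mext_id by (metis atMost_iff subsetD)

lemma rg_carrier:
  assumes "v \<in> {1..n + q}"
  shows "rg v \<in> monomials (n + 1)"
proof (cases "v \<le> n")
  case False
  then have "v - n \<in> {1..q}" using assms by auto
  then show ?thesis using False s_bounds[of "v - n"] unfolding rg_def by (auto intro!: monomials_single)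
qed (use assms in \<open>auto simp: rg_def intro!: monomials_single\<close>)

text \<open>The exponent of t in the image counts the T variables, since exactly these are mapped to
  multiples of t.\<close>

lemma rg_lookup_t:
  assumes "u \<in> monomials (n + q)" "lookup (mext rg u) (n + 1) = 0"
  shows "keys u \<subseteq> {..n}"
proof
  fix v assume "v \<in> keys u"
  then obtain u' where u: "u = single v 1 + u'" using pp_split[of u v] by (auto simp: in_keys_iff)
  show "v \<in> {..n}"
  proof (rule ccontr)
    assume "v \<notin> {..n}"
    then have "lookup (rg v) (n + 1) > 0" by (simp add: rg_def lookup_add)
    then show False using assms(2) unfolding u by (simp add: mext_add lookup_add)
  qed
qed

lemma rg_split_T:
  assumes "u \<in> monomials (n + q)" "lookup (mext rg u) (n + 1) > 0"
  obtains i u' where "i \<in> {1..q}" "u = single (n + i) 1 + u'"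
proof -
  have "\<not> keys u \<subseteq> {..n}"
  proof
    assume A: "keys u \<subseteq> {..n}"
    then have "n + 1 \<notin> keys u" by auto
    then show False using assms(2) mext_rg_X[OF A] by (simp add: in_keys_iff)
  qed
  then obtain v where v: "v \<in> keys u" "v > n" by (meson atMost_iff not_le subsetI)
  then have "v - n \<in> {1..q}" using assms(1) by (auto simp: monomials_def)
  moreover obtain u' where "u = single v 1 + u'" using v pp_split[of u v] by (auto simp: in_keys_iff)
  ultimately show ?thesis using that[of "v - n" u'] v by simp
qed

lemma lookup_mext_rg:
  assumes "u \<in> monomials (n + q)" "i \<in> {1..q}"
  shows "lookup (mext rg u) (s i) = lookup u (s i) + lookup u (n + i)"
  using assms(1)
proof (induction u rule: pp_induct)
  case (add v u')
  have v: "v \<in> {1..n + q}" and u': "u' \<in> monomials (n + q)"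
    using add(3) monomials_add[of "single v 1" u'] by (auto simp: monomials_def keys_plus_pp)
  have "lookup (rg v) (s i) = lookup (single v (1::nat)) (s i) + lookup (single v (1::nat)) (n + i)"
  proof (cases "v \<le> n")
    case True
    then show ?thesis using assms(2) by (simp add: rg_X lookup_single when_def)
  next
    case False
    then have "v - n \<in> {1..q}" using v by auto
    then show ?thesis using False s_eq_iff[of "v - n" i] s_bounds[OF assms(2)] assms(2)
      by (auto simp: rg_def lookup_add lookup_single when_def)
  qed
  then show ?case using add.IH u' by (simp add: mext_add lookup_add)
qed simp

text \<open>Induction on the exponent of t. Let T_i divide \<open>u\<close>. If T_i also divides
  \<open>u'\<close>, it is cancelled. Otherwise y_i divides the common image and hence
  \<open>u'\<close> itself, and some T_j divides \<open>u'\<close>; one minor exchanges y_i T_j for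
  y_j T_i, after which T_i can be cancelled.\<close>

lemma fibre:
  fixes I :: "'k::field mpoly set"
  assumes I: "ideal I (PR (n + q))"
    and minors: "\<And>i j. i \<in> {1..q} \<Longrightarrow> j \<in> {1..q} \<Longrightarrow> minor i j \<in> I"
    and u: "u \<in> monomials (n + q)" "u' \<in> monomials (n + q)" "mext rg u = mext rg u'"
  shows "mpmon u - mpmon u' \<in> I"
  using u
proof (induction "lookup (mext rg u) (n + 1)" arbitrary: u u')
  case 0
  have "keys u \<subseteq> {..n}" by (rule rg_lookup_t[OF 0(2)]) (use 0(1) in simp)
  moreover have "keys u' \<subseteq> {..n}" by (rule rg_lookup_t[OF 0(3)]) (use 0(1,4) in simp)
  ultimately have "u = u'" using mext_rg_X[of u] mext_rg_X[of u'] 0(4) by metis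
  then show ?case using ideal_PR_0[OF I] by simp
next
  case (Suc k)
  obtain i w where i: "i \<in> {1..q}" and w: "u = single (n + i) 1 + w"
    by (rule rg_split_T[OF Suc(3)]) (use Suc(2) in simp_all)
  have w_mon: "w \<in> monomials (n + q)" using Suc(3) unfolding w by simp
  have cancel: "mpmon u - mpmon (single (n + i) 1 + w') \<in> I"
    if w': "single (n + i) 1 + w' \<in> monomials (n + q)" "mext rg (single (n + i) 1 + w') = mext rg u" for w'
  proof -
    have eq: "mext rg w = mext rg w'" using w' unfolding w mext_add by simp
    have "mpmon w - mpmon w' \<in> I"
    proof (rule Suc(1))
      show "k = lookup (mext rg w) (n + 1)"
        using Suc(2) i s_bounds[OF i] unfolding w mext_add by (simp add: rg_T lookup_add lookup_single)
    qed (use w_mon w'(1) eq in simp_all)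
    from ideal_PR_mult[OF I this PR_var[of "n + i"]] i
    show ?thesis by (simp add: w mpmon_add var_def right_diff_distrib)
  qed
  show ?case
  proof (cases "lookup u' (n + i) > 0")
    case True
    then obtain w' where w': "u' = single (n + i) 1 + w'" using pp_split by blast
    show ?thesis unfolding w' by (rule cancel) (use Suc(4,5) in \<open>simp_all add: w'\<close>)
  next
    case False
    obtain j w1 where j: "j \<in> {1..q}" and w1: "u' = single (n + j) 1 + w1"
      by (rule rg_split_T[OF Suc(4)]) (use Suc(2,5) in simp_all)
    have "lookup (mext rg u) (s i) > 0"
      unfolding w mext_add using i by (simp add: rg_T lookup_add)
    then have "lookup u' (s i) > 0" using Suc(5) False lookup_mext_rg[OF Suc(4) i] by simp
    then have "lookup w1 (s i) > 0"
      using s_bounds[OF i] j unfolding w1 by (simp add: lookup_add lookup_single when_def split: if_splits)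
    then obtain w2 where w2: "w1 = single (s i) 1 + w2" using pp_split by blast
    define w' where "w' = single (s j) 1 + w2"
    have mon: "w2 \<in> monomials (n + q)" using Suc(4) by (simp add: w1 w2)
    have "mpmon u - mpmon (single (n + i) 1 + w') \<in> I"
    proof (rule cancel)
      show "single (n + i) 1 + w' \<in> monomials (n + q)"
        using mon i j s_bounds[OF j] by (auto simp: w'_def intro!: monomials_single)
      show "mext rg (single (n + i) 1 + w') = mext rg u"
        unfolding Suc(5) w1 w2 w'_def mext_add
        using i j s_bounds[OF i] s_bounds[OF j] by (simp add: rg_X rg_T) (simp add: add_ac)
    qed
    moreover have "mpmon u' - mpmon (single (n + i) 1 + w') = mpmon w2 * minor i j"
      by (simp add: w1 w2 w'_def minor_def mpmon_add var_def algebra_simps)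
    moreover have "mpmon w2 * minor i j \<in> I"
      by (intro ideal_PR_mult[OF I] minors i j PR_mpmon mon)
    ultimately have "(mpmon u - mpmon (single (n + i) 1 + w')) - (mpmon u' - mpmon (single (n + i) 1 + w')) \<in> I"
      using ideal_PR_diff[OF I] by metis
    then show ?thesis by simp
  qed
qed

lemma pker_rg_minimal:
  fixes I :: "'k::field mpoly set"
  assumes "ideal I (PR (n + q))" "\<And>i j. i \<in> {1..q} \<Longrightarrow> j \<in> {1..q} \<Longrightarrow> minor i j \<in> I"
  shows "pker (n + q) rg \<subseteq> I"
  by (rule pker_subset[OF assms(1)]) (rule fibre[OF assms])

section \<open>Stanley decomposition of the ideal of minors\<close>

definition ps :: "(nat \<times> nat) set" where
  "ps = {(i, j). 1 \<le> i \<and> i < j \<and> j \<le> q}"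

text \<open>Chosen to make y_i T_j the leading term of the minor of i < j: its weight is j, while
  y_j T_i has weight i.\<close>

definition wtT :: "nat \<Rightarrow> nat" where
  "wtT v = (if v \<le> n then 0 else v - n)"

text \<open>Excluding y_k for k < i and T_k for k > j assigns a multiple of several leading terms to
  one pair only: i is the smallest index of a y and j the largest index of a T dividing it.\<close>

definition Lp :: "nat \<times> nat \<Rightarrow> nat list" where
  "Lp = (\<lambda>(i, j). map s [1..<i] @ map (\<lambda>k. n + k) [Suc j..<Suc q])"

lemma Lp_set: "set (Lp (i, j)) = s ` {1..<i} \<union> (\<lambda>k. n + k) ` {Suc j..<Suc q}"
  unfolding Lp_def by (simp del: upt_Suc add: image_Un)

lemma Lp_distinct: "(i, j) \<in> ps \<Longrightarrow> distinct (Lp (i, j))"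
proof -
  assume "(i, j) \<in> ps"
  then have sub: "{1..<i} \<subseteq> {1..q}" by (auto simp: ps_def)
  have "inj_on s {1..<i}" using inj_on_subset[OF s_inj sub] .
  have "s ` {1..<i} \<subseteq> {1..n}" using image_mono[OF sub, of s] s_range by blast
  then have "s ` {1..<i} \<inter> (\<lambda>k. n + k) ` {Suc j..<Suc q} = {}" by fastforce
  with \<open>inj_on s {1..<i}\<close> show "distinct (Lp (i, j))"
    unfolding Lp_def by (simp del: upt_Suc add: distinct_map)
qed

lemma finite_ps [simp]: "finite ps"
  by (rule finite_subset[of _ "{1..q} \<times> {1..q}"]) (auto simp: ps_def)

lemma lookup_minor_mult:
  assumes "i \<in> {1..q}" "j \<in> {1..q}"
  shows "lookup (minor i j * p) w =
    lookup (single (single (s i) 1 + single (n + j) 1) 1 * p) w - lookup (single (single (s j) 1 + single (n + i) 1) 1 * (p :: 'k::field mpoly)) w"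
  by (simp add: minor_def var_def mpmon_def mult_single left_diff_distrib lookup_minus)

text \<open>The indices are recovered from the product: no y of index below i and no T of index
  above j can divide it.\<close>

lemma lead_unique:
  assumes ij: "(i, j) \<in> ps" "(i', j') \<in> ps"
    and u: "keys u \<inter> set (Lp (i, j)) = {}" "keys u' \<inter> set (Lp (i', j')) = {}"
    and eq: "single (s i) 1 + single (n + j) 1 + u = single (s i') 1 + single (n + j') 1 + (u' :: pp)"
  shows "i = i' \<and> j = j' \<and> u = u'"
proof -
  have b: "i \<in> {1..q}" "j \<in> {1..q}" "i' \<in> {1..q}" "j' \<in> {1..q}" using ij by (auto simp: ps_def)
  have keq: "insert (s i) (insert (n + j) (keys u)) = insert (s i') (insert (n + j') (keys u'))"
    using arg_cong[OF eq, of keys] by (simp add: keys_plus_pp insert_commute)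
  have sn: "s i \<le> n" "s i' \<le> n" using s_bounds b by auto
  have "\<not> i < i'"
  proof
    assume "i < i'"
    then have "s i \<in> set (Lp (i', j'))" using b by (auto simp: Lp_set)
    then have "s i \<notin> keys u'" using u by blast
    moreover have "s i \<noteq> s i'" using s_eq_iff b \<open>i < i'\<close> by auto
    moreover have "s i \<noteq> n + j'" using sn b by auto
    ultimately show False using keq by blast
  qed
  moreover have "\<not> i' < i"
  proof
    assume "i' < i"
    then have "s i' \<in> set (Lp (i, j))" using b by (auto simp: Lp_set)
    then have "s i' \<notin> keys u" using u by blast
    moreover have "s i' \<noteq> s i" using s_eq_iff b \<open>i' < i\<close> by auto
    moreover have "s i' \<noteq> n + j" using sn b by auto
    ultimately show False using keq by blast
  qed
  moreover have "\<not> j < j'"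
  proof
    assume "j < j'"
    then have "n + j' \<in> set (Lp (i, j))" using b by (auto simp: Lp_set)
    then have "n + j' \<notin> keys u" using u by blast
    moreover have "n + j' \<noteq> s i" "n + j' \<noteq> n + j" using sn b \<open>j < j'\<close> by auto
    ultimately show False using keq by blast
  qed
  moreover have "\<not> j' < j"
  proof
    assume "j' < j"
    then have "n + j \<in> set (Lp (i', j'))" using b by (auto simp: Lp_set)
    then have "n + j \<notin> keys u'" using u by blast
    moreover have "n + j \<noteq> s i'" "n + j \<noteq> n + j'" using sn b \<open>j' < j\<close> by auto
    ultimately show False using keq by blast
  qed
  ultimately have "i = i'" "j = j'" by auto
  then show ?thesis using eq by simp
qed

text \<open>A term whose product with y_i T_j has maximal weight cannot be cancelled: trailing
  products y_j T_i v are lighter than the corresponding leading ones, and leading products are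
  distinct by \<open>lead_unique\<close>.\<close>

lemma minors_indep:
  fixes c :: "nat \<times> nat \<Rightarrow> 'k::field mpoly"
  assumes std: "\<And>\<pi> u. \<pi> \<in> ps \<Longrightarrow> u \<in> keys (c \<pi>) \<Longrightarrow> keys u \<inter> set (Lp \<pi>) = {}"
    and zero: "(\<Sum>\<pi>\<in>ps. minor (fst \<pi>) (snd \<pi>) * c \<pi>) = 0" and \<pi>: "\<pi> \<in> ps"
  shows "c \<pi> = 0"
proof (rule ccontr)
  assume "c \<pi> \<noteq> 0"
  define T where "T = (SIGMA \<pi>:ps. keys (c \<pi>))"
  define f where "f = (\<lambda>(\<pi> :: nat \<times> nat, u). weight wtT u + snd \<pi>)"
  have "finite T" by (simp add: T_def)
  moreover have "T \<noteq> {}"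
  proof -
    obtain u where "u \<in> keys (c \<pi>)" using \<open>c \<pi> \<noteq> 0\<close> keys_eq_empty by fastforce
    then have "(\<pi>, u) \<in> T" using \<pi> by (simp add: T_def)
    then show ?thesis by blast
  qed
  ultimately have "Max (f ` T) \<in> f ` T" "\<And>t'. t' \<in> T \<Longrightarrow> f t' \<le> Max (f ` T)"
    by (auto intro: Max_in)
  then obtain t where t: "t \<in> T" "\<And>t'. t' \<in> T \<Longrightarrow> f t' \<le> f t"
    by (metis imageE)
  obtain i j u where tt: "t = ((i, j), u)" by (metis surj_pair)
  have ij: "(i, j) \<in> ps" and u: "u \<in> keys (c (i, j))" using t(1) tt by (auto simp: T_def)
  define w where "w = single (s i) 1 + single (n + j) 1 + u"
  have bnd: "fst \<pi> \<in> {1..q}" "snd \<pi> \<in> {1..q}" "fst \<pi> < snd \<pi>" if "\<pi> \<in> ps" for \<pi>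
    using that by (auto simp: ps_def)
  have wT: "wtT (s i) = 0" "wtT (n + i) = i" if "i \<in> {1..q}" for i
    using s_bounds[OF that] that by (simp_all add: wtT_def)
  have wtw: "weight wtT w = f t"
    using bnd[OF ij] by (simp add: w_def f_def tt wT)
  have "lookup (minor (fst \<pi>) (snd \<pi>) * c \<pi>) w = (if \<pi> = (i, j) then lookup (c (i, j)) u else 0)"
    if \<pi>: "\<pi> \<in> ps" for \<pi>
  proof -
    obtain i' j' where \<pi>e: "\<pi> = (i', j')" by fastforce
    have b: "i' \<in> {1..q}" "j' \<in> {1..q}" "i' < j'" using bnd[OF \<pi>] \<pi>e by auto
    have z2: "lookup (single (single (s j') 1 + single (n + i') 1) 1 * c \<pi>) w = 0"
    proof (rule ccontr)
      assume "lookup (single (single (s j') 1 + single (n + i') 1) 1 * c \<pi>) w \<noteq> 0"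
      then have "w \<in> keys (single (single (s j') 1 + single (n + i') 1) 1 * c \<pi>)" by (simp add: in_keys_iff)
      then obtain v where v: "v \<in> keys (c \<pi>)" "w = single (s j') 1 + single (n + i') 1 + v"
        using keys_single_mult[of "single (s j') 1 + single (n + i') 1" 1 "c \<pi>"] by auto
      have "weight wtT w = i' + weight wtT v" using v(2) b by (simp add: wT)
      moreover have "f (\<pi>, v) \<le> f t" using t(2)[of "(\<pi>, v)"] v(1) \<pi> by (simp add: T_def)
      ultimately show False using wtw b(3) by (simp add: f_def \<pi>e)
    qed
    have z1: "lookup (single (single (s i') 1 + single (n + j') 1) 1 * c \<pi>) w = (if \<pi> = (i, j) then lookup (c (i, j)) u else 0)"
    proof (cases "\<pi> = (i, j)")
      case True
      then have "i' = i" "j' = j" using \<pi>e by auto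
      then show ?thesis using True lookup_single_mult[of "single (s i) 1 + single (n + j) 1" 1 "c (i, j)" u]
        by (simp add: w_def)
    next
      case False
      have "w \<notin> keys (single (single (s i') 1 + single (n + j') 1) 1 * c \<pi>)"
      proof
        assume "w \<in> keys (single (single (s i') 1 + single (n + j') 1) 1 * c \<pi>)"
        then obtain v where v: "v \<in> keys (c \<pi>)" "w = single (s i') 1 + single (n + j') 1 + v"
          using keys_single_mult[of "single (s i') 1 + single (n + j') 1" 1 "c \<pi>"] by auto
        have "i = i' \<and> j = j' \<and> u = v"
          by (rule lead_unique) (use ij \<pi> \<pi>e std[OF ij u] std[OF \<pi> v(1)] v(2) w_def in auto)
        then show False using False \<pi>e by simp
      qed
      then show ?thesis using False by (simp add: in_keys_iff)
    qed
    show ?thesis using lookup_minor_mult[OF b(1,2), of "c \<pi>" w] z1 z2 by (simp add: \<pi>e)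
  qed
  then have "lookup (\<Sum>\<pi>\<in>ps. minor (fst \<pi>) (snd \<pi>) * c \<pi>) w = (\<Sum>\<pi>\<in>ps. if \<pi> = (i, j) then lookup (c (i, j)) u else 0)"
    unfolding lookup_sum by (intro sum.cong) auto
  also have "\<dots> = lookup (c (i, j)) u" using ij by simp
  finally show False using zero u by (simp add: in_keys_iff)
qed

text \<open>The rewriting rules expand 3 by 3 determinants with a repeated row: y_k D_ij = y_i D_kj
  - y_j D_ki for k < i, and T_k D_ij = T_j D_ik - T_i D_jk for k > j, where D_ij is the minor. With
  the offset i for D_ij both rules decrease the weight: the offset falls from i to k in the first,
  and the total falls from k + i to j + i in the second.\<close>

lemma minors_stanley:
  obtains h where "bij_betw h {..<card ps} ps"
    and "stanley_gens (n + q) 1 (card ps) 2 (\<lambda>_ l. minor (fst (h l)) (snd (h l)) :: 'k::field mpoly)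
      (\<lambda>l. Lp (h l)) wtT (\<lambda>l. fst (h l))"
proof -
  obtain h where h: "bij_betw h {..<card ps} ps"
    using ex_bij_betw_nat_finite[OF finite_ps] by (auto simp: atLeast0LessThan)
  define m where "m = card ps"
  define z :: "nat \<Rightarrow> 'k mpoly" where "z l = minor (fst (h l)) (snd (h l))" for l
  have hp: "h l \<in> ps" if "l < m" for l
    using h that by (auto simp: bij_betw_def m_def)
  have inj: "h l = h l' \<Longrightarrow> l = l'" if "l < m" "l' < m" for l l'
    using h that by (auto simp: bij_betw_def m_def inj_on_def)
  have hs: "\<exists>l<m. h l = \<pi>" if "\<pi> \<in> ps" for \<pi>
  proof -
    have "\<pi> \<in> h ` {..<m}" using that bij_betw_imp_surj_on[OF h] by (simp add: m_def)
    then show ?thesis by auto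
  qed
  have two: "(\<Sum>l<m. z l * (if l = l1 then a else if l = l2 then b else 0)) = z l1 * a + z l2 * b"
    if "l1 < m" "l2 < m" "l1 \<noteq> l2" for l1 l2 and a b :: "'k mpoly"
  proof -
    have "(\<Sum>l<m. z l * (if l = l1 then a else if l = l2 then b else 0)) =
        (\<Sum>l<m. (if l = l1 then z l1 * a else 0) + (if l = l2 then z l2 * b else 0))"
      using that by (intro sum.cong) auto
    then show ?thesis using that by (simp add: sum.distrib)
  qed
  \<comment> \<open>Both rules have the form of a minor times a variable minus another minor times a
    variable, so their degree and weight conditions are checked together.\<close>
  have rw: "\<exists>c. (\<forall>k<m. c k \<in> homog (n + q) 1 \<and> (\<forall>u\<in>keys (c k). weight wtT u + fst (h k) < W)) \<and> X = (\<Sum>k<m. z k * c k)"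
    if pp: "\<pi>1 \<in> ps" "\<pi>2 \<in> ps" "\<pi>1 \<noteq> \<pi>2" "X = minor (fst \<pi>1) (snd \<pi>1) * var x1 - minor (fst \<pi>2) (snd \<pi>2) * var x2"
      "x1 \<in> {1..n + q}" "x2 \<in> {1..n + q}" "wtT x1 + fst \<pi>1 < W" "wtT x2 + fst \<pi>2 < W" for \<pi>1 \<pi>2 x1 x2 X W
  proof -
    obtain l1 l2 where l: "l1 < m" "h l1 = \<pi>1" "l2 < m" "h l2 = \<pi>2" using hs pp(1,2) by metis
    then have "l1 \<noteq> l2" using pp(3) by auto
    show ?thesis
    proof (intro exI[of _ "\<lambda>l. if l = l1 then var x1 else if l = l2 then - var x2 else 0"] conjI allI impI ballI)
      show "X = (\<Sum>k<m. z k * (if k = l1 then var x1 else if k = l2 then - var x2 else 0))"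
        unfolding two[OF l(1,3) \<open>l1 \<noteq> l2\<close>] using pp(4) l by (simp add: z_def)
      show "(if k = l1 then var x1 else if k = l2 then - var x2 else 0) \<in> homog (n + q) 1" for k
        using pp(5,6) by (auto intro!: homog_var homog_uminus)
      fix k u assume u: "u \<in> keys (if k = l1 then var x1 else if k = l2 then - var x2 else 0 :: 'k mpoly)"
      then have "(k = l1 \<and> u = single x1 1) \<or> (k = l2 \<and> u = single x2 1)"
        by (auto simp: var_def in_keys_iff mpmon_def lookup_single when_def split: if_splits)
      then show "weight wtT u + fst (h k) < W" using pp(7,8) l by auto
    qed
  qed
  have "stanley_gens (n + q) 1 m 2 (\<lambda>_. z) (\<lambda>l. Lp (h l)) wtT (\<lambda>l. fst (h l))"
  proof
    fix l assume l: "l < m"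
    obtain i j where ij: "h l = (i, j)" by fastforce
    have p: "(i, j) \<in> ps" using hp[OF l] ij by simp
    then have b: "1 \<le> i" "i < j" "j \<le> q" "i \<in> {1..q}" "j \<in> {1..q}" by (auto simp: ps_def)
    have sb: "1 \<le> s k" "s k \<le> n" "wtT (s k) = 0" "wtT (n + k) = k" if "k \<in> {1..q}" for k
      using s_bounds[OF that] that by (simp_all add: wtT_def)
    show "z l \<in> homog (n + q) 2"
      using homog_mult[OF homog_var[of "s i" "n + q"] homog_var[of "n + j" "n + q"]]
        homog_mult[OF homog_var[of "s j" "n + q"] homog_var[of "n + i" "n + q"]] sb[OF b(4)] sb[OF b(5)] b
      by (auto simp: z_def ij minor_def intro!: homog_diff)
    show "set (Lp (h l)) \<subseteq> {1..n + q}"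
      unfolding ij Lp_set using sb b by fastforce
    show "distinct (Lp (h l))" unfolding ij by (rule Lp_distinct[OF p])
    fix x assume "x \<in> set (Lp (h l))"
    then have "x \<in> s ` {1..<i} \<union> (\<lambda>k. n + k) ` {Suc j..<Suc q}" unfolding ij Lp_set .
    then consider k where "1 \<le> k" "k < i" "x = s k" | k where "j < k" "k \<le> q" "x = n + k"
      by (elim UnE imageE) auto
    then have "\<exists>c. (\<forall>k<m. c k \<in> homog (n + q) 1 \<and> (\<forall>u\<in>keys (c k). weight wtT u + fst (h k) < wtT x + fst (h l))) \<and>
        var x * z l = (\<Sum>k<m. z k * c k)"
    proof cases
      case (1 k)
      have k: "k \<in> {1..q}" using 1 b by auto
      show ?thesis
      proof (rule rw[of "(k, j)" "(k, i)" _ "s i" "s j"])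
        show "var x * z l = minor (fst (k, j)) (snd (k, j)) * var (s i) - minor (fst (k, i)) (snd (k, i)) * var (s j)"
          by (simp add: z_def ij 1 minor_def algebra_simps)
      qed (use 1 b sb[OF k] sb[OF b(4)] sb[OF b(5)] ij in \<open>auto simp: ps_def\<close>)
    next
      case (2 k)
      have k: "k \<in> {1..q}" using 2 b by auto
      show ?thesis
      proof (rule rw[of "(i, k)" "(j, k)" _ "n + j" "n + i"])
        show "var x * z l = minor (fst (i, k)) (snd (i, k)) * var (n + j) - minor (fst (j, k)) (snd (j, k)) * var (n + i)"
          by (simp add: z_def ij 2 minor_def algebra_simps)
      qed (use 2 b sb[OF k] sb[OF b(4)] sb[OF b(5)] ij in \<open>auto simp: ps_def\<close>)
    qed
    then show "\<exists>c. (\<forall>k<m. c k \<in> homog (n + q) 1 \<and> (\<forall>u\<in>keys (c k). weight wtT u + fst (h k) < wtT x + fst (h l))) \<and>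
        (\<forall>i<(1::nat). var x * z l = (\<Sum>k<m. z k * c k))" by simp
  next
    fix c l assume std: "\<And>l u. l < m \<Longrightarrow> u \<in> keys (c l) \<Longrightarrow> keys u \<inter> set (Lp (h l)) = {}"
      and zero: "\<And>i::nat. i < 1 \<Longrightarrow> (\<Sum>l<m. z l * c l) = 0" and l: "l < m"
    define hi where "hi = the_inv_into {..<m} h"
    have hi: "hi (h l) = l" if "l < m" for l
      using h that unfolding hi_def m_def by (auto simp: bij_betw_def intro: the_inv_into_f_f)
    have hi2: "hi \<pi> < m" "h (hi \<pi>) = \<pi>" if "\<pi> \<in> ps" for \<pi>
      using hs[OF that] hi by auto
    have "c (hi (h l)) = 0"
    proof (rule minors_indep[of "\<lambda>\<pi>. c (hi \<pi>)"])
      show "keys u \<inter> set (Lp \<pi>) = {}" if "\<pi> \<in> ps" "u \<in> keys (c (hi \<pi>))" for \<pi> u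
        using std[OF hi2(1)[OF that(1)] that(2)] hi2(2)[OF that(1)] by simp
      have "(\<Sum>\<pi>\<in>ps. minor (fst \<pi>) (snd \<pi>) * c (hi \<pi>)) = (\<Sum>l<m. minor (fst (h l)) (snd (h l)) * c (hi (h l)))"
        using sum.reindex_bij_betw[OF h, of "\<lambda>\<pi>. minor (fst \<pi>) (snd \<pi>) * c (hi \<pi>)"] by (simp add: m_def)
      also have "\<dots> = (\<Sum>l<m. z l * c l)" by (intro sum.cong) (auto simp: z_def hi)
      finally show "(\<Sum>\<pi>\<in>ps. minor (fst \<pi>) (snd \<pi>) * c (hi \<pi>)) = 0" using zero[of 0] by simp
    qed (rule hp[OF l])
    then show "c l = 0" using hi[OF l] by simp
  qed
  moreover have "z = (\<lambda>l. minor (fst (h l)) (snd (h l)))" by (rule ext) (simp add: z_def)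
  ultimately show ?thesis using that[OF h] by (simp only: m_def)
qed

text \<open>Two generators provide at least one minor, and it is nonzero because only its first term
  contains y_i.\<close>

lemma regularity_pker:
  assumes "q \<ge> 2"
  shows "quot_reg (n + q) (pker (n + q) rg :: 'k::field mpoly set) = 1"
proof -
  obtain h where h: "bij_betw h {..<card ps} ps"
    and S: "stanley_gens (n + q) 1 (card ps) 2 (\<lambda>_ l. minor (fst (h l)) (snd (h l)) :: 'k mpoly)
      (\<lambda>l. Lp (h l)) wtT (\<lambda>l. fst (h l))"
    by (rule minors_stanley)
  define z :: "nat \<Rightarrow> 'k mpoly" where "z l = minor (fst (h l)) (snd (h l))" for l
  have zz: "z = (\<lambda>l. minor (fst (h l)) (snd (h l)))" by (rule ext) (simp add: z_def)
  have hp: "h l \<in> ps" if "l < card ps" for l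
    using h that by (auto simp: bij_betw_def)
  have hs: "\<exists>l<card ps. h l = \<pi>" if "\<pi> \<in> ps" for \<pi>
  proof -
    have "\<pi> \<in> h ` {..<card ps}" using that bij_betw_imp_surj_on[OF h] by simp
    then show ?thesis by auto
  qed
  define I where "I = {p. \<exists>d. (\<forall>l<card ps. d l \<in> carrier (PR (n + q))) \<and> p = (\<Sum>l<card ps. z l * d l)}"
  have zc: "z l \<in> pker (n + q) rg" if "l < card ps" for l
    unfolding z_def using hp[OF that] by (intro minor_in_pker) (auto simp: ps_def)
  have I: "ideal I (PR (n + q))"
    unfolding I_def using zc ideal_PR_carrier[OF pker_ideal] by (intro ideal_combinations) blast
  have minorI: "minor i j \<in> I" if ij: "(i, j) \<in> ps" for i j
  proof -
    obtain l where "l < card ps" "h l = (i, j)" using hs[OF ij] by blast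
    then show ?thesis using ideal_combinations_self[of l "card ps" "n + q" z] unfolding I_def by (simp add: z_def)
  qed
  have "pker (n + q) rg \<subseteq> I"
  proof (rule pker_rg_minimal[OF I])
    fix i j assume ij: "i \<in> {1..q}" "j \<in> {1..q}"
    consider "i < j" | "i = j" | "j < i" by linarith
    then show "minor i j \<in> I"
    proof cases
      case 1
      then show ?thesis using ij by (intro minorI) (auto simp: ps_def)
    next
      case 2
      then show ?thesis using ideal_PR_0[OF I] by (simp add: minor_def)
    next
      case 3
      then have "- minor j i \<in> I" using ij by (intro ideal_PR_uminus[OF I] minorI) (auto simp: ps_def)
      then show ?thesis by (simp add: minor_def)
    qed
  qed
  moreover have "I \<subseteq> pker (n + q) rg"
  proof
    fix p assume "p \<in> I"
    then obtain d where d: "\<forall>l<card ps. d l \<in> carrier (PR (n + q))" "p = (\<Sum>l<card ps. z l * d l)"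
      unfolding I_def by blast
    show "p \<in> pker (n + q) rg" unfolding d(2)
    proof (rule ideal_PR_sum[OF pker_ideal])
      fix l assume "l \<in> {..<card ps}"
      then show "z l * d l \<in> pker (n + q) rg"
        using ideal_PR_mult[OF pker_ideal zc[of l], of "d l"] d(1) by (simp add: mult.commute)
    qed
  qed
  ultimately have eq: "pker (n + q) rg = I" by blast
  have ne: "(1, 2) \<in> ps" using assms by (auto simp: ps_def)
  have c: "0 < card ps" using ne finite_ps by (metis card_gt_0_iff empty_iff)
  have z0: "z 0 \<noteq> 0"
  proof
    assume "z 0 = 0"
    obtain i j where ij: "h 0 = (i, j)" by fastforce
    have b: "1 \<le> i" "i < j" "j \<le> q" using hp[OF c] ij by (auto simp: ps_def)
    have "mpmon (single (s i) 1 + single (n + j) 1) = (mpmon (single (s j) 1 + single (n + i) 1) :: 'k mpoly)"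
      using \<open>z 0 = 0\<close> by (simp add: z_def ij minor_def var_def mpmon_add)
    then have "single (s i) 1 + single (n + j) 1 = single (s j) 1 + single (n + i) (1::nat)" by simp
    then have "lookup (single (s i) 1 + single (n + j) 1) (s i) = lookup (single (s j) 1 + single (n + i) (1::nat)) (s i)" by simp
    then show False using s_eq_iff[of i j] s_bounds[of i] b by (auto simp: lookup_add lookup_single when_def split: if_splits)
  qed
  have "linear_quotient (n + q) (card ps) z (\<lambda>l. Lp (h l)) wtT (\<lambda>l. fst (h l)) (pker (n + q) rg)"
    unfolding linear_quotient_def linear_quotient_axioms_def
  proof (intro conjI allI)
    show "stanley_gens (n + q) 1 (card ps) 2 (\<lambda>_. z) (\<lambda>l. Lp (h l)) wtT (\<lambda>l. fst (h l))"
      using S unfolding zz .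
    show "ideal (pker (n + q) rg) (PR (n + q))" by (rule pker_ideal)
    show "p \<in> pker (n + q) rg \<longleftrightarrow> (\<exists>d. (\<forall>l<card ps. d l \<in> carrier (PR (n + q))) \<and> p = (\<Sum>l<card ps. z l * d l))" for p
      unfolding eq I_def by simp
  qed (use c z0 in auto)
  then show ?thesis by (rule linear_quotient.regularity_eq_1)
qed

end

section \<open>Bounds for dimension and depth\<close>

text \<open>Scalars act through constant polynomials. This supplies the comparison between the sizes
  of independent and spanning sets for the growth argument.\<close>

interpretation mpv: vector_space "\<lambda>c (p :: 'k::field mpoly). const c * p"
  by unfold_locales (simp_all add: const_simps algebra_simps)

text \<open>The trivial-relation property also makes the family injective, so the bound for
  independent sets applies to its index set.\<close>

lemma independent_family_bound:
  fixes v :: "'i \<Rightarrow> 'k::field mpoly"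
  assumes A: "finite A" and T: "finite T"
    and span: "\<And>a. a \<in> A \<Longrightarrow> v a \<in> mpv.span T"
    and indep: "\<And>c. (\<Sum>a\<in>A. const (c a) * v a) = 0 \<Longrightarrow> \<forall>a\<in>A. c a = 0"
  shows "card A \<le> card T"
proof -
  have inj: "inj_on v A"
  proof (rule inj_onI, rule ccontr)
    fix a b assume ab: "a \<in> A" "b \<in> A" "v a = v b" "a \<noteq> b"
    define c where "c x = (if x = a then 1 else if x = b then - 1 else 0 :: 'k)" for x
    have "(\<Sum>x\<in>A. const (c x) * v x) = (\<Sum>x\<in>{a, b}. const (c x) * v x)"
      using ab A by (intro sum.mono_neutral_right) (auto simp: c_def const_simps)
    also have "\<dots> = 0" using ab by (simp add: c_def const_simps)
    finally show False using indep[of c] ab(1) by (auto simp: c_def)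
  qed
  have "mpv.independent (v ` A)"
  proof
    assume "mpv.dependent (v ` A)"
    then obtain u where u: "\<exists>w\<in>v ` A. u w \<noteq> 0" "(\<Sum>w\<in>v ` A. const (u w) * w) = 0"
      using mpv.dependent_finite[of "v ` A"] A by auto
    have "(\<Sum>a\<in>A. const (u (v a)) * v a) = 0"
      using u(2) by (simp add: sum.reindex[OF inj])
    from indep[OF this] u(1) show False by auto
  qed
  then have "card (v ` A) \<le> card T"
    using mpv.independent_span_bound[OF T] span by blast
  then show ?thesis by (simp add: card_image[OF inj])
qed

lemma in_span_mpmon:
  fixes p :: "'k::field mpoly"
  assumes "keys p \<subseteq> M"
  shows "p \<in> mpv.span (mpmon ` M)"
proof -
  have "(\<Sum>m\<in>keys p. single m (lookup p m)) \<in> mpv.span (mpmon ` M)"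
  proof (rule mpv.span_sum)
    fix m assume "m \<in> keys p"
    then have "(mpmon m :: 'k mpoly) \<in> mpv.span (mpmon ` M)" using assms by (intro mpv.span_base) blast
    then show "single m (lookup p m) \<in> mpv.span (mpmon ` M)"
      unfolding single_eq_const_mult by (rule mpv.span_scale)
  qed
  then show ?thesis using mpoly_expand[of p] by simp
qed

definition bmons :: "nat \<Rightarrow> nat \<Rightarrow> pp set" where
  "bmons N B = {m \<in> monomials N. \<forall>v. lookup m v \<le> B}"

lemma bmons_card: "finite (bmons N B)" "card (bmons N B) \<le> (B + 1) ^ N"
proof -
  define f where "f m = (\<lambda>v\<in>{1..N}. lookup m v)" for m :: pp
  have inj: "inj_on f (bmons N B)"
  proof (rule inj_onI)
    fix m m' assume m: "m \<in> bmons N B" "m' \<in> bmons N B" and eq: "f m = f m'"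
    show "m = m'"
    proof (rule poly_mapping_eqI)
      fix v
      show "lookup m v = lookup m' v"
      proof (cases "v \<in> {1..N}")
        case True
        then show ?thesis using fun_cong[OF eq, of v] by (simp add: f_def)
      next
        case False
        then have "v \<notin> keys m" "v \<notin> keys m'" using m by (auto simp: bmons_def monomials_def)
        then show ?thesis by (simp add: in_keys_iff)
      qed
    qed
  qed
  have sub: "f ` bmons N B \<subseteq> {1..N} \<rightarrow>\<^sub>E {..B}"
    by (auto simp: f_def bmons_def)
  have fin: "finite ({1..N} \<rightarrow>\<^sub>E {..B})" by (rule finite_PiE) auto
  show "finite (bmons N B)" using finite_imageD[OF finite_subset[OF sub fin] inj] .
  have "card (bmons N B) \<le> card ({1..N} \<rightarrow>\<^sub>E {..B})"
    using card_inj_on_le[OF inj sub fin] .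
  also have "\<dots> = (B + 1) ^ N" by (subst card_PiE) auto
  finally show "card (bmons N B) \<le> (B + 1) ^ N" .
qed

section \<open>Weakly regular sequences and polynomial growth\<close>

fun lmon :: "'k::field mpoly list \<Rightarrow> nat list \<Rightarrow> 'k mpoly" where
  "lmon (x # xs) (k # ks) = x ^ k * lmon xs ks"
| "lmon _ _ = 1"

text \<open>A common weakening of two notions. The next ideal \<open>I'\<close> may be larger than
  the one generated by \<open>I\<close> and \<open>x\<close>, so that regular sequences and strict
  chains of primes both give rise to such lists.\<close>

fun weakly_regular :: "nat \<Rightarrow> 'k::field mpoly set \<Rightarrow> 'k mpoly list \<Rightarrow> bool" where
  "weakly_regular N I [] \<longleftrightarrow> ideal I (PR N) \<and> 1 \<notin> I"
| "weakly_regular N I (x # xs) \<longleftrightarrow> ideal I (PR N) \<and> x \<in> carrier (PR N) \<and>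
    (\<forall>a\<in>carrier (PR N). x * a \<in> I \<longrightarrow> a \<in> I) \<and> (\<exists>I'. I \<subseteq> I' \<and> x \<in> I' \<and> weakly_regular N I' xs)"

lemma weakly_regular_ideal: "weakly_regular N I xs \<Longrightarrow> ideal I (PR N)"
  by (cases xs) auto

lemma weakly_regular_carrier: "weakly_regular N I xs \<Longrightarrow> set xs \<subseteq> carrier (PR N)"
  by (induction xs arbitrary: I) auto

lemma lmon_carrier: "set xs \<subseteq> carrier (PR N) \<Longrightarrow> lmon xs a \<in> carrier (PR N)"
  by (induction xs a rule: lmon.induct) (auto intro!: PR_mult PR_power PR_1)

definition box :: "nat \<Rightarrow> nat \<Rightarrow> nat list set" where
  "box D r = {a. set a \<subseteq> {..<D} \<and> length a = r}"

lemma finite_box [simp]: "finite (box D r)"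
  unfolding box_def by (rule finite_lists_length_eq) simp

lemma card_box: "card (box D r) = D ^ r"
  unfolding box_def by (simp add: card_lists_length_eq)

lemma sum_box_Suc:
  fixes f :: "nat list \<Rightarrow> 'a::comm_monoid_add"
  shows "(\<Sum>a\<in>box D (Suc r). f a) = (\<Sum>k<D. \<Sum>a\<in>box D r. f (k # a))"
proof -
  have eq: "box D (Suc r) = (\<lambda>p. fst p # snd p) ` ({..<D} \<times> box D r)"
    by (auto simp: box_def length_Suc_conv image_iff)
  have inj: "inj_on (\<lambda>p. fst p # snd p) ({..<D} \<times> box D r)" by (auto simp: inj_on_def)
  show ?thesis unfolding eq sum.reindex[OF inj] o_def by (simp add: sum.cartesian_product split_beta)
qed

text \<open>Arrange the combination by powers of the first element \<open>x\<close>. Since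
  \<open>x\<close> lies in \<open>I'\<close>, the coefficient of the zeroth power lies in
  \<open>I'\<close> and has zero coefficients by induction on the list. The remaining sum is
  \<open>x\<close> times a shorter one, and \<open>x\<close> can be cancelled modulo
  \<open>I\<close>.\<close>

lemma weakly_regular_independent:
  fixes c :: "nat list \<Rightarrow> 'k::field"
  assumes "weakly_regular N I xs" "(\<Sum>a\<in>box D (length xs). const (c a) * lmon xs a) \<in> I" "a \<in> box D (length xs)"
  shows "c a = 0"
  using assms
proof (induction xs arbitrary: I c a)
  case Nil
  then have I: "ideal I (PR N)" and one: "1 \<notin> I" by auto
  have box0: "box D 0 = {[]}" by (auto simp: box_def)
  have c: "const (c []) \<in> I" using Nil(2) by (simp add: box0)
  have "c [] = 0"
  proof (rule ccontr)
    assume "c [] \<noteq> 0"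
    have "const (inverse (c [])) * const (c []) \<in> I" by (rule ideal_PR_mult[OF I c PR_const])
    then have "const (inverse (c []) * c []) \<in> I" by (simp add: const_simps)
    then show False using one \<open>c [] \<noteq> 0\<close> by (simp add: const_simps)
  qed
  then show ?case using Nil(3) by (simp add: box0)
next
  case (Cons x xs)
  let ?B = "box D (length xs)"
  have I: "ideal I (PR N)" and x: "x \<in> carrier (PR N)"
    and reg: "\<And>a. a \<in> carrier (PR N) \<Longrightarrow> x * a \<in> I \<Longrightarrow> a \<in> I"
    using Cons.prems(1) by auto
  obtain I' where I': "I \<subseteq> I'" "x \<in> I'" "weakly_regular N I' xs" using Cons.prems(1) by auto
  note idI' = weakly_regular_ideal[OF I'(3)]
  have xs: "set xs \<subseteq> carrier (PR N)" using weakly_regular_carrier[OF I'(3)] .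
  \<comment> \<open>The coefficients \<open>g k a\<close> are arbitrary, so that after cancelling
    \<open>x\<close> the claim for the shifted family is available by induction on
    \<open>E\<close>.\<close>
  have claim: "\<forall>k<E. \<forall>a\<in>?B. g k a = 0"
    if "(\<Sum>k<E. x ^ k * (\<Sum>a\<in>?B. const (g k a) * lmon xs a)) \<in> I" for E and g :: "nat \<Rightarrow> nat list \<Rightarrow> 'k"
    using that
  proof (induction E arbitrary: g)
    case (Suc E)
    define G where "G k = (\<Sum>a\<in>?B. const (g k a) * lmon xs a)" for k
    define R where "R = (\<Sum>k<E. x ^ k * G (Suc k))"
    have Gc: "G k \<in> carrier (PR N)" for k
      unfolding G_def by (intro PR_sum PR_mult PR_const lmon_carrier xs)
    have Rc: "R \<in> carrier (PR N)"
      unfolding R_def by (intro PR_sum PR_mult PR_power x Gc)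
    have "(\<Sum>k<Suc E. x ^ k * G k) = G 0 + x * R"
      unfolding R_def by (subst sum.lessThan_Suc_shift) (simp add: sum_distrib_left mult.assoc)
    then have sumI: "G 0 + x * R \<in> I" using Suc.prems by (simp only: G_def)
    have "R * x \<in> I'" by (rule ideal_PR_mult[OF idI' I'(2) Rc])
    then have "(G 0 + x * R) - x * R \<in> I'"
      using sumI I'(1) by (intro ideal_PR_diff[OF idI']) (auto simp: mult.commute)
    then have "G 0 \<in> I'" by simp
    then have g0: "g 0 a = 0" if "a \<in> ?B" for a
      using Cons.IH[OF I'(3), of "g 0" a] that by (simp add: G_def)
    then have "G 0 = 0" by (simp add: G_def const_simps)
    then have "R \<in> I" using reg[OF Rc] sumI by simp
    then have gS: "\<forall>k<E. \<forall>a\<in>?B. g (Suc k) a = 0"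
      using Suc.IH[of "\<lambda>k. g (Suc k)"] by (simp add: R_def G_def)
    show ?case
    proof (intro allI impI ballI)
      fix k a assume "k < Suc E" "a \<in> ?B"
      then show "g k a = 0" using g0 gS by (cases k) auto
    qed
  qed simp
  have "(\<Sum>a\<in>box D (length (x # xs)). const (c a) * lmon (x # xs) a) =
      (\<Sum>k<D. x ^ k * (\<Sum>a\<in>?B. const (c (k # a)) * lmon xs a))"
    by (simp add: sum_box_Suc sum_distrib_left mult.left_commute)
  then have "\<forall>k<D. \<forall>a\<in>?B. c (k # a) = 0"
    using claim[where E = D and g = "\<lambda>k a. c (k # a)"] Cons.prems(2) by simp
  then show ?case using Cons.prems(3) by (auto simp: box_def length_Suc_conv)
qed

definition exponents_le :: "nat \<Rightarrow> 'k::field mpoly \<Rightarrow> bool" where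
  "exponents_le B p \<longleftrightarrow> (\<forall>m\<in>keys p. \<forall>v. lookup m v \<le> B)"

lemma exponents_le_mono: "exponents_le B p \<Longrightarrow> B \<le> B' \<Longrightarrow> exponents_le B' p"
  unfolding exponents_le_def using le_trans by blast

lemma exponents_le_mult:
  assumes "exponents_le B p" "exponents_le B' r"
  shows "exponents_le (B + B') (p * r)"
  unfolding exponents_le_def
proof (intro ballI allI)
  fix m v assume "m \<in> keys (p * r)"
  then obtain a b where ab: "a \<in> keys p" "b \<in> keys r" "m = a + b" using keys_mult[of p r] by auto
  then have "lookup a v \<le> B" "lookup b v \<le> B'" using assms by (auto simp: exponents_le_def)
  then show "lookup m v \<le> B + B'" by (simp add: ab(3) lookup_add)
qed

lemma exponents_le_1 [simp]: "exponents_le B 1"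
  by (simp add: exponents_le_def)

lemma exponents_le_power: "exponents_le B p \<Longrightarrow> exponents_le (k * B) (p ^ k)"
  by (induction k) (auto intro: exponents_le_mult)

lemma exponents_le_ex: "\<exists>B. exponents_le B p"
proof -
  have "lookup m v \<le> (\<Sum>m\<in>keys p. mdeg m)" if "m \<in> keys p" for m v
  proof -
    have "lookup m v \<le> mdeg m"
      unfolding mdeg_def by (cases "v \<in> keys m") (auto simp: in_keys_iff intro: member_le_sum)
    also have "\<dots> \<le> (\<Sum>m\<in>keys p. mdeg m)" using that by (intro member_le_sum) auto
    finally show ?thesis .
  qed
  then show ?thesis unfolding exponents_le_def by blast
qed

lemma exponents_le_list_ex: "\<exists>B. \<forall>x\<in>set xs. exponents_le B x"
proof (induction xs)
  case (Cons x xs)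
  then obtain B where B: "\<forall>x\<in>set xs. exponents_le B x" by blast
  obtain B' where "exponents_le B' x" using exponents_le_ex by blast
  then show ?case using B by (intro exI[of _ "max B B'"]) (auto intro: exponents_le_mono)
qed simp

lemma exponents_le_lmon:
  assumes "\<forall>x\<in>set xs. exponents_le B x" "length a = length xs" "set a \<subseteq> {..<D}"
  shows "exponents_le (length xs * (D * B)) (lmon xs a)"
  using assms
proof (induction xs a rule: lmon.induct)
  case (1 x xs k ks)
  have "exponents_le (k * B) (x ^ k)" using 1 by (intro exponents_le_power) simp
  then have "exponents_le (D * B) (x ^ k)" by (rule exponents_le_mono) (use 1 in auto)
  then have "exponents_le (D * B + length xs * (D * B)) (x ^ k * lmon xs ks)"
    by (rule exponents_le_mult) (use 1 in auto)
  then show ?case by simp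
qed simp_all

lemma psub_power: "psub g (p ^ k) = psub g p ^ k"
  by (induction k) (auto simp: psub_mult)

lemma psub_lmon: "psub g (lmon xs a) = lmon (map (psub g) xs) a"
  by (induction xs a rule: lmon.induct) (auto simp: psub_mult psub_power)

lemma psub_const_mult: "psub g (const c * p) = const c * psub g p"
  by (simp add: psub_mult const_def psub_single)

lemma poly_growth:
  fixes r b N :: nat
  assumes "\<And>D. D ^ r \<le> (r * (D * b) + 1) ^ N"
  shows "r \<le> N"
proof (rule ccontr)
  assume "\<not> r \<le> N"
  then have r: "Suc N \<le> r" by simp
  \<comment> \<open>Exceeds the constant factor (r b + 1)^N, so that the power of exponent N + 1
    already violates the bound.\<close>
  define D where "D = (r * b + 1) ^ N + 1"
  have D: "D \<ge> 1" by (simp add: D_def)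
  have "D ^ Suc N \<le> D ^ r" using D r by (rule power_increasing[rotated])
  also have "\<dots> \<le> (r * (D * b) + 1) ^ N" by (rule assms)
  also have "\<dots> \<le> (D * (r * b + 1)) ^ N"
    using D by (intro power_mono) (auto simp: algebra_simps)
  also have "\<dots> = D ^ N * (r * b + 1) ^ N" by (rule power_mult_distrib)
  also have "\<dots> < D ^ N * D" using D by (intro mult_strict_left_mono) (auto simp: D_def)
  finally show False by simp
qed

text \<open>The D^r power products with exponents below D remain independent after
  \<open>psub g\<close>, because a relation between the images lies in \<open>pker N g\<close> and
  hence in \<open>I\<close>. Their images involve only monomials with exponents linear in D, and
  there are at most (r D b + 1)^N' of these.\<close>

lemma weakly_regular_length:
  fixes I :: "'k::field mpoly set"
  assumes wr: "weakly_regular N I xs" and J: "pker N g \<subseteq> I" and g: "\<And>v. v \<in> {1..N} \<Longrightarrow> g v \<in> monomials N'"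
  shows "length xs \<le> N'"
proof -
  define r where "r = length xs"
  obtain b where b: "\<forall>x\<in>set (map (psub g) xs). exponents_le b x" using exponents_le_list_ex by blast
  have "D ^ r \<le> (r * (D * b) + 1) ^ N'" for D
  proof -
    let ?M = "bmons N' (r * (D * b))"
    let ?v = "\<lambda>a. psub g (lmon xs a)"
    have xs: "set xs \<subseteq> carrier (PR N)" using weakly_regular_carrier[OF wr] .
    have "card (box D r) \<le> card ((mpmon ` ?M) :: 'k mpoly set)"
    proof (rule independent_family_bound[where v = ?v])
      show "finite (mpmon ` ?M)" using bmons_card(1) by blast
      fix a assume a: "a \<in> box D r"
      have "exponents_le (r * (D * b)) (?v a)"
        using exponents_le_lmon[OF b, of a D] a by (simp add: psub_lmon box_def r_def)
      moreover have "?v a \<in> carrier (PR N')" by (rule psub_carrier[OF g lmon_carrier[OF xs]])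
      ultimately have "keys (?v a) \<subseteq> ?M" by (auto simp: bmons_def exponents_le_def PR_carrier)
      then show "?v a \<in> mpv.span (mpmon ` ?M)" by (rule in_span_mpmon)
    next
      fix c assume z: "(\<Sum>a\<in>box D r. const (c a) * ?v a) = 0"
      have "(\<Sum>a\<in>box D r. const (c a) * lmon xs a) \<in> pker N g"
        unfolding pker_def using z
        by (auto simp: psub_sum psub_const_mult intro!: PR_sum PR_mult PR_const lmon_carrier[OF xs])
      then have "(\<Sum>a\<in>box D (length xs). const (c a) * lmon xs a) \<in> I" using J unfolding r_def by blast
      then show "\<forall>a\<in>box D r. c a = 0" using weakly_regular_independent[OF wr] unfolding r_def by blast
    qed simp
    also have "\<dots> \<le> card ?M" by (rule card_image_le) (rule bmons_card)
    also have "\<dots> \<le> (r * (D * b) + 1) ^ N'" by (rule bmons_card)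
    finally show ?thesis by (simp add: card_box)
  qed
  then show ?thesis using poly_growth unfolding r_def by blast
qed

lemma weakly_regular_chain:
  assumes "\<And>i. i \<le> k \<Longrightarrow> ideal (Q i) (PR N)"
    and "\<And>i. i < k \<Longrightarrow> Q i \<subseteq> Q (Suc i) \<and> x i \<in> Q (Suc i)"
    and "\<And>i a. i < k \<Longrightarrow> a \<in> carrier (PR N) \<Longrightarrow> x i * a \<in> Q i \<Longrightarrow> a \<in> Q i"
    and "1 \<notin> Q k"
  shows "\<exists>xs. weakly_regular N (Q 0) xs \<and> length xs = k"
  using assms
proof (induction k arbitrary: Q x)
  case 0
  then show ?case by (intro exI[of _ "[]"]) auto
next
  case (Suc k)
  have "\<exists>xs. weakly_regular N (Q (Suc 0)) xs \<and> length xs = k"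
    by (rule Suc.IH[of "\<lambda>i. Q (Suc i)" "\<lambda>i. x (Suc i)"]) (use Suc.prems in auto)
  then obtain xs where xs: "weakly_regular N (Q (Suc 0)) xs" "length xs = k" by blast
  have "x 0 \<in> carrier (PR N)" using Suc.prems(2)[of 0] ideal_PR_carrier[OF Suc.prems(1)[of "Suc 0"]] by auto
  moreover have "ideal (Q 0) (PR N)" "Q 0 \<subseteq> Q (Suc 0)" "x 0 \<in> Q (Suc 0)" using Suc.prems(1)[of 0] Suc.prems(2)[of 0] by auto
  ultimately have "weakly_regular N (Q 0) (x 0 # xs)"
    using Suc.prems(3)[of 0] xs(1) by auto
  then show ?case using xs(2) by (intro exI[of _ "x 0 # xs"]) simp
qed

text \<open>An element of a prime that is missing from the previous one is a nonzerodivisor modulo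
  the previous prime, so a chain of primes pulls back to a weakly regular chain over
  \<open>J\<close>.\<close>

lemma krull_dim_le:
  fixes J :: "'k::field mpoly set"
  assumes J: "J = pker N g" and g: "\<And>v. v \<in> {1..N} \<Longrightarrow> g v \<in> monomials N'"
  shows "krull_dim (PR N Quot J) \<le> enat N'"
  unfolding krull_dim_def
proof (rule Sup_least)
  fix e assume "e \<in> {enat k | k. \<exists>P. (\<forall>i\<le>k. primeideal (P i) (PR N Quot J)) \<and> (\<forall>i<k. P i \<subset> P (Suc i))}"
  then obtain k P where e: "e = enat k" and P: "\<And>i. i \<le> k \<Longrightarrow> primeideal (P i) (PR N Quot J)"
    and strict: "\<And>i. i < k \<Longrightarrow> P i \<subset> P (Suc i)" by blast
  have Ji: "ideal J (PR N)" unfolding J by (rule pker_ideal)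
  let ?q = "\<lambda>p. J +>\<^bsub>PR N\<^esub> p"
  define Q where "Q i = {p \<in> carrier (PR N). ?q p \<in> P i}" for i
  interpret h: ring_hom_ring "PR N" "PR N Quot J" ?q by (rule ideal.rcos_ring_hom_ring[OF Ji])
  have Qi: "ideal (Q i) (PR N)" if "i \<le> k" for i
    unfolding Q_def by (rule h.ideal_vimage[OF primeideal.axioms(1)[OF P[OF that]]])
  have "\<exists>x. x \<in> Q (Suc i) \<and> x \<notin> Q i" if i: "i < k" for i
  proof -
    obtain X where X: "X \<in> P (Suc i)" "X \<notin> P i" using strict[OF i] by blast
    have "X \<in> carrier (PR N Quot J)"
      using ideal.Icarr[OF primeideal.axioms(1)[OF P[of "Suc i"]] X(1)] i by simp
    then obtain p where "p \<in> carrier (PR N)" "X = ?q p" unfolding q_carrier[OF Ji] by blast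
    then show ?thesis using X by (auto simp: Q_def)
  qed
  then have "\<forall>i. \<exists>x. i < k \<longrightarrow> x \<in> Q (Suc i) \<and> x \<notin> Q i" by blast
  from choice[OF this] obtain x where x: "\<And>i. i < k \<Longrightarrow> x i \<in> Q (Suc i) \<and> x i \<notin> Q i" by blast
  have "\<exists>xs. weakly_regular N (Q 0) xs \<and> length xs = k"
  proof (rule weakly_regular_chain[of k Q N x])
    show "Q i \<subseteq> Q (Suc i) \<and> x i \<in> Q (Suc i)" if "i < k" for i
      using strict[OF that] x[OF that] by (auto simp: Q_def)
    show "a \<in> Q i" if i: "i < k" and a: "a \<in> carrier (PR N)" and xa: "x i * a \<in> Q i" for i a
    proof -
      have xc: "x i \<in> carrier (PR N)" using x[OF i] by (auto simp: Q_def)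
      have "?q (x i) \<otimes>\<^bsub>PR N Quot J\<^esub> ?q a \<in> P i"
        unfolding q_mult[OF Ji xc a] using xa by (simp add: Q_def)
      then have "?q (x i) \<in> P i \<or> ?q a \<in> P i"
        using primeideal.I_prime[OF P[of i]] i q_closed[OF Ji xc] q_closed[OF Ji a] by auto
      then show ?thesis using x[OF i] xc a by (auto simp: Q_def)
    qed
    show "1 \<notin> Q k"
    proof
      assume "1 \<in> Q k"
      then have "\<one>\<^bsub>PR N Quot J\<^esub> \<in> P k" by (simp add: Q_def q_one[OF Ji])
      then have "P k = carrier (PR N Quot J)"
        using ideal.one_imp_carrier[OF primeideal.axioms(1)[OF P[OF order_refl]]] by blast
      then show False using primeideal.I_notcarr[OF P[OF order_refl]] by simp
    qed
  qed (rule Qi)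
  then obtain xs where xs: "weakly_regular N (Q 0) xs" "length xs = k" by blast
  have "J \<subseteq> Q 0"
  proof
    fix p assume p: "p \<in> J"
    then have pc: "p \<in> carrier (PR N)" by (rule ideal_PR_carrier[OF Ji])
    have "?q p = \<zero>\<^bsub>PR N Quot J\<^esub>" unfolding q_zero[OF Ji] using q_eq_0_iff[OF Ji pc] p by simp
    then show "p \<in> Q 0"
      using pc additive_subgroup.zero_closed[OF ideal.axioms(1)[OF primeideal.axioms(1)[OF P[of 0]]]]
      by (simp add: Q_def)
  qed
  then have "length xs \<le> N'" unfolding J by (rule weakly_regular_length[OF xs(1)]) (rule g)
  then show "e \<le> enat N'" using e xs(2) by simp
qed

text \<open>The preimages of the ideals generated by the initial segments of a regular sequence form
  a weakly regular chain over \<open>J\<close>.\<close>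

lemma depth_le:
  fixes J :: "'k::field mpoly set"
  assumes J: "J = pker N g" and g: "\<And>v. v \<in> {1..N} \<Longrightarrow> g v \<in> monomials N'"
  shows "depth (PR N Quot J) M \<le> enat N'"
  unfolding depth_def
proof (rule Sup_least)
  fix e assume "e \<in> {enat (length xs) | xs. set xs \<subseteq> M \<and> regular_sequence (PR N Quot J) xs}"
  then obtain X where e: "e = enat (length X)" and reg: "regular_sequence (PR N Quot J) X" by blast
  let ?S = "PR N Quot J"
  have Ji: "ideal J (PR N)" unfolding J by (rule pker_ideal)
  let ?q = "\<lambda>p. J +>\<^bsub>PR N\<^esub> p"
  interpret h: ring_hom_ring "PR N" ?S ?q by (rule ideal.rcos_ring_hom_ring[OF Ji])
  have Xc: "set X \<subseteq> carrier ?S" using reg unfolding regular_sequence_def by (rule conjunct1)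
  define P where "P i = Idl\<^bsub>?S\<^esub> (set (take i X))" for i
  have sub: "set (take i X) \<subseteq> carrier ?S" for i by (rule subset_trans[OF set_take_subset Xc])
  have Pi: "ideal (P i) ?S" for i unfolding P_def by (rule h.S.genideal_ideal[OF sub])
  have self: "set (take i X) \<subseteq> P i" for i unfolding P_def by (rule h.S.genideal_self[OF sub])
  have regI: "\<forall>i<length X. \<forall>a\<in>carrier ?S. X ! i \<otimes>\<^bsub>?S\<^esub> a \<in> P i \<longrightarrow> a \<in> P i"
    using conjunct1[OF conjunct2[OF reg[unfolded regular_sequence_def]]] unfolding P_def .
  define Q where "Q i = {p \<in> carrier (PR N). ?q p \<in> P i}" for i
  have Qi: "ideal (Q i) (PR N)" for i unfolding Q_def by (rule h.ideal_vimage[OF Pi])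
  have "\<exists>x. i < length X \<longrightarrow> x \<in> carrier (PR N) \<and> X ! i = ?q x" for i
  proof (cases "i < length X")
    case True
    then have "X ! i \<in> carrier ?S" using Xc nth_mem by blast
    then show ?thesis unfolding q_carrier[OF Ji] by blast
  qed auto
  then have "\<forall>i. \<exists>x. i < length X \<longrightarrow> x \<in> carrier (PR N) \<and> X ! i = ?q x" ..
  from choice[OF this] obtain x where x: "\<And>i. i < length X \<Longrightarrow> x i \<in> carrier (PR N) \<and> X ! i = ?q (x i)" by blast
  have "\<exists>xs. weakly_regular N (Q 0) xs \<and> length xs = length X"
  proof (rule weakly_regular_chain[of "length X" Q N x])
    show "Q i \<subseteq> Q (Suc i) \<and> x i \<in> Q (Suc i)" if i: "i < length X" for i
    proof
      have "set (take i X) \<subseteq> set (take (Suc i) X)" by (rule set_take_subset_set_take) simp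
      then have "set (take i X) \<subseteq> P (Suc i)" using self[of "Suc i"] by (rule subset_trans)
      then have "P i \<subseteq> P (Suc i)"
        unfolding P_def[of i] by (rule h.S.genideal_minimal[OF Pi])
      then show "Q i \<subseteq> Q (Suc i)" by (auto simp: Q_def)
      have "X ! i \<in> set (take (Suc i) X)" using i by (simp add: take_Suc_conv_app_nth)
      then have "X ! i \<in> P (Suc i)" using self[of "Suc i"] by (rule rev_subsetD)
      then show "x i \<in> Q (Suc i)" using x[OF i] by (simp add: Q_def)
    qed
    show "a \<in> Q i" if i: "i < length X" and a: "a \<in> carrier (PR N)" and xa: "x i * a \<in> Q i" for i a
    proof -
      have xc: "x i \<in> carrier (PR N)" and Xi: "X ! i = ?q (x i)" using x[OF i] by auto
      have "X ! i \<otimes>\<^bsub>?S\<^esub> ?q a \<in> P i"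
        unfolding Xi q_mult[OF Ji xc a] using xa by (simp add: Q_def)
      then have "?q a \<in> P i" using regI[rule_format, OF i q_closed[OF Ji a]] by blast
      then show ?thesis using a by (simp add: Q_def)
    qed
    show "1 \<notin> Q (length X)"
    proof
      assume "1 \<in> Q (length X)"
      then have "\<one>\<^bsub>?S\<^esub> \<in> P (length X)" by (simp add: Q_def q_one[OF Ji])
      then have "P (length X) = carrier ?S" using ideal.one_imp_carrier[OF Pi] by blast
      then show False using reg by (simp add: P_def regular_sequence_def)
    qed
  qed (rule Qi)
  then obtain xs where xs: "weakly_regular N (Q 0) xs" "length xs = length X" by blast
  have "J \<subseteq> Q 0"
  proof
    fix p assume p: "p \<in> J"
    then have pc: "p \<in> carrier (PR N)" by (rule ideal_PR_carrier[OF Ji])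
    have "?q p = \<zero>\<^bsub>?S\<^esub>" unfolding q_zero[OF Ji] using q_eq_0_iff[OF Ji pc] p by simp
    then show "p \<in> Q 0"
      using pc additive_subgroup.zero_closed[OF ideal.axioms(1)[OF Pi[of 0]]] by (simp add: Q_def)
  qed
  then have "length xs \<le> N'" unfolding J by (rule weakly_regular_length[OF xs(1)]) (rule g)
  then show "e \<le> enat N'" using e xs(2) by simp
qed

section \<open>Lower bounds from explicit primes and ideals upstairs\<close>

lemma pker_mono:
  assumes "\<And>v. v \<in> {1..N} \<Longrightarrow> mext \<kappa> (g v) = g' v"
  shows "pker N g \<subseteq> pker N g'"
proof
  fix p assume p: "p \<in> pker N g"
  then have pc: "p \<in> carrier (PR N)" and z: "psub g p = 0" by (auto simp: pker_def)
  have "psub g' p = psub (\<lambda>v. mext \<kappa> (g v)) p"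
    by (rule psub_cong) (use pc assms in \<open>auto simp: PR_carrier monomials_def subset_iff\<close>)
  also have "\<dots> = psub \<kappa> (psub g p)" by (simp add: psub_psub)
  finally show "p \<in> pker N g'" using pc z by (simp add: pker_def)
qed

lemma pker_cong: "(\<And>v. v \<in> {1..N} \<Longrightarrow> g v = g' v) \<Longrightarrow> pker N g = pker N g'"
  using pker_mono[of N "\<lambda>v. single v 1" g g'] pker_mono[of N "\<lambda>v. single v 1" g' g]
  by (simp only: mext_id) blast

lemma q_image_mem:
  assumes J: "ideal J (PR N)" and P: "ideal P (PR N)" "J \<subseteq> P" and a: "a \<in> carrier (PR N)"
  shows "J +>\<^bsub>PR N\<^esub> a \<in> (\<lambda>p. J +>\<^bsub>PR N\<^esub> p) ` P \<longleftrightarrow> a \<in> P"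
proof
  assume "J +>\<^bsub>PR N\<^esub> a \<in> (\<lambda>p. J +>\<^bsub>PR N\<^esub> p) ` P"
  then obtain p where p: "p \<in> P" "J +>\<^bsub>PR N\<^esub> a = J +>\<^bsub>PR N\<^esub> p" by blast
  have "a - p \<in> J" using p(2) q_eq_iff[OF J a ideal_PR_carrier[OF P(1) p(1)]] by simp
  then have "(a - p) + p \<in> P" using P(2) p(1) by (intro ideal_PR_add[OF P(1)]) auto
  then show "a \<in> P" by simp
qed blast

lemma quot_primeideal:
  fixes J :: "'k::field mpoly set"
  assumes J: "ideal J (PR N)" and P: "primeideal P (PR N)" "J \<subseteq> P"
  shows "primeideal ((\<lambda>p. J +>\<^bsub>PR N\<^esub> p) ` P) (PR N Quot J)"
proof -
  note Pi = primeideal.axioms(1)[OF P(1)]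
  note mem = q_image_mem[OF J Pi P(2)]
  show ?thesis
  proof (rule primeidealI)
    show "ideal ((\<lambda>p. J +>\<^bsub>PR N\<^esub> p) ` P) (PR N Quot J)"
      by (rule ring.ring_ideal_imp_quot_ideal[OF ring_PR J Pi])
    show "cring (PR N Quot J)" by (rule cring_quot[OF J])
    have "1 \<notin> P"
      using ideal.one_imp_carrier[OF Pi] primeideal.I_notcarr[OF P(1)] by auto
    then have "J +>\<^bsub>PR N\<^esub> 1 \<notin> (\<lambda>p. J +>\<^bsub>PR N\<^esub> p) ` P" using mem[OF PR_1] by simp
    then show "carrier (PR N Quot J) \<noteq> (\<lambda>p. J +>\<^bsub>PR N\<^esub> p) ` P" using q_closed[OF J PR_1] by metis
    fix A B assume A: "A \<in> carrier (PR N Quot J)" and B: "B \<in> carrier (PR N Quot J)"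
      and AB: "A \<otimes>\<^bsub>PR N Quot J\<^esub> B \<in> (\<lambda>p. J +>\<^bsub>PR N\<^esub> p) ` P"
    obtain a where a: "a \<in> carrier (PR N)" "A = J +>\<^bsub>PR N\<^esub> a" using A unfolding q_carrier[OF J] by blast
    obtain b where b: "b \<in> carrier (PR N)" "B = J +>\<^bsub>PR N\<^esub> b" using B unfolding q_carrier[OF J] by blast
    have "a * b \<in> P" using AB unfolding a(2) b(2) q_mult[OF J a(1) b(1)] mem[OF PR_mult[OF a(1) b(1)]] .
    then have "a \<in> P \<or> b \<in> P" using primeideal.I_prime[OF P(1) a(1) b(1)] by simp
    then show "A \<in> (\<lambda>p. J +>\<^bsub>PR N\<^esub> p) ` P \<or> B \<in> (\<lambda>p. J +>\<^bsub>PR N\<^esub> p) ` P"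
      unfolding a(2) b(2) by blast
  qed
qed

lemma krull_dim_ge:
  fixes J :: "'k::field mpoly set"
  assumes J: "ideal J (PR N)"
    and P: "\<And>i. i \<le> k \<Longrightarrow> primeideal (P i) (PR N)" "\<And>i. i \<le> k \<Longrightarrow> J \<subseteq> P i" "\<And>i. i < k \<Longrightarrow> P i \<subset> P (Suc i)"
  shows "enat k \<le> krull_dim (PR N Quot J)"
  unfolding krull_dim_def
proof (rule Sup_upper, rule CollectI, intro exI conjI allI impI)
  show "enat k = enat k" ..
  let ?P = "\<lambda>i. (\<lambda>p. J +>\<^bsub>PR N\<^esub> p) ` P i"
  show "primeideal (?P i) (PR N Quot J)" if "i \<le> k" for i
    using that by (intro quot_primeideal[OF J] P)
  show "?P i \<subset> ?P (Suc i)" if i: "i < k" for i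
  proof
    show "?P i \<subseteq> ?P (Suc i)" using P(3)[OF i] by blast
    obtain x where x: "x \<in> P (Suc i)" "x \<notin> P i" using P(3)[OF i] by blast
    have xc: "x \<in> carrier (PR N)"
      using x(1) i by (intro ideal_PR_carrier[OF primeideal.axioms(1)[OF P(1)[of "Suc i"]]]) auto
    have "J +>\<^bsub>PR N\<^esub> x \<notin> ?P i"
      using q_image_mem[OF J primeideal.axioms(1)[OF P(1)[of i]] P(2)[of i] xc] x(2) i by simp
    then show "?P i \<noteq> ?P (Suc i)" using x(1) by blast
  qed
qed

text \<open>Lets regularity be checked on explicit ideals of the polynomial ring. The link is that
  the ideal generated by the first \<open>i\<close> classes is the image of
  \<open>A i\<close>.\<close>

lemma regular_chain:
  fixes J :: "'k::field mpoly set"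
  assumes A: "\<And>i. i \<le> k \<Longrightarrow> ideal (A i) (PR N)" and A0: "A 0 = J"
    and x: "\<And>i. i < k \<Longrightarrow> x i \<in> carrier (PR N)"
    and AS: "\<And>i. i < k \<Longrightarrow> A (Suc i) = {u + x i * r | u r. u \<in> A i \<and> r \<in> carrier (PR N)}"
    and reg: "\<And>i a. i < k \<Longrightarrow> a \<in> carrier (PR N) \<Longrightarrow> x i * a \<in> A i \<Longrightarrow> a \<in> A i"
    and one: "1 \<notin> A k"
  shows "regular_sequence (PR N Quot J) (map (\<lambda>i. J +>\<^bsub>PR N\<^esub> x i) [0..<k])"
proof -
  let ?S = "PR N Quot J"
  let ?q = "\<lambda>p. J +>\<^bsub>PR N\<^esub> p"
  let ?X = "map (\<lambda>i. ?q (x i)) [0..<k]"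
  have J: "ideal J (PR N)" using A[of 0] A0 by simp
  interpret Q: cring ?S by (rule cring_quot[OF J])
  have mono: "A i \<subseteq> A (Suc i)" if i: "i < k" for i
  proof
    fix u assume u: "u \<in> A i"
    have "u = u + x i * 0" by simp
    moreover have "0 \<in> carrier (PR N :: 'k mpoly ring)" by (rule PR_0)
    ultimately show "u \<in> A (Suc i)" unfolding AS[OF i] using u by blast
  qed
  have JA: "J \<subseteq> A i" if "i \<le> k" for i
    using that
  proof (induction i)
    case (Suc i)
    then show ?case using mono[of i] by auto
  qed (simp add: A0)
  have Xc: "set ?X \<subseteq> carrier ?S" using q_closed[OF J x] by auto
  have Idl: "Idl\<^bsub>?S\<^esub> (set (take i ?X)) = ?q ` A i" if "i \<le> k" for i
    using that
  proof (induction i)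
    case 0
    have "?q ` A 0 = {\<zero>\<^bsub>?S\<^esub>}"
    proof
      show "?q ` A 0 \<subseteq> {\<zero>\<^bsub>?S\<^esub>}"
        using q_eq_0_iff[OF J ideal_PR_carrier[OF J]] by (auto simp: A0 q_zero[OF J])
      show "{\<zero>\<^bsub>?S\<^esub>} \<subseteq> ?q ` A 0" using ideal_PR_0[OF J] by (auto simp: A0 q_zero[OF J])
    qed
    moreover have "Idl\<^bsub>?S\<^esub> {} = {\<zero>\<^bsub>?S\<^esub>}"
    proof
      show "Idl\<^bsub>?S\<^esub> {} \<subseteq> {\<zero>\<^bsub>?S\<^esub>}" by (rule Q.genideal_minimal[OF Q.zeroideal]) simp
      show "{\<zero>\<^bsub>?S\<^esub>} \<subseteq> Idl\<^bsub>?S\<^esub> {}"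
        using additive_subgroup.zero_closed[OF ideal.axioms(1)[OF Q.genideal_ideal[of "{}"]]] by simp
    qed
    ultimately show ?case by simp
  next
    case (Suc i)
    then have i: "i < k" and IH: "Idl\<^bsub>?S\<^esub> (set (take i ?X)) = ?q ` A i" by auto
    have tk: "set (take (Suc i) ?X) = insert (?q (x i)) (set (take i ?X))"
      using i by (simp add: take_Suc_conv_app_nth)
    have sub: "set (take j ?X) \<subseteq> carrier ?S" for j by (rule subset_trans[OF set_take_subset Xc])
    note G = Q.genideal_ideal[OF sub[of "Suc i"]]
    note Gself = Q.genideal_self[OF sub[of "Suc i"]]
    have qx: "?q (x i) \<in> Idl\<^bsub>?S\<^esub> (set (take (Suc i) ?X))" using Gself unfolding tk by blast
    have low: "?q ` A i \<subseteq> Idl\<^bsub>?S\<^esub> (set (take (Suc i) ?X))"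
      unfolding IH[symmetric] by (rule Q.genideal_minimal[OF G]) (use Gself in \<open>simp add: tk\<close>)
    show ?case
    proof
      show "Idl\<^bsub>?S\<^esub> (set (take (Suc i) ?X)) \<subseteq> ?q ` A (Suc i)"
      proof (rule Q.genideal_minimal)
        show "ideal (?q ` A (Suc i)) ?S"
          using Suc.prems by (intro ring.ring_ideal_imp_quot_ideal[OF ring_PR J] A)
        have "x i = 0 + x i * 1" by simp
        moreover have "0 \<in> A i" "1 \<in> carrier (PR N :: 'k mpoly ring)" using ideal_PR_0[OF A[of i]] i by (simp_all add: PR_1)
        ultimately have "x i \<in> A (Suc i)" unfolding AS[OF i] by blast
        moreover have "set (take i ?X) \<subseteq> ?q ` A i" using Q.genideal_self[OF sub[of i]] IH by simp
        ultimately show "set (take (Suc i) ?X) \<subseteq> ?q ` A (Suc i)" using mono[OF i] unfolding tk by blast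
      qed
      show "?q ` A (Suc i) \<subseteq> Idl\<^bsub>?S\<^esub> (set (take (Suc i) ?X))"
      proof
        fix Y assume "Y \<in> ?q ` A (Suc i)"
        then obtain u r where u: "u \<in> A i" and r: "r \<in> carrier (PR N)" and Y: "Y = ?q (u + x i * r)"
          unfolding AS[OF i] by blast
        have uc: "u \<in> carrier (PR N)" using ideal_PR_carrier[OF A u] i by simp
        have "Y = ?q u \<oplus>\<^bsub>?S\<^esub> (?q (x i) \<otimes>\<^bsub>?S\<^esub> ?q r)"
          unfolding Y q_mult[OF J x[OF i] r] using q_add[OF J uc PR_mult[OF x[OF i] r]] by simp
        moreover have "?q u \<in> Idl\<^bsub>?S\<^esub> (set (take (Suc i) ?X))" using low u by blast
        moreover have "?q (x i) \<otimes>\<^bsub>?S\<^esub> ?q r \<in> Idl\<^bsub>?S\<^esub> (set (take (Suc i) ?X))"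
          by (rule ideal.I_r_closed[OF G qx q_closed[OF J r]])
        ultimately show "Y \<in> Idl\<^bsub>?S\<^esub> (set (take (Suc i) ?X))"
          using additive_subgroup.a_closed[OF ideal.axioms(1)[OF G]] by simp
      qed
    qed
  qed
  show ?thesis
    unfolding regular_sequence_def
  proof (intro conjI allI impI ballI)
    show "set ?X \<subseteq> carrier ?S" by (rule Xc)
    show "Idl\<^bsub>?S\<^esub> (set ?X) \<noteq> carrier ?S"
    proof
      assume eq: "Idl\<^bsub>?S\<^esub> (set ?X) = carrier ?S"
      have "Idl\<^bsub>?S\<^esub> (set ?X) = ?q ` A k" using Idl[OF order_refl] by simp
      then have "?q 1 \<in> ?q ` A k" using q_closed[OF J PR_1] eq by simp
      then show False using q_image_mem[OF J A[of k] JA[of k] PR_1] one by simp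
    qed
    fix i a assume il: "i < length ?X" and a: "a \<in> carrier ?S"
      and xa: "?X ! i \<otimes>\<^bsub>?S\<^esub> a \<in> Idl\<^bsub>?S\<^esub> (set (take i ?X))"
    then have i: "i < k" by simp
    obtain b where b: "b \<in> carrier (PR N)" "a = ?q b" using a unfolding q_carrier[OF J] by blast
    have "?q (x i * b) \<in> ?q ` A i"
      using xa i q_mult[OF J x[OF i] b(1)] Idl[of i] by (simp add: b(2))
    then have "x i * b \<in> A i"
      using q_image_mem[OF J A[of i] JA[of i] PR_mult[OF x[OF i] b(1)]] i by simp
    then have "b \<in> A i" using reg[OF i b(1)] by blast
    then show "a \<in> Idl\<^bsub>?S\<^esub> (set (take i ?X))" using Idl[of i] i b(2) by simp
  qed
qed

lemma depth_ge:
  assumes "regular_sequence R xs" "set xs \<subseteq> M"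
  shows "enat (length xs) \<le> depth R M"
  unfolding depth_def by (rule Sup_upper) (use assms in blast)

lemma mext_nonzero:
  assumes g: "\<And>v. v \<in> {1..N} \<Longrightarrow> g v \<noteq> 0" and m: "m \<in> monomials N" "m \<noteq> 0"
  shows "mext g m \<noteq> 0"
proof -
  have "keys m \<noteq> {}" using m(2) keys_eq_empty mdeg_def mdeg_eq_0_iff by (metis sum.empty)
  then obtain v where v: "v \<in> keys m" by blast
  then obtain m' where m': "m = single v 1 + m'" using pp_split[of m v] by (auto simp: in_keys_iff)
  have "v \<in> {1..N}" using m(1) v by (auto simp: monomials_def)
  then have "mdeg (g v) \<noteq> 0" using g by simp
  then have "mdeg (mext g m) \<noteq> 0" unfolding m' mext_add mext_single_1 mdeg_add by simp
  then show ?thesis by auto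
qed

text \<open>If no variable is mapped to 1, only the constant term of \<open>p\<close> can contribute
  to the constant coefficient of its image.\<close>

lemma pker_const_0:
  fixes p :: "'k::field mpoly"
  assumes g: "\<And>v. v \<in> {1..N} \<Longrightarrow> g v \<noteq> 0" and p: "p \<in> pker N g"
  shows "lookup p 0 = 0"
proof -
  have pc: "keys p \<subseteq> monomials N" and z: "psub g p = 0" using p by (auto simp: pker_def PR_carrier)
  have "lookup (psub g p) 0 = (\<Sum>m\<in>keys p. if m = 0 then lookup p 0 else 0)"
    unfolding psub_def lookup_sum
  proof (intro sum.cong refl)
    fix m assume "m \<in> keys p"
    then have "mext g m = 0 \<longleftrightarrow> m = 0" using mext_nonzero[of N g m, OF g] pc by auto
    then show "lookup (single (mext g m) (lookup p m)) 0 = (if m = 0 then lookup p 0 else 0)"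
      by (auto simp: lookup_single when_def)
  qed
  also have "\<dots> = lookup p 0" by (simp add: in_keys_iff)
  finally show ?thesis using z by simp
qed

lemma psub_lift:
  fixes p :: "'k::field mpoly"
  assumes "\<And>\<mu>. \<mu> \<in> keys p \<Longrightarrow> \<exists>u\<in>monomials N. mext g u = \<mu>"
  obtains r where "r \<in> carrier (PR N)" "psub g r = p"
proof -
  have "\<forall>\<mu>\<in>keys p. \<exists>u. u \<in> monomials N \<and> mext g u = \<mu>" using assms by blast
  from bchoice[OF this] obtain U where U: "\<And>\<mu>. \<mu> \<in> keys p \<Longrightarrow> U \<mu> \<in> monomials N \<and> mext g (U \<mu>) = \<mu>" by blast
  show ?thesis
  proof
    show "(\<Sum>\<mu>\<in>keys p. single (U \<mu>) (lookup p \<mu>)) \<in> carrier (PR N)"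
      using U by (intro PR_sum PR_single) auto
    have "psub g (\<Sum>\<mu>\<in>keys p. single (U \<mu>) (lookup p \<mu>)) = (\<Sum>\<mu>\<in>keys p. single \<mu> (lookup p \<mu>))"
      unfolding psub_sum psub_single using U by (intro sum.cong) auto
    then show "psub g (\<Sum>\<mu>\<in>keys p. single (U \<mu>) (lookup p \<mu>)) = p" using mpoly_expand[of p] by simp
  qed
qed

text \<open>Induction on the exponent of x, from the identity x \<nu> - \<rho> \<sigma>(\<nu>) = (x
  - \<rho>) \<nu> + \<rho> (\<nu> - \<sigma>(\<nu>)). The closure properties of \<open>W\<close>
  keep the quotient supported in \<open>W\<close>.\<close>

lemma divide_binomial:
  fixes p :: "'k::field mpoly"
  assumes p: "keys p \<subseteq> W" and W: "\<And>\<nu>. single x 1 + \<nu> \<in> W \<Longrightarrow> \<nu> \<in> W" "\<And>\<nu>. \<nu> \<in> W \<Longrightarrow> \<rho> + \<nu> \<in> W"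
    and \<sigma>: "\<And>v. v \<noteq> x \<Longrightarrow> \<sigma> v = single v 1" "\<sigma> x = \<rho>"
  shows "\<exists>h. keys h \<subseteq> W \<and> p - psub \<sigma> p = (var x - mpmon \<rho>) * h"
proof -
  have mono: "\<exists>h. keys h \<subseteq> W \<and> single \<mu> c - psub \<sigma> (single \<mu> c) = (var x - mpmon \<rho>) * h" if "\<mu> \<in> W" for \<mu> and c :: 'k
    using that
  proof (induction "lookup \<mu> x" arbitrary: \<mu>)
    case 0
    have "mext \<sigma> \<mu> = mext (\<lambda>v. single v 1) \<mu>"
    proof (rule mext_cong)
      fix v assume "v \<in> keys \<mu>"
      then have "v \<noteq> x" using 0(1) by (auto simp: in_keys_iff)
      then show "\<sigma> v = single v 1" by (rule \<sigma>(1))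
    qed
    then have "mext \<sigma> \<mu> = \<mu>" by (simp only: mext_id)
    then show ?case by (intro exI[of _ 0]) (simp add: psub_single)
  next
    case (Suc a)
    then obtain \<nu> where \<nu>: "\<mu> = single x 1 + \<nu>" using pp_split[of \<mu> x] by auto
    have "a = lookup \<nu> x" using Suc(2) unfolding \<nu> by (simp add: lookup_add)
    moreover have \<nu>W: "\<nu> \<in> W" using Suc(3) W(1) unfolding \<nu> by blast
    ultimately obtain h where h: "keys h \<subseteq> W" "single \<nu> c - psub \<sigma> (single \<nu> c) = (var x - mpmon \<rho>) * h"
      using Suc(1) by blast
    have e1: "single \<mu> c = var x * single \<nu> c" by (simp add: \<nu> var_def mpmon_def mult_single)
    have e2: "psub \<sigma> (single \<mu> c) = mpmon \<rho> * psub \<sigma> (single \<nu> c)" unfolding e1 by (simp add: psub_mult \<sigma>(2))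
    have "single \<mu> c - psub \<sigma> (single \<mu> c) = (var x - mpmon \<rho>) * single \<nu> c + mpmon \<rho> * (single \<nu> c - psub \<sigma> (single \<nu> c))"
      unfolding e1 e2[unfolded e1] by (simp add: algebra_simps)
    also have "\<dots> = (var x - mpmon \<rho>) * (single \<nu> c + mpmon \<rho> * h)"
      unfolding h(2) by (simp add: algebra_simps)
    finally have eq: "single \<mu> c - psub \<sigma> (single \<mu> c) = (var x - mpmon \<rho>) * (single \<nu> c + mpmon \<rho> * h)" .
    have "keys (single \<nu> c) \<subseteq> W" using \<nu>W by (simp add: keys_single)
    moreover have "keys (mpmon \<rho> * h) \<subseteq> W" using keys_single_mult[of \<rho> 1 h] h(1) W(2) by (auto simp: mpmon_def)
    ultimately have "keys (single \<nu> c + mpmon \<rho> * h) \<subseteq> W" using keys_add[of "single \<nu> c" "mpmon \<rho> * h"] by blast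
    then show ?case using eq by blast
  qed
  have "\<forall>\<mu>\<in>keys p. \<exists>h. keys h \<subseteq> W \<and> single \<mu> (lookup p \<mu>) - psub \<sigma> (single \<mu> (lookup p \<mu>)) = (var x - mpmon \<rho>) * h"
    using mono p by blast
  from bchoice[OF this] obtain H where H: "\<And>\<mu>. \<mu> \<in> keys p \<Longrightarrow> keys (H \<mu>) \<subseteq> W \<and>
      single \<mu> (lookup p \<mu>) - psub \<sigma> (single \<mu> (lookup p \<mu>)) = (var x - mpmon \<rho>) * H \<mu>" by blast
  have "p - psub \<sigma> p = (\<Sum>\<mu>\<in>keys p. single \<mu> (lookup p \<mu>) - psub \<sigma> (single \<mu> (lookup p \<mu>)))"
    using mpoly_expand[of p] by (simp add: sum_subtractf flip: psub_sum)
  also have "\<dots> = (\<Sum>\<mu>\<in>keys p. (var x - mpmon \<rho>) * H \<mu>)" using H by (intro sum.cong) auto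
  also have "\<dots> = (var x - mpmon \<rho>) * (\<Sum>\<mu>\<in>keys p. H \<mu>)" by (simp add: sum_distrib_left)
  finally have "p - psub \<sigma> p = (var x - mpmon \<rho>) * (\<Sum>\<mu>\<in>keys p. H \<mu>)" .
  moreover have "keys (\<Sum>\<mu>\<in>keys p. H \<mu>) \<subseteq> W" using keys_sum[of H "keys p"] H by blast
  ultimately show ?thesis by blast
qed

lemma extend_to_permutation:
  fixes s :: "nat \<Rightarrow> nat"
  assumes "inj_on s {1..q}" "s ` {1..q} \<subseteq> {1..n}"
  shows "\<exists>\<tau>. bij_betw \<tau> {1..n} {1..n} \<and> (\<forall>k\<in>{1..q}. \<tau> k = s k)"
proof -
  have qn: "q \<le> n" using card_inj_on_le[OF assms] by simp
  have "card ({1..n} - s ` {1..q}) = card {q + 1..n}"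
    using assms by (simp add: card_Diff_subset card_image)
  then obtain b where b: "bij_betw b {q + 1..n} ({1..n} - s ` {1..q})"
    using finite_same_card_bij[of "{q + 1..n}" "{1..n} - s ` {1..q}"] by auto
  define \<tau> where "\<tau> k = (if k \<le> q then s k else b k)" for k
  have "bij_betw \<tau> {1..q} (s ` {1..q})"
    using assms(1) by (intro bij_betw_cong[THEN iffD2, OF _ inj_on_imp_bij_betw]) (auto simp: \<tau>_def)
  moreover have "bij_betw \<tau> {q + 1..n} ({1..n} - s ` {1..q})"
    using b by (rule bij_betw_cong[THEN iffD2, rotated]) (auto simp: \<tau>_def)
  ultimately have "bij_betw \<tau> ({1..q} \<union> {q + 1..n}) (s ` {1..q} \<union> ({1..n} - s ` {1..q}))"
    by (rule bij_betw_combine) auto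
  moreover have "{1..q} \<union> {q + 1..n} = {1..n}" using qn by auto
  moreover have "s ` {1..q} \<union> ({1..n} - s ` {1..q}) = {1..n}" using assms(2) by blast
  ultimately show ?thesis by (intro exI[of _ \<tau>]) (auto simp: \<tau>_def)
qed

section \<open>A regular sequence of length \<open>n + 1\<close>\<close>

text \<open>
  Enumerating the variables of \<open>A\<close> as \<open>\<tau> 1, \<dots>, \<tau> n\<close>, with \<open>y\<^sub>k = \<tau> k\<close> for \<open>k \<le> q\<close>, the map \<open>st i\<close>
  replaces the \<open>k\<close>-th variable by \<open>y\<^sub>1 t\<^bsup>min (k-1) q\<^esup>\<close> for all \<open>k \<le> i\<close>.  Its image is spanned by
  the monomials \<open>\<mu> \<in> W i\<close> with \<open>V i \<mu> \<le> 0\<close>.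
\<close>

locale rees_stages = rees +
  fixes \<tau> :: "nat \<Rightarrow> nat"
  assumes q1: "1 \<le> q" and \<tau>_bij: "bij_betw \<tau> {1..n} {1..n}" and \<tau>_s: "k \<in> {1..q} \<Longrightarrow> \<tau> k = s k"
begin

definition ti :: "nat \<Rightarrow> nat" where
  "ti = the_inv_into {1..n} \<tau>"

definition X :: "nat \<Rightarrow> nat \<Rightarrow> pp" where
  "X i k = (if k \<le> i then single (\<tau> 1) 1 + single (n + 1) (min (k - 1) q) else single (\<tau> k) 1)"

definition st :: "nat \<Rightarrow> nat \<Rightarrow> pp" where
  "st i v = (if v \<le> n then X i (ti v) else X i (v - n) + single (n + 1) 1)"

text \<open>The excess of the exponent of t over its allowed maximum: each y_1 can carry up to
  \<open>min i q\<close> factors t, and each y_k not yet replaced can carry one.\<close>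

definition V :: "nat \<Rightarrow> pp \<Rightarrow> int" where
  "V i \<mu> = int (lookup \<mu> (n + 1)) - int (min i q) * int (lookup \<mu> (\<tau> 1)) - (\<Sum>k\<in>{i + 1..q}. int (lookup \<mu> (\<tau> k)))"

definition W :: "nat \<Rightarrow> pp set" where
  "W i = {\<mu> \<in> monomials (n + 1). \<forall>k\<in>{2..i}. lookup \<mu> (\<tau> k) = 0}"

lemma q_le_n: "q \<le> n"
  using card_inj_on_le[OF s_inj s_range] by simp

lemma n1: "1 \<le> n" using q1 q_le_n by simp

lemma \<tau>_range: "k \<in> {1..n} \<Longrightarrow> 1 \<le> \<tau> k \<and> \<tau> k \<le> n"
  using bij_betwE[OF \<tau>_bij] by fastforce

lemma \<tau>_eq_iff: "k \<in> {1..n} \<Longrightarrow> l \<in> {1..n} \<Longrightarrow> \<tau> k = \<tau> l \<longleftrightarrow> k = l"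
  using bij_betw_imp_inj_on[OF \<tau>_bij] by (rule inj_on_eq_iff)

lemma ti_\<tau>: "k \<in> {1..n} \<Longrightarrow> ti (\<tau> k) = k"
  unfolding ti_def by (rule the_inv_into_f_f[OF bij_betw_imp_inj_on[OF \<tau>_bij]])

lemma var_cases:
  assumes "v \<in> {1..n + q}"
  obtains k where "k \<in> {1..n}" "v = \<tau> k" | k where "k \<in> {1..q}" "v = n + k"
proof (cases "v \<le> n")
  case True
  then have "v \<in> \<tau> ` {1..n}" using assms bij_betw_imp_surj_on[OF \<tau>_bij] by auto
  then show ?thesis using that(1) by blast
next
  case False
  then show ?thesis using assms that(2)[of "v - n"] by auto
qed

lemma st_\<tau>: "k \<in> {1..n} \<Longrightarrow> st i (\<tau> k) = X i k"
  using \<tau>_range[of k] by (simp add: st_def ti_\<tau>)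

lemma st_T: "k \<in> {1..q} \<Longrightarrow> st i (n + k) = X i k + single (n + 1) 1"
  by (auto simp: st_def)

lemma V_add: "V i (\<mu> + \<nu>) = V i \<mu> + V i \<nu>"
  by (simp add: V_def lookup_add algebra_simps sum.distrib)

lemma V_single_t: "V i (single (n + 1) a) = int a"
proof -
  have ne: "\<tau> k \<noteq> n + 1" if "k \<in> {1..n}" for k using \<tau>_range[OF that] by simp
  have "(\<Sum>k\<in>{i + 1..q}. int (lookup (single (n + 1) a) (\<tau> k))) = 0"
  proof (rule sum.neutral, rule ballI)
    fix k assume "k \<in> {i + 1..q}"
    then have "k \<in> {1..n}" using q_le_n by auto
    from ne[OF this] show "int (lookup (single (n + 1) a) (\<tau> k)) = 0" by (simp add: lookup_single_if)
  qed
  then show ?thesis using ne[of 1] n1 by (simp add: V_def lookup_single_if)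
qed

lemma V_single_\<tau>:
  assumes "k \<in> {1..n}" "1 \<le> i"
  shows "V i (single (\<tau> k) 1) = (if k = 1 then - int (min i q) else if i < k \<and> k \<le> q then - 1 else 0)"
proof -
  have ne: "\<tau> k \<noteq> n + 1" using \<tau>_range[OF assms(1)] by simp
  have "(\<Sum>l\<in>{i + 1..q}. int (lookup (single (\<tau> k) 1) (\<tau> l))) = (\<Sum>l\<in>{i + 1..q}. if l = k then 1 else 0)"
  proof (intro sum.cong refl)
    fix l assume "l \<in> {i + 1..q}"
    then have "l \<in> {1..n}" using q_le_n by auto
    then show "int (lookup (single (\<tau> k) 1) (\<tau> l)) = (if l = k then 1 else 0)"
      using \<tau>_eq_iff[OF assms(1), of l] by (auto simp: lookup_single_if)
  qed
  also have "\<dots> = (if i < k \<and> k \<le> q then 1 else 0)" by auto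
  finally show ?thesis
    using ne \<tau>_eq_iff[OF assms(1), of 1] n1 assms by (auto simp: V_def lookup_single_if)
qed

lemma V_X:
  assumes "k \<in> {1..n}" "1 \<le> i"
  shows "V i (X i k) = (if k \<le> i then int (min (k - 1) q) - int (min i q) else if k \<le> q then - 1 else 0)"
proof (cases "k \<le> i")
  case True
  have "V i (X i k) = V i (single (\<tau> 1) 1) + int (min (k - 1) q)"
    unfolding X_def if_P[OF True] V_add V_single_t ..
  then show ?thesis using V_single_\<tau>[of 1 i] n1 assms(2) True by simp
next
  case False
  then show ?thesis using V_single_\<tau>[OF assms] assms by (simp add: X_def)
qed

lemma V_st:
  assumes "v \<in> {1..n + q}" "1 \<le> i"
  shows "V i (st i v) \<le> 0"
  using assms(1)
proof (cases rule: var_cases)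
  case (1 k)
  then show ?thesis using V_X[OF 1(1) assms(2)] by (auto simp: st_\<tau>)
next
  case (2 k)
  then have k: "k \<in> {1..n}" using q_le_n by auto
  have "V i (st i v) = V i (X i k) + 1" unfolding 2(2) st_T[OF 2(1)] V_add V_single_t by simp
  then show ?thesis using V_X[OF k assms(2)] 2(1) by auto
qed

lemma W_add: "\<mu> + \<nu> \<in> W i \<longleftrightarrow> \<mu> \<in> W i \<and> \<nu> \<in> W i"
  by (auto simp: W_def lookup_add)

lemma W_0: "0 \<in> W i"
  by (simp add: W_def)

lemma W_single_t: "single (n + 1) a \<in> W i" if "i \<le> n"
proof -
  have "lookup (single (n + 1) a) (\<tau> k) = 0" if "k \<in> {2..i}" for k
    using \<tau>_range[of k] that \<open>i \<le> n\<close> by (simp add: lookup_single_if)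
  then show ?thesis by (auto simp: W_def intro: monomials_single)
qed

lemma W_single_\<tau>:
  assumes "k \<in> {1..n}" "i \<le> n" "k = 1 \<or> i < k"
  shows "single (\<tau> k) a \<in> W i"
proof -
  have "lookup (single (\<tau> k) a) (\<tau> l) = 0" if "l \<in> {2..i}" for l
    using that assms \<tau>_eq_iff[OF assms(1), of l] by (auto simp: lookup_single_if)
  then show ?thesis using \<tau>_range[OF assms(1)] by (auto simp: W_def intro: monomials_single)
qed

lemma W_X: "k \<in> {1..n} \<Longrightarrow> 1 \<le> i \<Longrightarrow> i \<le> n \<Longrightarrow> X i k \<in> W i"
  using W_single_\<tau>[of 1 i 1] W_single_\<tau>[of k i 1] W_single_t n1 by (auto simp: X_def W_add)

lemma W_st:
  assumes "v \<in> {1..n + q}" "1 \<le> i" "i \<le> n"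
  shows "st i v \<in> W i"
  using assms(1)
proof (cases rule: var_cases)
  case (1 k)
  then show ?thesis using W_X assms by (simp add: st_\<tau>)
next
  case (2 k)
  then have k: "k \<in> {1..n}" using q_le_n by auto
  show ?thesis unfolding 2(2) st_T[OF 2(1)] W_add using W_X[OF k assms(2,3)] W_single_t[OF assms(3), of 1] by simp
qed

lemma image_st:
  assumes "u \<in> monomials (n + q)" "1 \<le> i" "i \<le> n"
  shows "mext (st i) u \<in> W i \<and> V i (mext (st i) u) \<le> 0"
  using assms(1)
proof (induction u rule: pp_induct)
  case zero
  then show ?case by (simp add: W_0 V_def)
next
  case (add v m')
  then have "v \<in> {1..n + q}" "m' \<in> monomials (n + q)" by (auto simp: monomials_def keys_plus_pp)
  then show ?case using add.IH W_st[of v i] V_st[of v i] assms by (simp add: mext_add W_add V_add)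
qed

text \<open>A preimage is built by peeling off one T variable at a time until no t is left. A
  remaining y_k with i < k takes one t and comes from T_k. If there is none, all t are carried by
  y_1, and y_1 t^j is the image of T_j.\<close>

lemma surj_st:
  assumes "\<mu> \<in> W i" "V i \<mu> \<le> 0" "1 \<le> i" "i \<le> n"
  shows "\<exists>u\<in>monomials (n + q). mext (st i) u = \<mu>"
  using assms(1,2)
proof (induction "lookup \<mu> (n + 1)" arbitrary: \<mu> rule: less_induct)
  case less
  show ?case
  proof (cases "lookup \<mu> (n + 1) = 0")
    case True
    have "mext (st i) \<mu> = mext (\<lambda>v. single v 1) \<mu>"
    proof (rule mext_cong)
      fix v assume v: "v \<in> keys \<mu>"
      have "v \<noteq> n + 1" using True v by (auto simp: in_keys_iff)
      moreover have "v \<in> {1..n + 1}" using v less.prems(1) unfolding W_def monomials_def by blast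
      ultimately have "v \<in> {1..n + q}" "v \<le> n" by auto
      from this(1) show "st i v = single v 1"
      proof (cases rule: var_cases)
        case (1 k)
        then have "k \<notin> {2..i}" using v less.prems by (auto simp: W_def in_keys_iff)
        then have "k = 1 \<or> i < k" using 1(1) by auto
        then show ?thesis using 1 by (auto simp: st_\<tau> X_def)
      qed (use \<open>v \<le> n\<close> in auto)
    qed
    then have "mext (st i) \<mu> = \<mu>" by (simp only: mext_id)
    moreover have "\<mu> \<in> monomials (n + q)"
    proof -
      have "keys \<mu> \<subseteq> {1..n + 1}" "n + 1 \<notin> keys \<mu>"
        using less.prems(1) True unfolding W_def monomials_def by (blast, simp add: in_keys_iff)
      then have "keys \<mu> \<subseteq> {1..n}" by (force simp: subset_iff le_Suc_eq)
      then show ?thesis unfolding monomials_def by auto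
    qed
    ultimately show ?thesis by blast
  next
    case False
    then have tpos: "0 < lookup \<mu> (n + 1)" by simp
    have peel: ?thesis if k: "k \<in> {1..q}" and eq: "\<mu> = st i (n + k) + \<nu>" and Vle: "V i \<nu> \<le> 0"
        and lt: "lookup \<nu> (n + 1) < lookup \<mu> (n + 1)" for k \<nu>
    proof -
      have "\<nu> \<in> W i" using less.prems(1) unfolding eq W_add by simp
      from less.hyps[OF lt this Vle] obtain u where u: "u \<in> monomials (n + q)" "mext (st i) u = \<nu>" by blast
      then have "single (n + k) 1 + u \<in> monomials (n + q)" "mext (st i) (single (n + k) 1 + u) = \<mu>"
        using k by (auto simp: mext_add eq intro: monomials_single)
      then show ?thesis by blast
    qed
    show ?thesis
    proof (cases "\<exists>k\<in>{i + 1..q}. lookup \<mu> (\<tau> k) > 0")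
      case True
      then obtain k where k: "k \<in> {i + 1..q}" "lookup \<mu> (\<tau> k) > 0" by blast
      obtain \<nu>1 where \<nu>1: "\<mu> = single (\<tau> k) 1 + \<nu>1" using pp_split[OF k(2)] by blast
      have kn: "k \<in> {1..n}" "k \<in> {1..q}" using k q_le_n by auto
      have "lookup \<nu>1 (n + 1) > 0" using tpos \<tau>_range[OF kn(1)] unfolding \<nu>1 by (simp add: lookup_add lookup_single_if)
      then obtain \<nu> where \<nu>: "\<nu>1 = single (n + 1) 1 + \<nu>" using pp_split by blast
      have "st i (n + k) = single (\<tau> k) 1 + single (n + 1) 1" unfolding st_T[OF kn(2)] using k(1) by (simp add: X_def)
      then have eq: "\<mu> = st i (n + k) + \<nu>" by (simp only: \<nu>1 \<nu> add.assoc)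
      have "V i \<mu> = V i \<nu>"
        unfolding \<nu>1 \<nu> V_add V_single_t V_single_\<tau>[OF kn(1) assms(3)] using k assms(3) by auto
      moreover have "lookup \<nu> (n + 1) < lookup \<mu> (n + 1)"
        unfolding \<nu>1 \<nu> by (simp add: lookup_add)
      ultimately show ?thesis using peel[OF kn(2) eq] less.prems(2) by simp
    next
      case False
      then have "(\<Sum>k\<in>{i + 1..q}. int (lookup \<mu> (\<tau> k))) = 0" by (intro sum.neutral) auto
      then have Vmu: "V i \<mu> = int (lookup \<mu> (n + 1)) - int (min i q) * int (lookup \<mu> (\<tau> 1))" by (simp add: V_def)
      have "lookup \<mu> (\<tau> 1) > 0"
        using less.prems(2) tpos unfolding Vmu by (cases "lookup \<mu> (\<tau> 1) = 0") auto
      then obtain \<nu>1 where \<nu>1: "\<mu> = single (\<tau> 1) 1 + \<nu>1" using pp_split by blast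
      \<comment> \<open>As many factors t as one y_1 can carry. If the bound \<open>min i q\<close>
        is reached, \<open>V\<close> does not change; otherwise t is used up and the inequality is
        automatic.\<close>
      define j where "j = min (min i q) (lookup \<mu> (n + 1))"
      have j: "1 \<le> j" "j \<le> i" "j \<le> q" using assms(3) q1 tpos by (auto simp: j_def)
      have jq: "j \<in> {1..q}" using j by simp
      have t1: "\<tau> 1 \<noteq> n + 1" using \<tau>_range[of 1] n1 by simp
      define \<nu> where "\<nu> = \<nu>1 - single (n + 1) j"
      have jle: "j \<le> lookup \<nu>1 (n + 1)" using t1 by (simp add: j_def \<nu>1 lookup_add lookup_single_if)
      have \<nu>: "\<nu>1 = single (n + 1) j + \<nu>"
        unfolding \<nu>_def using jle by (intro poly_mapping_eqI) (auto simp: lookup_add lookup_minus lookup_single_if)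
      have "single (n + 1) j = single (n + 1) (min (j - 1) q) + single (n + 1) (1::nat)"
        using j by (simp add: single_add[symmetric])
      moreover have "st i (n + j) = single (\<tau> 1) 1 + single (n + 1) (min (j - 1) q) + single (n + 1) 1"
        unfolding st_T[OF jq] using j by (simp add: X_def)
      ultimately have eq: "\<mu> = st i (n + j) + \<nu>" by (simp only: \<nu>1 \<nu> add.assoc)
      have lt: "lookup \<nu> (n + 1) < lookup \<mu> (n + 1)"
        unfolding \<nu>1 \<nu> using j by (simp add: lookup_add)
      have "V i \<nu> \<le> 0"
      proof (cases "j = min i q")
        case True
        have "V i \<mu> = V i \<nu>"
          unfolding \<nu>1 \<nu> V_add V_single_t using V_single_\<tau>[of 1 i] n1 assms(3) True by simp
        then show ?thesis using less.prems(2) by simp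
      next
        case False
        then have "j = lookup \<mu> (n + 1)" by (simp add: j_def split: if_splits)
        then have "lookup \<nu> (n + 1) = 0" using t1 unfolding \<nu>1 \<nu> by (simp add: lookup_add lookup_single_if)
        moreover have "0 \<le> (\<Sum>k\<in>{i + 1..q}. int (lookup \<nu> (\<tau> k)))" by (rule sum_nonneg) simp
        moreover have "0 \<le> int (min i q) * int (lookup \<nu> (\<tau> 1))" by simp
        ultimately show ?thesis unfolding V_def by linarith
      qed
      then show ?thesis using peel[OF jq eq] lt by simp
    qed
  qed
qed

lemma psub_st_keys:
  assumes "p \<in> carrier (PR (n + q))" "1 \<le> i" "i \<le> n" "\<mu> \<in> keys (psub (st i) p)"
  shows "\<mu> \<in> W i \<and> V i \<mu> \<le> 0"
proof -
  obtain u where "u \<in> keys p" "\<mu> = mext (st i) u" using keys_psub[of "st i" p] assms(4) by blast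
  then show ?thesis using image_st[of u i] assms by (auto simp: PR_carrier)
qed

section \<open>Passing to the next stage by one linear form\<close>

definition \<theta> :: "nat \<Rightarrow> 'k::field mpoly" where
  "\<theta> i = var (\<tau> (i + 1)) - var (n + min i q)"

text \<open>The common image at stage i + 1 of the two variables occurring in
  \<open>\<theta> i\<close>.\<close>

definition \<rho> :: "nat \<Rightarrow> pp" where
  "\<rho> i = single (\<tau> 1) 1 + single (n + 1) (min i q)"

lemma st_T_min:
  assumes "1 \<le> i" "min i q \<le> j"
  shows "st j (n + min i q) = \<rho> i"
proof -
  have m: "min i q \<in> {1..q}" using assms q1 by auto
  have "single (n + 1) (min (min i q - 1) q) + single (n + 1) (1::nat) = single (n + 1) (min i q)"
    using m by (auto simp: single_add[symmetric])
  then show ?thesis unfolding st_T[OF m] using assms(2) by (simp add: X_def \<rho>_def add.assoc)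
qed

lemma psub_\<theta>:
  assumes "1 \<le> i" "i < n"
  shows "psub (st i) (\<theta> i) = var (\<tau> (i + 1)) - mpmon (\<rho> i)"
proof -
  have "i + 1 \<in> {1..n}" "min i q \<le> i" using assms by auto
  then show ?thesis
    unfolding \<theta>_def psub_diff psub_var st_\<tau>[OF \<open>i + 1 \<in> {1..n}\<close>] st_T_min[OF assms(1) \<open>min i q \<le> i\<close>]
    by (simp add: X_def var_def)
qed

lemma \<theta>_carrier: "1 \<le> i \<Longrightarrow> i < n \<Longrightarrow> \<theta> i \<in> carrier (PR (n + q))"
  using \<tau>_range[of "i + 1"] q1 unfolding \<theta>_def by (intro PR_diff PR_var) auto

lemma stage_mono:
  assumes "1 \<le> i" "i < n" "v \<in> {1..n + q}"
  shows "mext (\<lambda>w. if w = \<tau> (i + 1) then \<rho> i else single w 1) (st i v) = st (i + 1) v"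
proof -
  let ?\<sigma> = "\<lambda>w. if w = \<tau> (i + 1) then \<rho> i else single w 1"
  have t1: "\<tau> 1 \<noteq> \<tau> (i + 1)" using assms \<tau>_eq_iff[of 1 "i + 1"] by simp
  have tn: "n + 1 \<noteq> \<tau> (i + 1)" using assms \<tau>_range[of "i + 1"] by simp
  have sig: "mext ?\<sigma> (single w a) = single w a" if "w \<noteq> \<tau> (i + 1)" for w a
  proof -
    have "mext ?\<sigma> (single w a) = mext (\<lambda>v. single v 1) (single w a)"
      by (rule mext_cong) (use that in \<open>auto simp: keys_single split: if_splits\<close>)
    then show ?thesis by (simp only: mext_id)
  qed
  have X: "mext ?\<sigma> (X i k) = X (i + 1) k" if k: "k \<in> {1..n}" for k
  proof -
    consider "k \<le> i" | "k = i + 1" | "k > i + 1" by linarith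
    then show ?thesis
    proof cases
      case 1
      then show ?thesis using sig[OF t1, of 1] sig[OF tn] t1 by (simp add: X_def mext_add)
    next
      case 2
      then show ?thesis by (simp add: X_def \<rho>_def)
    next
      case 3
      then have "\<tau> k \<noteq> \<tau> (i + 1)" using assms k \<tau>_eq_iff[of k "i + 1"] by simp
      then show ?thesis using 3 by (simp add: X_def)
    qed
  qed
  show ?thesis
    using assms(3)
  proof (cases rule: var_cases)
    case (1 k)
    then show ?thesis using X by (simp add: st_\<tau>)
  next
    case (2 k)
    then have "k \<in> {1..n}" using q_le_n by auto
    show ?thesis unfolding 2(2) st_T[OF 2(1)] mext_add sig[OF tn] X[OF \<open>k \<in> {1..n}\<close>] by (rule refl)
  qed
qed

lemma stage_subset:
  assumes "1 \<le> i" "i < n"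
  shows "pker (n + q) (st i) \<subseteq> pker (n + q) (st (i + 1))"
  by (rule pker_mono[of _ "\<lambda>w. if w = \<tau> (i + 1) then \<rho> i else single w 1"]) (rule stage_mono[OF assms])

text \<open>The image of \<open>p\<close> at stage \<open>i\<close> vanishes when the variable x =
  \<open>\<tau> (i + 1)\<close> is replaced by \<open>\<rho> i\<close>, so it equals (x - \<rho>) h.
  The point is that h again lies in the image ring, so that it can be lifted to the multiplier
  \<open>r\<close>; by \<open>surj_st\<close> this amounts to \<open>V i\<close> being nonpositive
  on its monomials.\<close>

lemma stage_step:
  fixes p :: "'k::field mpoly"
  assumes i: "1 \<le> i" "i < n" and p: "p \<in> pker (n + q) (st (i + 1))"
  shows "\<exists>r\<in>carrier (PR (n + q)). p - \<theta> i * r \<in> pker (n + q) (st i)"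
proof -
  let ?\<sigma> = "\<lambda>w. if w = \<tau> (i + 1) then \<rho> i else single w 1"
  let ?x = "\<tau> (i + 1)"
  have pc: "p \<in> carrier (PR (n + q))" and p0: "psub (st (i + 1)) p = 0" using p by (auto simp: pker_def)
  define g where "g = psub (st i) p"
  have "psub ?\<sigma> g = psub (\<lambda>v. mext ?\<sigma> (st i v)) p" by (simp add: g_def psub_psub)
  also have "\<dots> = psub (st (i + 1)) p"
    by (rule psub_cong, rule stage_mono[OF i]) (use pc in \<open>auto simp: PR_carrier monomials_def subset_iff\<close>)
  finally have \<sigma>g: "psub ?\<sigma> g = 0" using p0 by simp
  have keys_g: "\<mu> \<in> W i \<and> V i \<mu> \<le> 0" if "\<mu> \<in> keys g" for \<mu>
    using psub_st_keys[OF pc i(1)] i(2) that by (simp add: g_def)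
  have i1: "i + 1 \<in> {1..n}" "1 \<in> {1..n}" using i n1 by auto
  have xW: "single ?x 1 \<in> W i" using W_single_\<tau>[OF i1(1)] i by simp
  have \<rho>W: "\<rho> i \<in> W i" using W_single_\<tau>[OF i1(2), of i 1] W_single_t[of i "min i q"] i by (simp add: \<rho>_def W_add)
  have "\<exists>h. keys h \<subseteq> W i \<and> g - psub ?\<sigma> g = (var ?x - mpmon (\<rho> i)) * h"
    by (rule divide_binomial) (use keys_g xW \<rho>W W_add in auto)
  then obtain h where h: "keys h \<subseteq> W i" "g = (var ?x - mpmon (\<rho> i)) * h" using \<sigma>g by auto
  have Vx: "V i (single ?x 1) \<le> 0" using V_single_\<tau>[OF i1(1) i(1)] i by simp
  have V\<rho>: "V i (\<rho> i) = 0" unfolding \<rho>_def V_add V_single_t using V_single_\<tau>[OF i1(2) i(1)] by simp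
  have \<tau>1x: "\<tau> 1 \<noteq> ?x" using \<tau>_eq_iff[OF i1(2,1)] i by simp
  have keys_h: "V i \<nu> \<le> 0" if "\<nu> \<in> keys h" for \<nu>
  proof (rule ccontr)
    assume "\<not> V i \<nu> \<le> 0"
    \<comment> \<open>Among the bad monomials take one with maximal exponent of y_1. Its product
      with \<rho> can be cancelled only by x times a monomial with one more y_1, and that one is bad
      too because \<open>V i\<close> vanishes on \<rho> and is nonpositive on x. So a bad term would
      survive in \<open>g\<close>.\<close>
    define K where "K = {\<nu> \<in> keys h. V i \<nu> > 0}"
    have K: "finite K" "K \<noteq> {}" using that \<open>\<not> V i \<nu> \<le> 0\<close> by (auto simp: K_def)
    have "Max ((\<lambda>\<nu>. lookup \<nu> (\<tau> 1)) ` K) \<in> (\<lambda>\<nu>. lookup \<nu> (\<tau> 1)) ` K" using K by (intro Max_in) auto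
    then obtain \<nu>0 where \<nu>0: "\<nu>0 \<in> K" "lookup \<nu>0 (\<tau> 1) = Max ((\<lambda>\<nu>. lookup \<nu> (\<tau> 1)) ` K)" by auto
    have max: "lookup \<nu> (\<tau> 1) \<le> lookup \<nu>0 (\<tau> 1)" if "\<nu> \<in> K" for \<nu>
      unfolding \<nu>0(2) using K that by (intro Max_ge) auto
    have z: "lookup (var ?x * h) (\<rho> i + \<nu>0) = 0"
    proof (rule ccontr)
      assume "lookup (var ?x * h) (\<rho> i + \<nu>0) \<noteq> 0"
      then have "\<rho> i + \<nu>0 \<in> keys (single (single ?x 1) 1 * h)" by (simp add: in_keys_iff var_def mpmon_def)
      then obtain \<nu>2 where \<nu>2: "\<nu>2 \<in> keys h" "\<rho> i + \<nu>0 = single ?x 1 + \<nu>2"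
        using keys_single_mult[of "single ?x 1" 1 h] by blast
      have "V i \<nu>0 = V i (single ?x 1) + V i \<nu>2" using arg_cong[OF \<nu>2(2), of "V i"] by (simp only: V_add V\<rho>)
      then have "\<nu>2 \<in> K" using \<nu>0(1) \<nu>2(1) Vx by (simp add: K_def)
      moreover have "lookup \<nu>2 (\<tau> 1) \<ge> lookup \<nu>0 (\<tau> 1) + 1"
        using arg_cong[OF \<nu>2(2), of "\<lambda>m. lookup m (\<tau> 1)"] \<tau>1x by (simp add: \<rho>_def lookup_add lookup_single_if)
      ultimately show False using max[of \<nu>2] by simp
    qed
    have "lookup (mpmon (\<rho> i) * h) (\<rho> i + \<nu>0) = lookup h \<nu>0"
      using lookup_single_mult[of "\<rho> i" 1 h \<nu>0] by (simp add: mpmon_def)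
    then have "lookup g (\<rho> i + \<nu>0) = - lookup h \<nu>0"
      unfolding h(2) left_diff_distrib lookup_minus z by simp
    moreover have "lookup h \<nu>0 \<noteq> 0" using \<nu>0(1) by (simp add: K_def in_keys_iff)
    ultimately have "\<rho> i + \<nu>0 \<in> keys g" by (simp add: in_keys_iff)
    then have "V i (\<rho> i + \<nu>0) \<le> 0" using keys_g by blast
    then show False using \<nu>0(1) by (simp add: V_add V\<rho> K_def)
  qed
  have "\<exists>u\<in>monomials (n + q). mext (st i) u = \<mu>" if "\<mu> \<in> keys h" for \<mu>
    using surj_st[of \<mu> i] keys_h[OF that] h(1) that i by auto
  then obtain r where r: "r \<in> carrier (PR (n + q))" "psub (st i) r = h" by (rule psub_lift)
  have "p - \<theta> i * r \<in> pker (n + q) (st i)"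
    unfolding pker_def
  proof (rule CollectI, rule conjI)
    show "p - \<theta> i * r \<in> carrier (PR (n + q))" by (intro PR_diff PR_mult \<theta>_carrier i pc r)
    have "psub (st i) (p - \<theta> i * r) = g - (var ?x - mpmon (\<rho> i)) * h"
      unfolding psub_diff psub_mult psub_\<theta>[OF i] r(2) g_def ..
    then show "psub (st i) (p - \<theta> i * r) = 0" using h(2) by simp
  qed
  then show ?thesis using r(1) by blast
qed

lemma st_1:
  assumes "v \<in> {1..n + q}"
  shows "st 1 v = rg v"
  using assms
proof (cases rule: var_cases)
  case (1 k)
  then show ?thesis using \<tau>_range[OF 1(1)] by (cases "k = 1") (simp_all add: st_\<tau> X_def rg_X)
next
  case (2 k)
  then have "k \<in> {1..n}" using q_le_n by auto
  then show ?thesis unfolding 2(2) st_T[OF 2(1)] rg_T[OF 2(1)] using \<tau>_s[OF 2(1)] 2(1)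
    by (cases "k = 1") (simp_all add: X_def)
qed

lemma pker_st_1: "pker (n + q) (st 1) = pker (n + q) rg"
  by (rule pker_cong) (rule st_1)

lemma st_nonzero:
  assumes "v \<in> {1..n + q}"
  shows "st i v \<noteq> 0"
proof -
  have X: "0 < mdeg (X i k)" for k by (cases "k \<le> i") (simp_all add: X_def)
  have "0 < mdeg (st i v)" using X[of "ti v"] by (simp add: st_def)
  then show ?thesis by auto
qed

lemma stage_ideal_Suc:
  assumes i: "1 \<le> i" "i < n"
  shows "pker (n + q) (st (i + 1)) = {u + \<theta> i * r | u r. u \<in> pker (n + q) (st i) \<and> r \<in> carrier (PR (n + q) :: 'k::field mpoly ring)}"
    (is "?L = ?R")
proof
  show "?L \<subseteq> ?R"
  proof
    fix p :: "'k mpoly" assume "p \<in> ?L"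
    from stage_step[OF i this] obtain r where r: "r \<in> carrier (PR (n + q))" "p - \<theta> i * r \<in> pker (n + q) (st i)" by blast
    have "p = (p - \<theta> i * r) + \<theta> i * r" by simp
    then show "p \<in> ?R" using r by blast
  qed
  have i1: "i + 1 \<in> {1..n}" using i by auto
  have "st (i + 1) (\<tau> (i + 1)) = \<rho> i" unfolding st_\<tau>[OF i1] by (simp add: X_def \<rho>_def)
  moreover have "st (i + 1) (n + min i q) = \<rho> i" by (rule st_T_min[OF i(1)]) simp
  ultimately have "psub (st (i + 1)) (\<theta> i :: 'k mpoly) = 0" by (simp add: \<theta>_def psub_diff)
  then have \<theta>: "(\<theta> i :: 'k mpoly) \<in> ?L" using \<theta>_carrier[OF i] by (simp add: pker_def)
  show "?R \<subseteq> ?L"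
  proof
    fix p assume "p \<in> ?R"
    then obtain u r where p: "p = u + \<theta> i * r" "u \<in> pker (n + q) (st i)" "r \<in> carrier (PR (n + q))" by blast
    have "u \<in> ?L" using p(2) stage_subset[OF i] by blast
    moreover have "r * \<theta> i \<in> ?L" by (rule ideal_PR_mult[OF pker_ideal \<theta> p(3)])
    ultimately show "p \<in> ?L" unfolding p(1) using ideal_PR_add[OF pker_ideal] by (metis mult.commute)
  qed
qed

lemma pker_cancel:
  assumes "a \<in> carrier (PR N)" "x * a \<in> pker N g" "psub g x \<noteq> (0 :: 'k::field mpoly)"
  shows "a \<in> pker N g"
  using assms by (simp add: pker_def psub_mult)

lemma principal_ideal_sum:
  fixes I :: "'k::field mpoly set"
  assumes I: "ideal I (PR N)" and x: "x \<in> carrier (PR N)"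
  shows "ideal {u + x * r | u r. u \<in> I \<and> r \<in> carrier (PR N)} (PR N)" (is "ideal ?S _")
proof -
  have mem: "u + x * r \<in> ?S" if "u \<in> I" "r \<in> carrier (PR N)" for u r using that by blast
  have "a \<in> carrier (PR N)" if "a \<in> ?S" for a
    using that ideal_PR_carrier[OF I] x PR_add PR_mult by blast
  moreover have "0 \<in> ?S" using mem[OF ideal_PR_0[OF I] PR_0] by simp
  moreover have "a + b \<in> ?S" if ab: "a \<in> ?S" "b \<in> ?S" for a b
  proof -
    obtain u r where a: "a = u + x * r" "u \<in> I" "r \<in> carrier (PR N)" using ab(1) by blast
    obtain u' r' where b: "b = u' + x * r'" "u' \<in> I" "r' \<in> carrier (PR N)" using ab(2) by blast
    have "a + b = (u + u') + x * (r + r')" by (simp add: a(1) b(1) algebra_simps)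
    then show ?thesis using mem[OF ideal_PR_add[OF I a(2) b(2)] PR_add[OF a(3) b(3)]] by simp
  qed
  moreover have "y * a \<in> ?S" if ay: "a \<in> ?S" "y \<in> carrier (PR N)" for a y
  proof -
    obtain u r where a: "a = u + x * r" "u \<in> I" "r \<in> carrier (PR N)" using ay(1) by blast
    have "y * a = y * u + x * (y * r)" by (simp add: a(1) algebra_simps)
    then show ?thesis using mem[OF ideal_PR_mult[OF I a(2) ay(2)] PR_mult[OF ay(2) a(3)]] by simp
  qed
  ultimately show ?thesis unfolding ideal_PR_iff by (intro conjI ballI subsetI) blast+
qed

section \<open>The complete regular sequence and the depth\<close>

definition seq :: "nat \<Rightarrow> 'k::field mpoly" where
  "seq i = (if Suc i < n then \<theta> (Suc i) else if Suc i = n then var (\<tau> 1) else var (n + q))"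

text \<open>The ideals generated over J by initial segments of the sequence. Up to index n - 1 they
  are given as kernels, hence are visibly prime; only the steps for y_1 and T_q adjoin an element
  explicitly.\<close>

primrec idl :: "nat \<Rightarrow> 'k::field mpoly set" where
  "idl 0 = pker (n + q) (st 1)"
| "idl (Suc i) = (if Suc i < n then pker (n + q) (st (Suc (Suc i)))
     else {u + seq i * r | u r. u \<in> idl i \<and> r \<in> carrier (PR (n + q))})"

lemma seq_carrier: "seq i \<in> carrier (PR (n + q))"
  using \<theta>_carrier[of "Suc i"] \<tau>_range[of 1] n1 q1 by (auto simp: seq_def intro: PR_var)

lemma idl_low: "i < n \<Longrightarrow> idl i = pker (n + q) (st (Suc i))"
  by (cases i) simp_all

lemma idl_Suc: "idl (Suc i) = {u + seq i * r | u r. u \<in> idl i \<and> r \<in> carrier (PR (n + q) :: 'k::field mpoly ring)}"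
proof (cases "Suc i < n")
  case True
  then have s: "seq i = (\<theta> (Suc i) :: 'k mpoly)" by (simp add: seq_def)
  have l: "idl i = (pker (n + q) (st (Suc i)) :: 'k mpoly set)" using True by (intro idl_low) simp
  show ?thesis unfolding s l using True stage_ideal_Suc[of "Suc i", where 'k = 'k] by simp
qed simp

lemma idl_ideal: "ideal (idl i) (PR (n + q) :: 'k::field mpoly ring)"
proof (induction i)
  case 0
  then show ?case by (simp add: pker_ideal)
next
  case (Suc i)
  show ?case unfolding idl_Suc by (rule principal_ideal_sum[OF Suc seq_carrier])
qed

lemma idl_n: "idl n = {u + var (\<tau> 1) * r | u r. u \<in> pker (n + q) (st n) \<and> r \<in> carrier (PR (n + q) :: 'k::field mpoly ring)}"
proof -
  obtain n' where n': "n = Suc n'" using n1 by (cases n) auto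
  have l: "idl n' = (pker (n + q) (st n) :: 'k mpoly set)" using idl_low[of n'] n' by simp
  have s: "seq n' = (var (\<tau> 1) :: 'k mpoly)" by (simp add: seq_def n'[symmetric])
  have "idl n = {u + seq n' * r | u r. u \<in> idl n' \<and> r \<in> carrier (PR (n + q) :: 'k mpoly ring)}"
    using idl_Suc[of n'] n' by simp
  then show ?thesis unfolding l s .
qed

lemma seq_n: "seq n = var (n + q)"
  by (simp add: seq_def)

text \<open>The image ring at stage n is spanned by the y_1^a t^b with b at most q a. If T_q a lies
  in the ideal, cancelling y_1 shows that t^q times the image of \<open>a\<close> is in this ring.
  Each of its monomials then satisfies the inequality with q to spare, so it can be divided by one
  y_1 inside the ring.\<close>

lemma last_regular:
  fixes a :: "'k::field mpoly"
  assumes a: "a \<in> carrier (PR (n + q))" and T: "seq n * a \<in> idl n"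
  shows "a \<in> idl n"
proof -
  let ?\<phi> = "psub (st n) :: 'k mpoly \<Rightarrow> 'k mpoly"
  obtain u r where ur: "var (n + q) * a = u + var (\<tau> 1) * r" "u \<in> pker (n + q) (st n)" "r \<in> carrier (PR (n + q))"
    using T unfolding idl_n seq_n by blast
  have \<tau>1: "1 \<in> {1..n}" using n1 by simp
  have st1: "st n (\<tau> 1) = single (\<tau> 1) 1" unfolding st_\<tau>[OF \<tau>1] using n1 by (simp add: X_def)
  have stT: "st n (n + q) = single (\<tau> 1) 1 + single (n + 1) q"
    using st_T_min[of q n] q1 q_le_n by (simp add: \<rho>_def)
  have "?\<phi> (var (n + q) * a) = ?\<phi> (u + var (\<tau> 1) * r)" using ur(1) by simp
  then have "mpmon (single (\<tau> 1) 1) * (mpmon (single (n + 1) q) * ?\<phi> a) = mpmon (single (\<tau> 1) 1) * ?\<phi> r"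
    using ur(2) unfolding psub_mult psub_add psub_var st1 stT mpmon_add mult.assoc by (simp add: pker_def)
  then have eq: "mpmon (single (n + 1) q) * ?\<phi> a = ?\<phi> r" using mult_left_cancel[OF mpmon_nonzero] by blast
  have key: "\<exists>\<nu>. \<mu> = single (\<tau> 1) 1 + \<nu> \<and> \<nu> \<in> W n \<and> V n \<nu> \<le> 0" if \<mu>: "\<mu> \<in> keys (?\<phi> a)" for \<mu>
  proof -
    have W: "\<mu> \<in> W n" using psub_st_keys[OF a n1 order_refl \<mu>] by simp
    have "single (n + 1) q + \<mu> \<in> keys (?\<phi> r)"
      using \<mu> lookup_single_mult[of "single (n + 1) q" 1 "?\<phi> a" \<mu>] unfolding eq[symmetric] by (simp add: in_keys_iff mpmon_def)
    then have "V n (single (n + 1) q + \<mu>) \<le> 0" using psub_st_keys[OF ur(3) n1 order_refl] by blast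
    then have V\<mu>: "V n \<mu> + int q \<le> 0" unfolding V_add V_single_t by simp
    have min: "min n q = q" using q_le_n by simp
    have "(\<Sum>k\<in>{n + 1..q}. int (lookup \<mu> (\<tau> k))) = 0" using q_le_n by simp
    then have "V n \<mu> = int (lookup \<mu> (n + 1)) - int q * int (lookup \<mu> (\<tau> 1))" unfolding V_def min by simp
    then have "lookup \<mu> (\<tau> 1) > 0" using V\<mu> q1 by (cases "lookup \<mu> (\<tau> 1) = 0") auto
    then obtain \<nu> where \<nu>: "\<mu> = single (\<tau> 1) 1 + \<nu>" using pp_split by blast
    have "V n \<mu> = V n \<nu> - int q" unfolding \<nu> V_add using V_single_\<tau>[OF \<tau>1 n1] min by simp
    then show ?thesis using V\<mu> W \<nu> by (auto simp: W_add)
  qed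
  then have "\<forall>\<mu>\<in>keys (?\<phi> a). \<exists>\<nu>. \<mu> = single (\<tau> 1) 1 + \<nu> \<and> \<nu> \<in> W n \<and> V n \<nu> \<le> 0" by blast
  from bchoice[OF this] obtain D where D: "\<And>\<mu>. \<mu> \<in> keys (?\<phi> a) \<Longrightarrow> \<mu> = single (\<tau> 1) 1 + D \<mu> \<and> D \<mu> \<in> W n \<and> V n (D \<mu>) \<le> 0"
    by blast
  define h where "h = (\<Sum>\<mu>\<in>keys (?\<phi> a). single (D \<mu>) (lookup (?\<phi> a) \<mu>))"
  have "mpmon (single (\<tau> 1) 1) * h = (\<Sum>\<mu>\<in>keys (?\<phi> a). single \<mu> (lookup (?\<phi> a) \<mu>))"
    unfolding h_def sum_distrib_left mpmon_def mult_single using D by (intro sum.cong) auto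
  then have h: "?\<phi> a = mpmon (single (\<tau> 1) 1) * h" using mpoly_expand[of "?\<phi> a"] by simp
  have "\<exists>u\<in>monomials (n + q). mext (st n) u = \<mu>" if \<mu>h: "\<mu> \<in> keys h" for \<mu>
  proof -
    obtain \<nu> where "\<nu> \<in> keys (?\<phi> a)" "\<mu> \<in> keys (single (D \<nu>) (lookup (?\<phi> a) \<nu>))"
      using subsetD[OF keys_sum \<mu>h[unfolded h_def]] by blast
    then have "\<nu> \<in> keys (?\<phi> a)" "\<mu> = D \<nu>" by (simp_all add: keys_single split: if_splits)
    then show ?thesis using D[of \<nu>] surj_st[of \<mu> n] n1 by simp
  qed
  then obtain r' where r': "r' \<in> carrier (PR (n + q))" "?\<phi> r' = h" by (rule psub_lift)
  have v1: "var (\<tau> 1) \<in> carrier (PR (n + q))" using \<tau>_range[OF \<tau>1] by (intro PR_var) auto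
  have "a - var (\<tau> 1) * r' \<in> pker (n + q) (st n)"
    unfolding pker_def mem_Collect_eq psub_diff psub_mult psub_var st1 r'(2) h
    by (intro conjI PR_diff PR_mult a v1 r'(1)) simp
  moreover have "a = (a - var (\<tau> 1) * r') + var (\<tau> 1) * r'" by simp
  ultimately show ?thesis unfolding idl_n using r'(1) by blast
qed

text \<open>Below index n the ideal is the kernel of a map to a domain, where an element with
  nonzero image can be cancelled.\<close>

lemma idl_regular:
  fixes a :: "'k::field mpoly"
  assumes i: "i < n + 1" and a: "a \<in> carrier (PR (n + q))" and x: "seq i * a \<in> idl i"
  shows "a \<in> idl i"
proof (cases "i = n")
  case True
  then show ?thesis using last_regular a x by simp
next
  case False
  then have in': "i < n" using i by simp
  have "psub (st (Suc i)) (seq i :: 'k mpoly) \<noteq> 0"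
  proof (cases "Suc i < n")
    case True
    then have "psub (st (Suc i)) (seq i) = var (\<tau> (Suc (Suc i))) - (mpmon (\<rho> (Suc i)) :: 'k mpoly)"
      using psub_\<theta>[of "Suc i", where 'a = 'k] by (simp add: seq_def)
    moreover have "\<tau> (Suc (Suc i)) \<noteq> \<tau> 1" using \<tau>_eq_iff[of "Suc (Suc i)" 1] True by simp
    then have "lookup (single (\<tau> (Suc (Suc i))) 1) (\<tau> 1) \<noteq> lookup (\<rho> (Suc i)) (\<tau> 1)"
      by (simp add: \<rho>_def lookup_add lookup_single_if)
    then have "single (\<tau> (Suc (Suc i))) 1 \<noteq> \<rho> (Suc i)" by metis
    ultimately show ?thesis by (simp add: var_def)
  next
    case False
    then have "seq i = (var (\<tau> 1) :: 'k mpoly)" using in' by (simp add: seq_def)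
    then show ?thesis by simp
  qed
  then show ?thesis using pker_cancel[OF a] x unfolding idl_low[OF in'] by blast
qed

lemma lookup_var_0: "lookup (var v :: 'k::field mpoly) 0 = 0"
proof -
  have "0 \<notin> keys (var v :: 'k mpoly)" by (simp add: var_def) (metis mdeg_0 mdeg_single zero_neq_one One_nat_def)
  then show ?thesis by (simp add: in_keys_iff)
qed

lemma seq_const_0: "lookup (seq i :: 'k::field mpoly) 0 = 0"
  by (simp add: seq_def \<theta>_def lookup_minus lookup_var_0)

lemma idl_const_0: "p \<in> idl i \<Longrightarrow> lookup (p :: 'k::field mpoly) 0 = 0"
proof (induction i arbitrary: p)
  case 0
  have "p \<in> pker (n + q) (st 1)" using 0 by simp
  with st_nonzero show ?case by (rule pker_const_0)
next
  case (Suc i)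
  then obtain u r where "p = u + seq i * r" "u \<in> idl i" unfolding idl_Suc by blast
  then show ?case using Suc.IH by (simp add: lookup_add lookup_mult_0 seq_const_0)
qed

lemma depth_pker:
  "depth (PR (n + q) Quot pker (n + q) rg) ((\<lambda>p. pker (n + q) rg +>\<^bsub>PR (n + q)\<^esub> p) ` irrelevant_ideal (n + q) :: 'k::field mpoly set set)
    = enat (n + 1)"
proof (rule antisym)
  let ?J = "pker (n + q) rg :: 'k mpoly set"
  let ?xs = "map (\<lambda>i. ?J +>\<^bsub>PR (n + q)\<^esub> seq i) [0..<n + 1]"
  show "depth (PR (n + q) Quot ?J) ((\<lambda>p. ?J +>\<^bsub>PR (n + q)\<^esub> p) ` irrelevant_ideal (n + q)) \<le> enat (n + 1)"
    by (rule depth_le[OF refl]) (rule rg_carrier)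
  have "regular_sequence (PR (n + q) Quot ?J) ?xs"
  proof (rule regular_chain[where A = idl])
    show "idl 0 = ?J" by (simp only: idl.simps pker_st_1)
    show "1 \<notin> idl (n + 1)" using idl_const_0[of 1 "n + 1"] by auto
  qed (rule idl_ideal seq_carrier idl_Suc idl_regular; assumption?)+
  moreover have "set ?xs \<subseteq> (\<lambda>p. ?J +>\<^bsub>PR (n + q)\<^esub> p) ` irrelevant_ideal (n + q)"
    using seq_carrier seq_const_0 by (auto simp: irrelevant_ideal_eq)
  ultimately have "enat (length ?xs) \<le> depth (PR (n + q) Quot ?J) ((\<lambda>p. ?J +>\<^bsub>PR (n + q)\<^esub> p) ` irrelevant_ideal (n + q))"
    by (rule depth_ge)
  then show "enat (n + 1) \<le> depth (PR (n + q) Quot ?J) ((\<lambda>p. ?J +>\<^bsub>PR (n + q)\<^esub> p) ` irrelevant_ideal (n + q))"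
    by simp
qed

end

section \<open>A chain of primes of length n + 1\<close>

context rees
begin

text \<open>Exponent 0 stands for the monomial 1, so the first \<open>j\<close> variables of A[t]
  are set to 1.\<close>

definition kill :: "nat \<Rightarrow> nat \<Rightarrow> pp" where
  "kill j w = (if w \<le> j then 0 else single w 1)"

lemma kill_kill: "mext (kill (Suc j)) (kill j w) = kill (Suc j) w"
  by (auto simp: kill_def)

lemma krull_pker:
  assumes q: "1 \<le> q"
  shows "krull_dim (PR (n + q) Quot (pker (n + q) rg :: 'k::field mpoly set)) = enat (n + 1)"
proof (rule antisym)
  let ?J = "pker (n + q) rg :: 'k mpoly set"
  show "krull_dim (PR (n + q) Quot ?J) \<le> enat (n + 1)"
    by (rule krull_dim_le[OF refl]) (rule rg_carrier)
  define g where "g j v = mext (kill j) (rg v)" for j v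
  define P where "P j = (pker (n + q) (g j) :: 'k mpoly set)" for j
  have gS: "mext (kill (Suc j)) (g j v) = g (Suc j) v" for j v
    unfolding g_def mext_mext kill_kill ..
  have mono: "P j \<subseteq> P (Suc j)" for j unfolding P_def by (rule pker_mono) (rule gS)
  have sub: "?J \<subseteq> P j" for j unfolding P_def by (rule pker_mono) (simp add: g_def)
  have strict: "P j \<subset> P (Suc j)" if j: "j < n + 1" for j
  proof -
    define v where "v = Suc j"
    have v: "v \<in> {1..n + q}" using j q by (auto simp: v_def)
    \<comment> \<open>The element \<open>var v - 1\<close> separates consecutive primes. The index n
      + 1 means T_1 in the source and t in the target: T_1 is mapped to y_1 t, which at stage n has
      become t.\<close>
    have gj: "g j v \<noteq> 0 \<and> g (Suc j) v = 0"
    proof (cases "v \<le> n")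
      case True
      then show ?thesis by (simp add: g_def rg_X kill_def v_def) (metis mdeg_0 mdeg_single zero_neq_one One_nat_def)
    next
      case False
      then have "v = n + 1" "j = n" using j by (auto simp: v_def)
      moreover have "s 1 \<le> n" "1 \<in> {1..q}" using s_bounds[of 1] q by auto
      ultimately show ?thesis
        using rg_T[of 1] by (simp add: g_def kill_def mext_add) (metis mdeg_0 mdeg_single zero_neq_one One_nat_def)
    qed
    have c: "(var v - 1 :: 'k mpoly) \<in> carrier (PR (n + q))" using v by (intro PR_diff PR_var PR_1) auto
    have "var v - 1 \<in> P (Suc j)" unfolding P_def pker_def using c gj by (simp add: psub_diff)
    moreover have "var v - 1 \<notin> P j"
    proof
      assume "var v - 1 \<in> P j"
      then have "(mpmon (g j v) :: 'k mpoly) = mpmon 0" unfolding P_def pker_def by (simp add: psub_diff)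
      then show False using gj by (simp only: mpmon_eq_iff)
    qed
    ultimately show ?thesis using mono[of j] by blast
  qed
  show "enat (n + 1) \<le> krull_dim (PR (n + q) Quot ?J)"
    by (rule krull_dim_ge[OF pker_ideal, where P = P]) (use sub strict pker_prime in \<open>auto simp: P_def\<close>)
qed

end

section \<open>Hilbert function and multiplicity\<close>

lemma range_const_subfield: "subfield (const ` UNIV) (PR N :: 'k::field mpoly ring)"
proof -
  interpret R: cring "PR N :: 'k mpoly ring" by (rule cring_PR)
  let ?K = "const ` UNIV :: 'k mpoly set"
  have Kc: "?K \<subseteq> carrier (PR N)" using PR_const by blast
  have "subring ?K (PR N)"
  proof (rule R.subringI[OF Kc])
    show "\<one>\<^bsub>PR N\<^esub> \<in> ?K" using const_simps(2) by (metis PR_simps(2) UNIV_I image_eqI)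
    fix x y assume x: "x \<in> ?K"
    then obtain a where a: "x = const a" by blast
    show "\<ominus>\<^bsub>PR N\<^esub> x \<in> ?K" unfolding a PR_a_inv[OF PR_const] const_simps(5)[symmetric] by blast
    assume "y \<in> ?K"
    then obtain b where b: "y = const b" by blast
    show "x \<otimes>\<^bsub>PR N\<^esub> y \<in> ?K" unfolding a b PR_simps const_simps(4)[symmetric] by blast
    show "x \<oplus>\<^bsub>PR N\<^esub> y \<in> ?K" unfolding a b PR_simps const_simps(3)[symmetric] by blast
  qed
  then have sc: "subcring ?K (PR N)" by (rule R.subcringI')
  show ?thesis
  proof (rule R.subfieldI[OF sc])
    show "Units (PR N\<lparr>carrier := ?K\<rparr>) = ?K - {\<zero>\<^bsub>PR N\<^esub>}"
    proof
      show "Units (PR N\<lparr>carrier := ?K\<rparr>) \<subseteq> ?K - {\<zero>\<^bsub>PR N\<^esub>}" by (auto simp: Units_def)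
      show "?K - {\<zero>\<^bsub>PR N\<^esub>} \<subseteq> Units (PR N\<lparr>carrier := ?K\<rparr>)"
      proof
        fix x assume "x \<in> ?K - {\<zero>\<^bsub>PR N\<^esub>}"
        then obtain a where "x = const a" "x \<noteq> 0" by auto
        then have a: "x = const a" "a \<noteq> 0" using const_simps(1) by auto
        then have "const (inverse a) * x = 1" "x * const (inverse a) = 1" by (simp_all flip: const_simps(4) add: const_simps(2))
        then show "x \<in> Units (PR N\<lparr>carrier := ?K\<rparr>)" using a(1) by (auto simp: Units_def)
      qed
    qed
  qed
qed

text \<open>Mirrors \<open>combine\<close>, which runs along two lists and stops at the shorter one.
  With \<open>U\<close> the identity it is the combination of the image monomials, otherwise that of
  chosen preimages.\<close>

definition zsum :: "(pp \<Rightarrow> pp) \<Rightarrow> 'k::field list \<Rightarrow> pp list \<Rightarrow> 'k mpoly" where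
  "zsum U cs ms = sum_list (map (\<lambda>(c, m). single (U m) c) (zip cs ms))"

lemma zsum_simps [simp]:
  "zsum U [] ms = 0" "zsum U cs [] = 0"
  "zsum U (c # cs) (m # ms) = single (U m) c + zsum U cs ms"
  by (simp_all add: zsum_def)

lemma lookup_zsum_notin: "m \<notin> set ms \<Longrightarrow> lookup (zsum (\<lambda>m. m) cs ms) m = 0"
proof (induction ms arbitrary: cs)
  case (Cons a ms)
  then show ?case by (cases cs) (auto simp: lookup_add lookup_single when_def)
qed simp

lemma zsum_0: "distinct ms \<Longrightarrow> zsum (\<lambda>m. m) cs ms = 0 \<Longrightarrow> c \<in> set (take (length ms) cs) \<Longrightarrow> c = 0"
proof (induction ms arbitrary: cs)
  case (Cons a ms)
  then show ?case
  proof (cases cs)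
    case (Cons b bs)
    have "lookup (zsum (\<lambda>m. m) cs (a # ms)) a = b"
      using Cons.prems(1) lookup_zsum_notin[of a ms bs] unfolding Cons by (simp add: lookup_add)
    then have b: "b = 0" using Cons.prems(2) by simp
    then have "zsum (\<lambda>m. m) bs ms = 0" using Cons.prems(2) unfolding Cons by simp
    then show ?thesis using Cons.IH[of bs] Cons.prems b unfolding Cons by auto
  qed simp
qed simp

lemma zsum_map: "zsum U (map f ms) ms = sum_list (map (\<lambda>m. single (U m) (f m)) ms)"
  by (induction ms) auto

lemma psub_zsum:
  "(\<And>m. m \<in> set ms \<Longrightarrow> mext g (U m) = m) \<Longrightarrow> psub g (zsum U cs ms) = zsum (\<lambda>m. m) cs ms"
proof (induction ms arbitrary: cs)
  case (Cons a ms)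
  then show ?case by (cases cs) (auto simp: psub_add psub_single)
qed simp

lemma zsum_homog:
  "(\<And>m. m \<in> set ms \<Longrightarrow> U m \<in> monomials N \<and> int (mdeg (U m)) = j) \<Longrightarrow> zsum U cs ms \<in> homog N j"
proof (induction ms arbitrary: cs)
  case (Cons a ms)
  then show ?case by (cases cs) (auto intro!: homog_add homog_single)
qed simp

text \<open>Choose one preimage of degree i for each image monomial. Their classes are independent
  because the images are distinct monomials, and they span because the difference of a form and its
  combination of preimages is mapped to 0.\<close>

lemma quot_comp_dimension:
  fixes g :: "nat \<Rightarrow> pp" and N :: nat
  defines "J \<equiv> pker N g :: 'k::field mpoly set"
  assumes g0: "\<And>v. v \<in> {1..N} \<Longrightarrow> g v \<noteq> 0"
    and M: "finite M" "M = mext g ` {u \<in> monomials N. mdeg u = i}"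
  shows "ring.dimension (PR N Quot J) (card M) ((\<lambda>c. J +>\<^bsub>PR N\<^esub> const c) ` UNIV) (quot_comp N J (int i))"
    and "subfield ((\<lambda>c. J +>\<^bsub>PR N\<^esub> const c) ` UNIV) (PR N Quot J)"
proof -
  have Ji: "ideal J (PR N)" unfolding J_def by (rule pker_ideal)
  let ?S = "PR N Quot J"
  let ?q = "\<lambda>p. J +>\<^bsub>PR N\<^esub> p"
  let ?K = "(\<lambda>c. ?q (const c)) ` UNIV"
  interpret h: ring_hom_ring "PR N" ?S ?q by (rule ideal.rcos_ring_hom_ring[OF Ji])
  have Kim: "?K = ?q ` (const ` UNIV)" by (simp add: image_image)
  have "(1 :: 'k mpoly) \<notin> J" by (simp add: J_def pker_def)
  then have "\<one>\<^bsub>?S\<^esub> \<noteq> \<zero>\<^bsub>?S\<^esub>" unfolding q_one[OF Ji] q_zero[OF Ji] using q_eq_0_iff[OF Ji PR_1] by simp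
  then have sf: "subfield ?K ?S" unfolding Kim by (rule h.img_is_subfield(2)[OF range_const_subfield])
  then show "subfield ?K ?S" .
  obtain ms where ms: "set ms = M" "distinct ms" using finite_distinct_list[OF M(1)] by blast
  define U where "U m = (SOME u. u \<in> monomials N \<and> mdeg u = i \<and> mext g u = m)" for m
  have U: "U m \<in> monomials N \<and> mdeg (U m) = i \<and> mext g (U m) = m" if "m \<in> M" for m
  proof -
    have "\<exists>u. u \<in> monomials N \<and> mdeg u = i \<and> mext g u = m" using that M(2) by auto
    then show ?thesis unfolding U_def by (rule someI_ex)
  qed
  have zh: "zsum U cs ms \<in> homog N (int i)" for cs :: "'k list"
    using U ms(1) by (intro zsum_homog) auto
  have pz: "psub g (zsum U cs ms) = zsum (\<lambda>m. m) cs ms" for cs :: "'k list"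
    using U ms(1) by (intro psub_zsum) auto
  define Us where "Us = map (\<lambda>m. ?q (mpmon (U m))) ms"
  have Uc: "mpmon (U m) \<in> carrier (PR N :: 'k mpoly ring)" if "m \<in> M" for m using U[OF that] by (intro PR_mpmon) simp
  have Us_c: "set Us \<subseteq> carrier ?S"
    using q_closed[OF Ji Uc] ms(1) by (auto simp: Us_def)
  have comb: "h.S.combine (map (\<lambda>c. ?q (const c)) cs) (map (\<lambda>m. ?q (mpmon (U m))) ms') = ?q (zsum U cs ms')"
    if "set ms' \<subseteq> M" for cs ms'
    using that
  proof (induction ms' arbitrary: cs)
    case Nil
    then show ?case using q_zero[OF Ji] by simp
  next
    case (Cons m ms')
    show ?case
    proof (cases cs)
      case Nil
      then show ?thesis using q_zero[OF Ji] by simp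
    next
      case (Cons c cs')
      have mM: "m \<in> M" using Cons.prems by simp
      have c1: "const c * mpmon (U m) \<in> carrier (PR N)" by (intro PR_mult PR_const Uc mM)
      have c2: "zsum U cs' ms' \<in> carrier (PR N)"
        using Cons.prems U by (intro homog_carrier[OF zsum_homog[where j = "int i"]]) auto
      show ?thesis unfolding Cons list.map h.S.combine.simps zsum_simps single_eq_const_mult
        using Cons.IH[of cs'] Cons.prems q_mult[OF Ji PR_const Uc[OF mM], of c] q_add[OF Ji c1 c2] by simp
    qed
  qed
  have combU: "h.S.combine (map (\<lambda>c. ?q (const c)) cs) Us = ?q (zsum U cs ms)" for cs
    unfolding Us_def by (rule comb) (use ms(1) in simp)
  have Ks: "\<exists>cs. Ks = map (\<lambda>c. ?q (const c)) cs" if "set Ks \<subseteq> ?K" for Ks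
    using that
  proof (induction Ks)
    case (Cons k Ks)
    then obtain cs c where "Ks = map (\<lambda>c. ?q (const c)) cs" "k = ?q (const c)" by auto
    then show ?case by (intro exI[of _ "c # cs"]) simp
  qed simp
  have ind: "h.S.independent ?K Us"
  proof (rule h.S.trivial_combine_imp_independent[OF sf Us_c])
    fix Ks assume K: "set Ks \<subseteq> ?K" and z: "h.S.combine Ks Us = \<zero>\<^bsub>?S\<^esub>"
    obtain cs where cs: "Ks = map (\<lambda>c. ?q (const c)) cs" using Ks[OF K] by blast
    have "zsum U cs ms \<in> J"
      using z q_eq_0_iff[OF Ji homog_carrier[OF zh]] unfolding cs combU q_zero[OF Ji] by blast
    then have "zsum (\<lambda>m. m) cs ms = 0" using pz[of cs] by (simp add: J_def pker_def)
    then have c0: "c = 0" if "c \<in> set (take (length ms) cs)" for c using zsum_0[OF ms(2) _ that] by blast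
    show "set (take (length Us) Ks) \<subseteq> {\<zero>\<^bsub>?S\<^esub>}"
    proof
      fix X assume "X \<in> set (take (length Us) Ks)"
      then obtain c where "c \<in> set (take (length ms) cs)" "X = ?q (const c)"
        unfolding cs take_map by (auto simp: Us_def)
      moreover from this have "c = 0" by (intro c0)
      ultimately have "X = ?q 0" by (simp only: const_simps(1))
      then show "X \<in> {\<zero>\<^bsub>?S\<^esub>}" by (simp only: q_zero[OF Ji] singleton_iff)
    qed
  qed
  have span: "h.S.Span ?K Us = quot_comp N J (int i)"
  proof
    show "h.S.Span ?K Us \<subseteq> quot_comp N J (int i)"
    proof
      fix X assume "X \<in> h.S.Span ?K Us"
      then obtain Ks where K: "set Ks \<subseteq> ?K" "X = h.S.combine Ks Us"
        unfolding h.S.Span_eq_combine_set[OF sf Us_c] by blast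
      obtain cs where cs: "Ks = map (\<lambda>c. ?q (const c)) cs" using Ks[OF K(1)] by blast
      show "X \<in> quot_comp N J (int i)" unfolding K(2) cs combU quot_comp_def using zh by blast
    qed
    show "quot_comp N J (int i) \<subseteq> h.S.Span ?K Us"
    proof
      fix X assume "X \<in> quot_comp N J (int i)"
      then obtain p where p: "p \<in> homog N (int i)" "X = ?q p" unfolding quot_comp_def by blast
      define cs where "cs = map (lookup (psub g p)) ms"
      have keys: "keys (psub g p) \<subseteq> set ms"
      proof
        fix m assume "m \<in> keys (psub g p)"
        then obtain u where "u \<in> keys p" "m = mext g u" using keys_psub[of g p] by blast
        then show "m \<in> set ms" using p(1) ms(1) M(2) by (auto simp: homog_iff)
      qed
      have "zsum (\<lambda>m. m) cs ms = sum_list (map (\<lambda>m. single m (lookup (psub g p) m)) ms)"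
        unfolding cs_def by (rule zsum_map)
      also have "\<dots> = (\<Sum>m\<in>set ms. single m (lookup (psub g p) m))" using ms(2) by (rule sum_list_distinct_conv_sum_set)
      also have "\<dots> = (\<Sum>m\<in>keys (psub g p). single m (lookup (psub g p) m))"
        by (intro sum.mono_neutral_right keys) (auto simp: in_keys_iff)
      also have "\<dots> = psub g p" using mpoly_expand[of "psub g p"] by simp
      finally have "psub g (zsum U cs ms - p) = 0" using pz[of cs] by (simp add: psub_diff)
      then have "zsum U cs ms - p \<in> J"
        unfolding J_def pker_def using homog_carrier[OF zh] homog_carrier[OF p(1)] by (auto intro: PR_diff)
      then have "X = h.S.combine (map (\<lambda>c. ?q (const c)) cs) Us"
        unfolding combU p(2) using q_eq_iff[OF Ji homog_carrier[OF zh[of cs]] homog_carrier[OF p(1)]] by simp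
      then show "X \<in> h.S.Span ?K Us"
        unfolding h.S.Span_eq_combine_set[OF sf Us_c] by (intro CollectI exI[of _ "map (\<lambda>c. ?q (const c)) cs"]) auto
    qed
  qed
  have "length Us = card M" using ms by (simp add: Us_def distinct_card flip: ms(1))
  then show "h.S.dimension (card M) ?K (quot_comp N J (int i))"
    using h.S.dimensionI[OF sf ind span] by simp
qed

lemma hilbert_fun_pker:
  fixes g :: "nat \<Rightarrow> pp" and N :: nat
  defines "J \<equiv> pker N g :: 'k::field mpoly set"
  assumes g0: "\<And>v. v \<in> {1..N} \<Longrightarrow> g v \<noteq> 0"
    and M: "finite M" "M = mext g ` {u \<in> monomials N. mdeg u = i}"
  shows "hilbert_fun (PR N Quot J) ((\<lambda>c. J +>\<^bsub>PR N\<^esub> const c) ` UNIV) (\<lambda>i. quot_comp N J (int i)) i = card M"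
  unfolding hilbert_fun_def
proof (rule the_equality)
  note D = quot_comp_dimension[where N = N and g = g and 'k = 'k, OF g0 M, folded J_def]
  show "ring.dimension (PR N Quot J) (card M) ((\<lambda>c. J +>\<^bsub>PR N\<^esub> const c) ` UNIV) (quot_comp N J (int i))" by (rule D(1))
  fix r assume "ring.dimension (PR N Quot J) r ((\<lambda>c. J +>\<^bsub>PR N\<^esub> const c) ` UNIV) (quot_comp N J (int i))"
  moreover have "ring (PR N Quot J)" unfolding J_def by (rule ideal.quotient_is_ring[OF pker_ideal])
  ultimately show "r = card M" using ring.dimension_is_inj[OF _ D(2) _ D(1)] by blast
qed

text \<open>Exhibits the binomial coefficient, up to m!, as the value at i of a polynomial of degree
  m.\<close>

lemma prod_binomial: "(\<Prod>j=1..m. of_nat i + of_nat j) = (of_nat ((i + m) choose m) * fact m :: rat)"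
proof (induction m)
  case (Suc m)
  have "Suc m * (Suc (i + m) choose Suc m) = Suc (i + m) * (i + m choose m)" by (rule Suc_times_binomial)
  then have eq: "(of_nat (Suc m) :: rat) * of_nat (Suc (i + m) choose Suc m) = of_nat (Suc (i + m)) * of_nat (i + m choose m)"
    by (metis of_nat_mult)
  have "(\<Prod>j=1..Suc m. of_nat i + of_nat j :: rat) = (\<Prod>j=1..m. of_nat i + of_nat j) * of_nat (Suc (i + m))" by simp
  also have "\<dots> = fact m * (of_nat (Suc (i + m)) * of_nat (i + m choose m))" unfolding Suc by (simp only: mult_ac)
  also have "\<dots> = of_nat ((i + Suc m) choose Suc m) * fact (Suc m)"
    unfolding eq[symmetric] fact_Suc of_nat_mult by (simp only: mult_ac add_Suc_right)
  finally show ?case .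
qed simp

lemma lin_prod_degree: "Polynomial.degree (\<Prod>j=1..m. [:of_nat j, 1:] :: rat poly) = m"
  "Polynomial.coeff (\<Prod>j=1..m. [:of_nat j, 1:] :: rat poly) m = 1"
proof -
  have 1: "Polynomial.degree (\<Prod>j=1..m. [:of_nat j, 1:] :: rat poly) = m"
    by (subst degree_prod_eq_sum_degree) auto
  moreover have "lead_coeff (\<Prod>j=1..m. [:of_nat j, 1:] :: rat poly) = 1"
    by (subst lead_coeff_prod) simp
  ultimately show "Polynomial.degree (\<Prod>j=1..m. [:of_nat j, 1:] :: rat poly) = m"
    "Polynomial.coeff (\<Prod>j=1..m. [:of_nat j, 1:] :: rat poly) m = 1" by auto
qed

text \<open>Two polynomials that agree at all large integers have a difference with infinitely many
  roots, so the definite description is determined.\<close>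

lemma hilbert_poly_eqI:
  assumes "\<And>i. of_nat (hilbert_fun R k C i) = poly p (of_nat i)"
  shows "hilbert_poly R k C = p"
  unfolding hilbert_poly_def
proof (rule the_equality)
  show "\<forall>\<^sub>F i in sequentially. of_nat (hilbert_fun R k C i) = poly p (of_nat i)" using assms by simp
  fix p' :: "rat poly" assume "\<forall>\<^sub>F i in sequentially. of_nat (hilbert_fun R k C i) = poly p' (of_nat i)"
  then obtain i0 where "\<forall>i\<ge>i0. poly p (of_nat i) = poly p' (of_nat i)"
    unfolding assms eventually_sequentially by blast
  then have i0: "poly p' (of_nat i) = poly p (of_nat i)" if "i \<ge> i0" for i using that by simp
  show "p' = p"
  proof (rule ccontr)
    assume "p' \<noteq> p"
    then have "finite {x. poly (p' - p) x = 0}" by (intro poly_roots_finite) simp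
    moreover have "(of_nat :: nat \<Rightarrow> rat) ` {i0..} \<subseteq> {x. poly (p' - p) x = 0}" using i0 by auto
    ultimately have "finite ((of_nat :: nat \<Rightarrow> rat) ` {i0..})" by (rule finite_subset[rotated])
    then have "finite {i0..}" by (rule finite_imageD) (simp add: inj_on_def)
    then show False using infinite_Ici by blast
  qed
qed

section \<open>Counting monomials of the Rees algebra\<close>

definition degmons :: "nat \<Rightarrow> nat \<Rightarrow> pp set" where
  "degmons n i = {m \<in> monomials n. mdeg m = i}"

lemma degmons_sub_bmons: "degmons n i \<subseteq> bmons n i"
proof
  fix m assume m: "m \<in> degmons n i"
  have "lookup m v \<le> mdeg m" for v
    unfolding mdeg_def by (cases "v \<in> keys m") (auto simp: in_keys_iff intro: member_le_sum)
  then show "m \<in> bmons n i" using m by (auto simp: degmons_def bmons_def)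
qed

lemma finite_degmons [simp]: "finite (degmons n i)"
  using finite_subset[OF degmons_sub_bmons bmons_card(1)] .

lemma card_degmons: "card (degmons n i) = (i + n - 1) choose i"
proof -
  define f where "f m = map (lookup m) [1..<Suc n]" for m :: pp
  have "bij_betw f (degmons n i) {l. length l = n \<and> sum_list l = i}"
  proof (rule bij_betwI')
    fix x y assume xy: "x \<in> degmons n i" "y \<in> degmons n i"
    show "f x = f y \<longleftrightarrow> x = y"
    proof
      assume "f x = f y"
      then have eq: "lookup x v = lookup y v" if "v \<in> {1..n}" for v using that by (auto simp: f_def simp del: upt_Suc)
      show "x = y"
      proof (rule poly_mapping_eqI)
        fix v
        show "lookup x v = lookup y v"
        proof (cases "v \<in> {1..n}")
          case False
          then have "v \<notin> keys x" "v \<notin> keys y" using xy by (auto simp: degmons_def monomials_def)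
          then show ?thesis by (simp add: in_keys_iff)
        qed (rule eq)
      qed
    qed simp
  next
    fix x assume x: "x \<in> degmons n i"
    have "sum_list (f x) = (\<Sum>v=1..n. lookup x v)"
      unfolding f_def by (simp del: upt_Suc add: sum_list_distinct_conv_sum_set atLeastLessThanSuc_atLeastAtMost)
    then have "sum_list (f x) = i" using x mdeg_monomials[of x n] by (simp add: degmons_def)
    then show "f x \<in> {l. length l = n \<and> sum_list l = i}" by (simp add: f_def)
  next
    fix l :: "nat list" assume l: "l \<in> {l. length l = n \<and> sum_list l = i}"
    define x where "x = (\<Sum>v=1..n. single v (l ! (v - 1)))"
    have lx: "lookup x v = (if v \<in> {1..n} then l ! (v - 1) else 0)" for v
    proof -
      have "lookup x v = (\<Sum>w=1..n. if w = v then l ! (v - 1) else 0)"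
        unfolding x_def lookup_sum by (intro sum.cong) (auto simp: lookup_single_if)
      then show ?thesis by simp
    qed
    have xm: "x \<in> monomials n" by (auto simp: monomials_def in_keys_iff lx split: if_splits)
    have fx: "f x = l" using l by (intro nth_equalityI) (auto simp: f_def lx simp del: upt_Suc)
    have "mdeg x = sum_list (f x)"
      unfolding f_def mdeg_monomials[OF xm] by (simp del: upt_Suc add: sum_list_distinct_conv_sum_set atLeastLessThanSuc_atLeastAtMost)
    then have "x \<in> degmons n i" using xm l fx by (simp add: degmons_def)
    then show "\<exists>x\<in>degmons n i. l = f x" using fx by blast
  qed
  then have "card (degmons n i) = card {l :: nat list. length l = n \<and> sum_list l = i}" by (rule bij_betw_same_card)
  then show ?thesis by (simp add: card_length_sum_list)
qed

lemma lookup_mext: "lookup (mext g m) w = (\<Sum>v\<in>keys m. lookup m v * lookup (g v) w)"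
  by (simp add: mext_def lookup_sum)

lemma degmons_swap:
  assumes "a \<in> {1..n}" "b \<in> {1..n}"
  shows "(\<Sum>m\<in>degmons n i. lookup m a) = (\<Sum>m\<in>degmons n i. lookup m b)"
proof -
  define \<pi> where "\<pi> w = (if w = a then b else if w = b then a else w)" for w :: nat
  define f where "f = mext (\<lambda>w. single (\<pi> w) 1)"
  have \<pi>\<pi>: "\<pi> (\<pi> w) = w" for w by (auto simp: \<pi>_def)
  have ff: "f (f m) = m" for m
  proof -
    have "f (f m) = mext (\<lambda>w. single w 1) m" unfolding f_def mext_mext by (simp add: \<pi>\<pi>)
    then show ?thesis by (simp only: mext_id)
  qed
  have fd: "f m \<in> degmons n i" if "m \<in> degmons n i" for m
  proof -
    have "mdeg (mext (\<lambda>w. single (\<pi> w) 1) m) = mdeg m" by (induction m rule: pp_induct) (auto simp: mext_add)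
    moreover have "f m \<in> monomials n" unfolding f_def
      by (rule mext_monomials, rule monomials_single) (use that assms in \<open>auto simp: degmons_def monomials_def \<pi>_def subset_iff\<close>)
    ultimately show ?thesis using that by (simp add: degmons_def f_def)
  qed
  have fl: "lookup (f m) b = lookup m a" for m
  proof -
    have "lookup (f m) b = (\<Sum>v\<in>keys m. if v = a then lookup m a else 0)"
      unfolding f_def lookup_mext by (intro sum.cong) (auto simp: lookup_single_if \<pi>_def)
    then show ?thesis by (simp add: in_keys_iff)
  qed
  show ?thesis
    by (rule sum.reindex_bij_witness[of _ f f]) (auto simp: ff fd fl)
qed

text \<open>By symmetry all n variables have the same total exponent over the monomials of degree i,
  and together these totals count i for each monomial.\<close>

lemma degmons_sum_lookup:
  assumes "a \<in> {1..n}"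
  shows "n * (\<Sum>m\<in>degmons n i. lookup m a) = i * card (degmons n i)"
proof -
  have "n * (\<Sum>m\<in>degmons n i. lookup m a) = (\<Sum>b=1..n. \<Sum>m\<in>degmons n i. lookup m b)"
  proof -
    have "(\<Sum>b=1..n. \<Sum>m\<in>degmons n i. lookup m b) = (\<Sum>b=1..n. \<Sum>m\<in>degmons n i. lookup m a)"
      by (intro sum.cong refl degmons_swap assms)
    then show ?thesis by simp
  qed
  also have "\<dots> = (\<Sum>m\<in>degmons n i. \<Sum>b=1..n. lookup m b)" by (rule sum.swap)
  also have "\<dots> = (\<Sum>m\<in>degmons n i. i)" by (intro sum.cong) (auto simp: degmons_def mdeg_monomials)
  finally show ?thesis by simp
qed

context rees_stages
begin

definition Mi :: "nat \<Rightarrow> pp set" where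
  "Mi i = mext rg ` {u \<in> monomials (n + q). mdeg u = i}"

text \<open>The map \<open>rg\<close> is stage 1, where the inequality
  \<open>V 1 \<mu> \<le> 0\<close> bounds the exponent of t by the total exponent of the y
  variables.\<close>

lemma Mi_eq: "Mi i = (\<lambda>(\<alpha>, b). \<alpha> + single (n + 1) b) ` (SIGMA \<alpha>:degmons n i. {..\<Sum>k=1..q. lookup \<alpha> (s k)})"
proof -
  have rg_st: "mext rg u = mext (st 1) u" if "u \<in> monomials (n + q)" for u
    by (rule mext_cong, rule st_1[symmetric]) (use that in \<open>auto simp: monomials_def\<close>)
  have W1: "W 1 = monomials (n + 1)" by (simp add: W_def)
  have V1: "V 1 \<mu> \<le> 0 \<longleftrightarrow> lookup \<mu> (n + 1) \<le> (\<Sum>k=1..q. lookup \<mu> (s k))" for \<mu>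
  proof -
    have "(\<Sum>k=1..q. lookup \<mu> (s k)) = (\<Sum>k=1..q. lookup \<mu> (\<tau> k))" using \<tau>_s by (intro sum.cong) auto
    also have "\<dots> = lookup \<mu> (\<tau> 1) + (\<Sum>k=1 + 1..q. lookup \<mu> (\<tau> k))" using q1 by (subst sum.atLeast_Suc_atMost) auto
    finally have eq: "(\<Sum>k=1..q. lookup \<mu> (s k)) = lookup \<mu> (\<tau> 1) + (\<Sum>k=1 + 1..q. lookup \<mu> (\<tau> k))" .
    have m: "min 1 q = 1" using q1 by simp
    show ?thesis unfolding V_def eq m of_nat_sum[symmetric] of_nat_1 mult_1 by linarith
  qed
  have ls: "lookup (\<alpha> + single (n + 1) b) (s k) = lookup \<alpha> (s k)" if "k \<in> {1..q}" for \<alpha> k and b :: nat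
    using s_bounds[OF that] by (simp add: lookup_add lookup_single_if)
  \<comment> \<open>The degree in the variables of A. Each X and each T maps to a monomial of value
    1, so it recovers the degree of the source from the image.\<close>
  define xd where "xd \<mu> = (\<Sum>v=1..n. lookup \<mu> v)" for \<mu> :: pp
  have xd_add: "xd (a + b) = xd a + xd b" for a b by (simp add: xd_def lookup_add sum.distrib)
  have xd_single: "xd (single v a) = (if v \<in> {1..n} then a else 0)" for v a
    by (simp add: xd_def lookup_single_if)
  have xd_rg: "xd (mext rg u) = mdeg u" if "u \<in> monomials (n + q)" for u
    using that
  proof (induction u rule: pp_induct)
    case (add v m')
    then have v: "v \<in> {1..n + q}" and m': "m' \<in> monomials (n + q)" by (auto simp: monomials_def keys_plus_pp)
    have "xd (rg v) = 1"
      using v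
    proof (cases rule: var_cases)
      case (1 k)
      then show ?thesis using \<tau>_range[OF 1(1)] by (simp add: rg_X xd_single)
    next
      case (2 k)
      then show ?thesis using s_bounds[OF 2(1)] unfolding 2(2) rg_T[OF 2(1)] xd_add xd_single by auto
    qed
    then show ?case using add.IH[OF m'] by (simp add: mext_add xd_add)
  qed (simp add: xd_def)
  show ?thesis
  proof
    show "Mi i \<subseteq> (\<lambda>(\<alpha>, b). \<alpha> + single (n + 1) b) ` (SIGMA \<alpha>:degmons n i. {..\<Sum>k=1..q. lookup \<alpha> (s k)})"
    proof
      fix \<mu> assume "\<mu> \<in> Mi i"
      then obtain u where u: "u \<in> monomials (n + q)" "mdeg u = i" "\<mu> = mext rg u" by (auto simp: Mi_def)
      have \<mu>: "\<mu> \<in> monomials (n + 1)" "lookup \<mu> (n + 1) \<le> (\<Sum>k=1..q. lookup \<mu> (s k))" "xd \<mu> = i"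
        using image_st[OF u(1) order_refl n1] xd_rg[OF u(1)] u(2) unfolding u(3) rg_st[OF u(1)] W1 V1 by auto
      define b where "b = lookup \<mu> (n + 1)"
      define \<alpha> where "\<alpha> = \<mu> - single (n + 1) b"
      have dec: "\<mu> = \<alpha> + single (n + 1) b"
        unfolding \<alpha>_def b_def by (intro poly_mapping_eqI) (auto simp: lookup_add lookup_minus lookup_single_if)
      have a0: "n + 1 \<notin> keys \<alpha>" by (simp add: \<alpha>_def b_def lookup_minus in_keys_iff)
      have a1: "\<alpha> \<in> monomials (n + 1)" using \<mu>(1) unfolding dec by simp
      have am: "\<alpha> \<in> monomials n"
        unfolding monomials_def
      proof (rule CollectI, rule subsetI)
        fix v assume v: "v \<in> keys \<alpha>"
        then have "v \<in> {1..n + 1}" using a1 unfolding monomials_def by blast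
        moreover have "v \<noteq> n + 1" using v a0 by blast
        ultimately show "v \<in> {1..n}" by simp
      qed
      have "xd \<alpha> = i" using \<mu>(3) unfolding dec xd_add xd_single by simp
      then have "\<alpha> \<in> degmons n i" using am by (simp add: degmons_def mdeg_monomials xd_def)
      moreover have "(\<Sum>k=1..q. lookup \<mu> (s k)) = (\<Sum>k=1..q. lookup \<alpha> (s k))"
        unfolding dec by (intro sum.cong refl ls)
      moreover have "b \<le> (\<Sum>k=1..q. lookup \<mu> (s k))" using \<mu>(2) unfolding b_def .
      ultimately have "(\<alpha>, b) \<in> (SIGMA \<alpha>:degmons n i. {..\<Sum>k=1..q. lookup \<alpha> (s k)})" by simp
      then show "\<mu> \<in> (\<lambda>(\<alpha>, b). \<alpha> + single (n + 1) b) ` (SIGMA \<alpha>:degmons n i. {..\<Sum>k=1..q. lookup \<alpha> (s k)})"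
        by (rule rev_image_eqI) (simp only: prod.case dec[symmetric])
    qed
    show "(\<lambda>(\<alpha>, b). \<alpha> + single (n + 1) b) ` (SIGMA \<alpha>:degmons n i. {..\<Sum>k=1..q. lookup \<alpha> (s k)}) \<subseteq> Mi i"
    proof clarify
      fix \<alpha> b assume a: "\<alpha> \<in> degmons n i" and b: "b \<le> (\<Sum>k=1..q. lookup \<alpha> (s k))"
      define \<mu> where "\<mu> = \<alpha> + single (n + 1) b"
      have am: "\<alpha> \<in> monomials n" "mdeg \<alpha> = i" using a by (auto simp: degmons_def)
      then have "n + 1 \<notin> keys \<alpha>" by (auto simp: monomials_def)
      then have t: "lookup \<mu> (n + 1) = b" by (simp add: \<mu>_def lookup_add in_keys_iff)
      have \<mu>m: "\<mu> \<in> monomials (n + 1)"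
        using am(1) monomials_mono[of n "n + 1"] by (auto simp: \<mu>_def intro: monomials_single)
      have "(\<Sum>k=1..q. lookup \<mu> (s k)) = (\<Sum>k=1..q. lookup \<alpha> (s k))"
        unfolding \<mu>_def by (intro sum.cong refl ls)
      then have "V 1 \<mu> \<le> 0" unfolding V1 t using b by simp
      then obtain u where u: "u \<in> monomials (n + q)" "mext (st 1) u = \<mu>" using surj_st[of \<mu> 1] \<mu>m W1 n1 by auto
      have "mdeg u = xd \<mu>" using xd_rg[OF u(1)] u(2) rg_st[OF u(1)] by simp
      also have "\<dots> = i" using am by (simp add: \<mu>_def xd_add xd_single) (simp add: xd_def mdeg_monomials)
      finally have "mdeg u = i" .
      moreover have "\<mu> = mext rg u" using u(2) rg_st[OF u(1)] by simp
      ultimately show "\<alpha> + single (n + 1) b \<in> Mi i"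
        unfolding Mi_def \<mu>_def[symmetric] using u(1) by (intro image_eqI[of _ _ u]) simp_all
    qed
  qed
qed

text \<open>A monomial \<alpha> with y-degree c admits the c + 1 exponents 0, ..., c of t, and the
  mean of c over degree i is q i / n. The factor n keeps the identity within the natural
  numbers.\<close>

lemma card_Mi: "n * card (Mi i) = (n + q * i) * ((i + n - 1) choose i)" and finite_Mi: "finite (Mi i)"
proof -
  let ?D = "SIGMA \<alpha>:degmons n i. {..\<Sum>k=1..q. lookup \<alpha> (s k)}"
  have inj: "inj_on (\<lambda>(\<alpha>, b). \<alpha> + single (n + 1) b) ?D"
  proof (rule inj_onI, clarify)
    fix \<alpha> \<alpha>' and b b' :: nat assume a: "\<alpha> \<in> degmons n i" "\<alpha>' \<in> degmons n i"
      and eq: "\<alpha> + single (n + 1) b = \<alpha>' + single (n + 1) b'"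
    have "n + 1 \<notin> keys \<alpha>" "n + 1 \<notin> keys \<alpha>'" using a by (auto simp: degmons_def monomials_def)
    then have "b = b'" using arg_cong[OF eq, of "\<lambda>m. lookup m (n + 1)"] by (simp add: lookup_add in_keys_iff)
    then show "\<alpha> = \<alpha>' \<and> b = b'" using eq by simp
  qed
  have "finite ?D" by (intro finite_SigmaI) auto
  then show "finite (Mi i)" unfolding Mi_eq by (rule finite_imageI)
  have "card (Mi i) = card ?D" unfolding Mi_eq by (rule card_image[OF inj])
  also have "\<dots> = (\<Sum>\<alpha>\<in>degmons n i. Suc (\<Sum>k=1..q. lookup \<alpha> (s k)))" by (subst card_SigmaI) auto
  also have "\<dots> = card (degmons n i) + (\<Sum>k=1..q. \<Sum>\<alpha>\<in>degmons n i. lookup \<alpha> (s k))"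
    by (subst sum.swap) (simp add: sum_Suc)
  finally have "n * card (Mi i) = n * card (degmons n i) + (\<Sum>k=1..q. n * (\<Sum>\<alpha>\<in>degmons n i. lookup \<alpha> (s k)))"
    by (simp add: distrib_left sum_distrib_left)
  also have "(\<Sum>k=1..q. n * (\<Sum>\<alpha>\<in>degmons n i. lookup \<alpha> (s k))) = (\<Sum>k=1..q. i * card (degmons n i))"
    using s_bounds by (intro sum.cong refl degmons_sum_lookup) auto
  finally show "n * card (Mi i) = (n + q * i) * ((i + n - 1) choose i)"
    by (simp add: card_degmons algebra_simps)
qed

lemma multiplicity_pker: "quot_mult (n + q) (pker (n + q) rg :: 'k::field mpoly set) = of_nat q"
proof -
  let ?J = "pker (n + q) rg :: 'k mpoly set"
  let ?S = "PR (n + q) Quot ?J"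
  let ?K = "(\<lambda>c. ?J +>\<^bsub>PR (n + q)\<^esub> const c) ` UNIV"
  let ?C = "\<lambda>i. quot_comp (n + q) ?J (int i)"
  \<comment> \<open>The Hilbert function is (1 + q i / n) times the binomial coefficient of i + n -
    1 over n - 1. Its coefficient in degree n is q / n!, and the dimension n + 1 makes n! the
    normalising factor.\<close>
  define P :: "rat poly" where "P = Polynomial.smult (1 / fact (n - 1)) ([:1, of_nat q / of_nat n:] * (\<Prod>j=1..n - 1. [:of_nat j, 1:]))"
  have rg0: "rg v \<noteq> 0" if "v \<in> {1..n + q}" for v
    using st_nonzero[OF that, of 1] st_1[OF that] by simp
  have n0: "(of_nat n :: rat) \<noteq> 0" using n1 by simp
  have H: "of_nat (hilbert_fun ?S ?K ?C i) = poly P (of_nat i)" for i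
  proof -
    have h: "hilbert_fun ?S ?K ?C i = card (Mi i)"
      by (rule hilbert_fun_pker[OF rg0 finite_Mi Mi_def])
    have ch: "(i + n - 1) choose i = (i + (n - 1)) choose (n - 1)"
      using n1 by (subst binomial_symmetric) auto
    have "(of_nat n :: rat) * of_nat (card (Mi i)) = (of_nat n + of_nat q * of_nat i) * of_nat ((i + (n - 1)) choose (n - 1))"
      using card_Mi[of i] unfolding ch by (metis of_nat_add of_nat_mult)
    then have "(of_nat (card (Mi i)) :: rat) = (1 + of_nat q / of_nat n * of_nat i) * of_nat ((i + (n - 1)) choose (n - 1))"
      using n0 by (simp add: field_simps)
    also have "\<dots> = poly P (of_nat i)"
      using prod_binomial[of i "n - 1"]
      by (simp add: P_def poly_prod add.commute[of "of_nat i"] algebra_simps)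
    finally show ?thesis unfolding h .
  qed
  have hp: "hilbert_poly ?S ?K ?C = P" by (rule hilbert_poly_eqI) (rule H)
  have cf: "Polynomial.coeff P n = of_nat q / (of_nat n * fact (n - 1))"
  proof -
    define Q :: "rat poly" where "Q = (\<Prod>j=1..n - 1. [:of_nat j, 1:])"
    have dQ: "Polynomial.degree Q = n - 1" "Polynomial.coeff Q (n - 1) = 1"
      unfolding Q_def by (rule lin_prod_degree)+
    have "Polynomial.coeff Q n = 0" using dQ(1) n1 by (intro coeff_eq_0) simp
    moreover have "Polynomial.coeff ([:1, of_nat q / of_nat n:] * Q) n = Polynomial.coeff Q n + of_nat q / of_nat n * Polynomial.coeff Q (n - 1)"
      using n1 by (cases n) (simp_all add: mult_pCons_left)
    ultimately show ?thesis unfolding P_def Q_def[symmetric] using dQ(2) by simp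
  qed
  have D: "the_enat (krull_dim ?S) = n + 1" by (simp add: krull_pker[OF q1])
  have "(fact n :: rat) = of_nat n * fact (n - 1)" using n1 by (simp add: fact_reduce)
  then have "fact n * Polynomial.coeff P n = of_nat q"
    unfolding cf using n0 by simp
  then show ?thesis
    unfolding quot_mult_def multiplicity_def Let_def D hp by simp
qed

end

section \<open>Generators of universal squarefree lexsegment ideals\<close>

lemma Idl_mpmon:
  fixes M :: "pp set"
  assumes M: "M \<subseteq> monomials N"
  shows "Idl\<^bsub>PR N\<^esub> (mpmon ` M) =
    {p :: 'k::field mpoly. p \<in> carrier (PR N) \<and> (\<forall>k\<in>keys p. \<exists>m\<in>M. \<exists>c. k = m + c)}" (is "?I = ?R")
proof
  have sub: "mpmon ` M \<subseteq> carrier (PR N :: 'k mpoly ring)"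
    using M PR_mpmon by auto
  have id: "ideal ?I (PR N)" by (rule Idl_PR_ideal[OF sub])
  have "ideal ?R (PR N)"
    unfolding ideal_PR_iff
  proof (intro conjI ballI)
    show "a + b \<in> ?R" if "a \<in> ?R" "b \<in> ?R" for a b
      using that PR_add[of a N b] keys_add[of a b] by auto
    show "x * a \<in> ?R" if "a \<in> ?R" "x \<in> carrier (PR N)" for a x
    proof -
      have "\<exists>m\<in>M. \<exists>c. k = m + c" if k: "k \<in> keys (x * a)" for k
      proof -
        obtain b e where be: "k = b + e" "e \<in> keys a"
          using keys_mult[of x a] k by auto
        obtain m c where mc: "m \<in> M" "e = m + c"
          using \<open>a \<in> ?R\<close> be(2) by auto
        show ?thesis
          by (rule bexI[OF _ mc(1)], rule exI[of _ "b + c"]) (simp add: be(1) mc(2) add_ac)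
      qed
      then show ?thesis using that PR_mult[of x N a] by auto
    qed
  qed (auto intro: PR_0)
  moreover have "mpmon ` M \<subseteq> ?R"
  proof (rule image_subsetI)
    fix m assume m: "m \<in> M"
    have "m = m + 0" by simp
    then have "\<exists>m'\<in>M. \<exists>c. m = m' + c" using m by blast
    then show "mpmon m \<in> ?R" using m sub by auto
  qed
  ultimately show "?I \<subseteq> ?R" by (rule Idl_PR_minimal)
  show "?R \<subseteq> ?I"
  proof
    fix p assume p: "p \<in> ?R"
    have "single k (lookup p k) \<in> ?I" if k: "k \<in> keys p" for k
    proof -
      obtain m c where mc: "m \<in> M" "k = m + c" using p k by auto
      have "k \<in> monomials N" using p k by (auto simp: PR_carrier)
      then have c: "single c (lookup p k) \<in> carrier (PR N)"
        using mc by (intro PR_single) simp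
      have "mpmon m \<in> ?I" by (rule Idl_PR_self[OF sub]) (use mc in auto)
      from ideal_PR_mult[OF id this c] show ?thesis
        by (simp add: mpmon_def mult_single mc(2) add_ac)
    qed
    then have "(\<Sum>k\<in>keys p. single k (lookup p k)) \<in> ?I"
      by (rule ideal_PR_sum[OF id])
    then show "p \<in> ?I" using mpoly_expand[of p] by simp
  qed
qed

lemma mpmon_in_Idl:
  assumes "M \<subseteq> monomials N"
  shows "mpmon u \<in> Idl\<^bsub>PR N\<^esub> (mpmon ` M :: 'k::field mpoly set) \<longleftrightarrow>
    u \<in> monomials N \<and> (\<exists>m\<in>M. \<exists>c. u = m + c)"
  unfolding Idl_mpmon[OF assms] by (simp add: PR_carrier)

definition minimal_monomials :: "nat \<Rightarrow> 'k::field mpoly set \<Rightarrow> pp set" where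
  "minimal_monomials n I = {u \<in> monomials n. mpmon u \<in> I \<and> (\<forall>v c. u = v + c \<longrightarrow> mpmon v \<in> I \<longrightarrow> c = 0)}"

lemma minimal_monomials_subset:
  fixes I :: "'k::field mpoly set"
  assumes M: "M \<subseteq> monomials n" "I = Idl\<^bsub>PR n\<^esub> (mpmon ` M)"
  shows "minimal_monomials n I \<subseteq> M"
proof
  fix u assume u: "u \<in> minimal_monomials n I"
  then have "mpmon u \<in> I" by (simp add: minimal_monomials_def)
  then obtain m c where mc: "m \<in> M" "u = m + c"
    unfolding M(2) mpmon_in_Idl[OF M(1)] by auto
  have "m = m + 0" by simp
  then have "mpmon m \<in> I"
    unfolding M(2) mpmon_in_Idl[OF M(1)] using mc(1) M(1) by blast
  then have "c = 0" using u mc(2) by (simp add: minimal_monomials_def)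
  then show "u \<in> M" using mc by simp
qed

lemma minimal_monomials_divides:
  fixes I :: "'k::field mpoly set"
  assumes "u \<in> monomials n" "mpmon u \<in> I"
  shows "\<exists>m\<in>minimal_monomials n I. \<exists>c. u = m + c"
  using assms
proof (induction "mdeg u" arbitrary: u rule: less_induct)
  case less
  show ?case
  proof (cases "u \<in> minimal_monomials n I")
    case True
    have "u = u + 0" by simp
    then show ?thesis using True by blast
  next
    case False
    then obtain v c where vc: "u = v + c" "mpmon v \<in> I" "c \<noteq> 0"
      using less.prems by (auto simp: minimal_monomials_def)
    have "mdeg c > 0" using vc(3) mdeg_eq_0_iff[of c] by blast
    then have "mdeg v < mdeg u" by (simp only: vc(1) mdeg_add)
    moreover have "v \<in> monomials n" using less.prems(1) by (simp add: vc(1))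
    ultimately obtain m e where me: "m \<in> minimal_monomials n I" "v = m + e"
      using less.hyps vc(2) by blast
    have "u = m + (e + c)" by (simp add: vc(1) me(2) add_ac)
    then show ?thesis using me(1) by blast
  qed
qed

lemma Idl_minimal_monomials:
  fixes I :: "'k::field mpoly set"
  assumes M: "M \<subseteq> monomials n" "I = Idl\<^bsub>PR n\<^esub> (mpmon ` M)"
  shows "Idl\<^bsub>PR n\<^esub> (mpmon ` minimal_monomials n I) = I"
proof
  have D: "minimal_monomials n I \<subseteq> monomials n" by (auto simp: minimal_monomials_def)
  have Mc: "mpmon ` M \<subseteq> carrier (PR n :: 'k mpoly ring)" using M PR_mpmon by auto
  have sub: "mpmon ` M \<subseteq> I" unfolding M(2) using Idl_PR_self[OF Mc] by blast
  have id: "ideal I (PR n)" unfolding M(2) by (rule Idl_PR_ideal[OF Mc])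
  show "Idl\<^bsub>PR n\<^esub> (mpmon ` minimal_monomials n I) \<subseteq> I"
    by (rule Idl_PR_minimal[OF id]) (auto simp: minimal_monomials_def)
  have Did: "ideal (Idl\<^bsub>PR n\<^esub> (mpmon ` minimal_monomials n I)) (PR n :: 'k mpoly ring)"
    by (rule Idl_PR_ideal) (use D PR_mpmon in auto)
  have "Idl\<^bsub>PR n\<^esub> (mpmon ` M :: 'k mpoly set) \<subseteq> Idl\<^bsub>PR n\<^esub> (mpmon ` minimal_monomials n I)"
  proof (rule Idl_PR_minimal[OF Did], rule image_subsetI)
    fix m assume m: "m \<in> M"
    then have mn: "m \<in> monomials n" and mI: "mpmon m \<in> I" using M(1) sub by auto
    show "mpmon m \<in> Idl\<^bsub>PR n\<^esub> (mpmon ` minimal_monomials n I)"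
      unfolding mpmon_in_Idl[OF D] using minimal_monomials_divides[OF mn mI] mn by simp
  qed
  then show "I \<subseteq> Idl\<^bsub>PR n\<^esub> (mpmon ` minimal_monomials n I)"
    by (simp only: M(2)[symmetric])
qed

text \<open>Every monomial generating set contains the monomials of the ideal that are minimal for
  divisibility, and these already generate. They are therefore the only irredundant monomial
  generating set.\<close>

lemma min_gens_eq:
  fixes I :: "'k::field mpoly set"
  assumes M: "M \<subseteq> monomials n" "I = Idl\<^bsub>PR n\<^esub> (mpmon ` M)"
  shows "min_gens n I = minimal_monomials n I"
  unfolding min_gens_def
proof (rule the_equality)
  have D: "minimal_monomials n I \<subseteq> monomials n" by (auto simp: minimal_monomials_def)
  have "Idl\<^bsub>PR n\<^esub> (mpmon ` M') \<noteq> I" if "M' \<subset> minimal_monomials n I" for M'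
  proof
    assume "Idl\<^bsub>PR n\<^esub> (mpmon ` M') = I"
    then have "minimal_monomials n I \<subseteq> M'"
      using minimal_monomials_subset[of M' n I] that D by simp
    then show False using that by auto
  qed
  then show "minimal_monomials n I \<subseteq> monomials n \<and> Idl\<^bsub>PR n\<^esub> (mpmon ` minimal_monomials n I) = I \<and>
     (\<forall>M'. M' \<subset> minimal_monomials n I \<longrightarrow> Idl\<^bsub>PR n\<^esub> (mpmon ` M') \<noteq> I)"
    using D Idl_minimal_monomials[OF M] by simp
next
  fix M' assume M': "M' \<subseteq> monomials n \<and> Idl\<^bsub>PR n\<^esub> (mpmon ` M') = I \<and>
     (\<forall>M''. M'' \<subset> M' \<longrightarrow> Idl\<^bsub>PR n\<^esub> (mpmon ` M'') \<noteq> I)"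
  then have "minimal_monomials n I \<subseteq> M'" using minimal_monomials_subset[of M' n I] by simp
  moreover have "\<not> minimal_monomials n I \<subset> M'" using M' Idl_minimal_monomials[OF M] by auto
  ultimately show "M' = minimal_monomials n I" by auto
qed

lemma min_gens_sqfree:
  fixes I :: "'k::field mpoly set"
  assumes "sqfree_lexsegment n I"
  shows "min_gens n I \<subseteq> sqfree_monomials n" "Idl\<^bsub>PR n\<^esub> (mpmon ` min_gens n I) = I"
proof -
  obtain M where M: "M \<subseteq> sqfree_monomials n" "I = Idl\<^bsub>PR n\<^esub> (mpmon ` M)"
    using assms unfolding sqfree_lexsegment_def by blast
  have M': "M \<subseteq> monomials n" using M(1) by (auto simp: sqfree_monomials_def)
  show "min_gens n I \<subseteq> sqfree_monomials n"
    using minimal_monomials_subset[OF M' M(2)] M(1) unfolding min_gens_eq[OF M' M(2)] by simp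
  show "Idl\<^bsub>PR n\<^esub> (mpmon ` min_gens n I) = I"
    unfolding min_gens_eq[OF M' M(2)] by (rule Idl_minimal_monomials[OF M' M(2)])
qed

section \<open>Squarefree monomials and the shape of the generators\<close>

definition sqmon :: "nat set \<Rightarrow> pp" where
  "sqmon A = (\<Sum>i\<in>A. single i 1)"

lemma lookup_sqmon: "finite A \<Longrightarrow> lookup (sqmon A) v = (if v \<in> A then 1 else 0)"
  unfolding sqmon_def lookup_sum by (simp add: lookup_single when_def)

lemma keys_sqmon: "finite A \<Longrightarrow> keys (sqmon A) = A"
  by (auto simp: in_keys_iff lookup_sqmon split: if_splits)

lemma mdeg_sqmon: "mdeg (sqmon A) = card A"
  by (simp add: sqmon_def mdeg_sum)

lemma sqfree_eq_sqmon:
  assumes "u \<in> sqfree_monomials n"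
  shows "u = sqmon (keys u)"
proof (rule poly_mapping_eqI)
  fix v
  have "lookup u v \<le> 1" using assms by (simp add: sqfree_monomials_def)
  moreover have "lookup u v = 0" if "v \<notin> keys u" using that by (simp add: in_keys_iff)
  moreover have "lookup u v \<noteq> 0" if "v \<in> keys u" using that by (simp add: in_keys_iff)
  ultimately show "lookup u v = lookup (sqmon (keys u)) v"
    by (cases "v \<in> keys u") (auto simp: lookup_sqmon)
qed

lemma sqmon_sqfree: "A \<subseteq> {1..n} \<Longrightarrow> sqmon A \<in> sqfree_monomials n"
  using finite_subset[of A "{1..n}"]
  by (auto simp: sqfree_monomials_def monomials_def keys_sqmon lookup_sqmon)

lemma strict_sorted_nth_ge:
  fixes xs :: "nat list"
  assumes "sorted_wrt (<) xs" "\<And>x. x \<in> set xs \<Longrightarrow> 1 \<le> x"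
  shows "i < length xs \<Longrightarrow> Suc i \<le> xs ! i"
proof (induction i)
  case 0
  then show ?case using assms(2) nth_mem[of 0 xs] by auto
next
  case (Suc i)
  then have "xs ! i < xs ! Suc i" using sorted_wrt_nth_less[OF assms(1), of i "Suc i"] by simp
  then show ?case using Suc by simp
qed

text \<open>In the increasing list of \<open>A\<close>, counted from 0, entry s is at least s + 1.
  Some entry before position d - 1 differs from s + 1, since otherwise \<open>A\<close> would
  contain \<open>{1..<d}\<close>. At the first such position the entry of \<open>A\<close> is larger
  than the corresponding one of 1, ..., d - 1, N.\<close>

lemma slex_gt_initial:
  assumes A: "finite A" "card A = d" "d \<ge> 1" "\<And>x. x \<in> A \<Longrightarrow> 1 \<le> x" "\<not> {1..<d} \<subseteq> A"
    and N: "N \<ge> d"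
  shows "slex_gt (sqmon (insert N {1..<d})) (sqmon A)"
proof -
  define xs where "xs = sorted_list_of_set A"
  have xs: "sorted_wrt (<) xs" "set xs = A" "length xs = d"
    using A by (auto simp: xs_def)
  have ge: "Suc i \<le> xs ! i" if "i < d" for i
    using strict_sorted_nth_ge[OF xs(1), of i] that A xs by auto
  have ys: "sorted_list_of_set (insert N {1..<d}) = [1..<d] @ [N]"
  proof -
    have "set ([1..<d] @ [N]) = insert N {1..<d}" by auto
    moreover have "sorted ([1..<d] @ [N])" "distinct ([1..<d] @ [N])"
      using N by (auto simp: sorted_append)
    ultimately show ?thesis using sorted_list_of_set.idem_if_sorted_distinct by metis
  qed
  have "\<exists>s<d - 1. xs ! s \<noteq> Suc s"
  proof (rule ccontr)
    assume *: "\<not> (\<exists>s<d - 1. xs ! s \<noteq> Suc s)"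
    have "x \<in> A" if "x \<in> {1..<d}" for x
    proof -
      have "xs ! (x - 1) = x" using * that by (cases x) auto
      then show ?thesis using nth_mem[of "x - 1" xs] that xs by auto
    qed
    then show False using A(5) by auto
  qed
  then obtain s where s: "s < d - 1" "xs ! s \<noteq> Suc s" "\<And>t. t < s \<Longrightarrow> \<not> (t < d - 1 \<and> xs ! t \<noteq> Suc t)"
    using exists_least_iff[of "\<lambda>s. s < d - 1 \<and> xs ! s \<noteq> Suc s"] by blast
  have nth: "([1..<d] @ [N]) ! t = Suc t" if "t < d - 1" for t
    using that by (simp add: nth_append)
  show ?thesis
    unfolding slex_gt_def Let_def keys_sqmon[OF A(1)] keys_sqmon[OF finite.insertI[OF finite_atLeastLessThan]] ys
      xs_def[symmetric]
  proof (intro conjI exI[of _ s] allI impI)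
    show "length ([1..<d] @ [N]) = length xs" using xs A by simp
    show "s < length ([1..<d] @ [N])" using s by simp
    show "([1..<d] @ [N]) ! t = xs ! t" if "t < s" for t
      using that s nth[of t] by auto
    show "([1..<d] @ [N]) ! s < xs ! s"
      unfolding nth[OF s(1)] using ge[of s] s(1,2) by linarith
  qed
qed

lemma USLI_generators:
  fixes I :: "'k::field mpoly set"
  assumes U: "USLI n I" and g: "generated_in_degree n I d" and u: "u \<in> min_gens n I"
  shows "\<exists>j\<in>{1..n}. u = sqmon {1..<d} + single j 1"
proof -
  let ?G = "min_gens n I"
  have lex: "sqfree_lexsegment n I" and lex1: "sqfree_lexsegment (n + 1) (Idl\<^bsub>PR (n + 1)\<^esub> I)"
    using U unfolding USLI_def by auto
  note G = min_gens_sqfree[OF lex]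
  have Gm: "?G \<subseteq> monomials n" using G(1) by (auto simp: sqfree_monomials_def)
  then have Gm1: "?G \<subseteq> monomials (n + 1)" using monomials_mono[of n "n + 1"] by auto
  have d: "d \<ge> 1" and deg: "\<And>m. m \<in> ?G \<Longrightarrow> mdeg m = d"
    using g unfolding generated_in_degree_def by auto
  have us: "u = sqmon (keys u)" by (rule sqfree_eq_sqmon) (use u G(1) in auto)
  have card: "card (keys u) = d" using deg[OF u] mdeg_sqmon[of "keys u"] us by simp
  have keys: "keys u \<subseteq> {1..n}" using u Gm by (auto simp: monomials_def)
  then have dn: "d \<le> n" using card_mono[OF _ keys] card by simp
  have I1: "I \<subseteq> carrier (PR (n + 1))"
    using lex PR_carrier_mono[of n "n + 1"] unfolding sqfree_lexsegment_def by auto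
  have IG: "I \<subseteq> Idl\<^bsub>PR (n + 1)\<^esub> (mpmon ` ?G)"
    using PR_carrier_mono[of n "n + 1"] unfolding Idl_mpmon[OF Gm1]
    by (subst G(2)[symmetric], subst Idl_mpmon[OF Gm]) auto
  have J: "Idl\<^bsub>PR (n + 1)\<^esub> I \<subseteq> Idl\<^bsub>PR (n + 1)\<^esub> (mpmon ` ?G)"
    by (rule Idl_PR_minimal[OF Idl_PR_ideal IG]) (use Gm1 PR_mpmon in auto)
  have sub: "{1..<d} \<subseteq> keys u"
  proof (rule ccontr)
    assume *: "\<not> {1..<d} \<subseteq> keys u"
    \<comment> \<open>Among squarefree monomials of degree d this one involves the new variable but
      still precedes \<open>u\<close>, so the lexsegment property over one more variable puts it
      into the extended ideal.\<close>
    define v where "v = sqmon (insert (n + 1) {1..<d})"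
    have "slex_gt v (sqmon (keys u))"
      unfolding v_def by (rule slex_gt_initial[OF _ card d _ *]) (use keys dn in auto)
    then have gt: "slex_gt v u" by (simp only: us[symmetric])
    have v: "v \<in> sqfree_monomials (n + 1)"
      unfolding v_def by (rule sqmon_sqfree) (use dn in auto)
    have vd: "mdeg v = d" unfolding v_def mdeg_sqmon using dn d by simp
    have uI: "mpmon u \<in> Idl\<^bsub>PR (n + 1)\<^esub> I"
    proof (rule Idl_PR_self[OF I1])
      have "u = u + 0" by simp
      then show "mpmon u \<in> I"
        by (subst G(2)[symmetric], subst mpmon_in_Idl[OF Gm]) (use u Gm in blast)
    qed
    have us1: "u \<in> sqfree_monomials (n + 1)"
      by (subst us, rule sqmon_sqfree) (use keys in auto)
    have closed: "\<forall>u\<in>sqfree_monomials (n + 1). \<forall>v\<in>sqfree_monomials (n + 1).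
        mpmon u \<in> Idl\<^bsub>PR (n + 1)\<^esub> I \<and> mdeg u = mdeg v \<and> slex_gt v u \<longrightarrow> mpmon v \<in> Idl\<^bsub>PR (n + 1)\<^esub> I"
      using lex1 unfolding sqfree_lexsegment_def by (elim conjE)
    have "mdeg u = mdeg v" by (simp only: deg[OF u] vd)
    then have "mpmon v \<in> Idl\<^bsub>PR (n + 1)\<^esub> I"
      using closed[rule_format, OF us1 v] uI gt by blast
    from subsetD[OF J this] obtain m c where mc: "m \<in> ?G" "v = m + c"
      unfolding mpmon_in_Idl[OF Gm1] by blast
    \<comment> \<open>A generator dividing \<open>v\<close> has the same degree and so equals
      \<open>v\<close>; but generators do not involve the variable with index n + 1.\<close>
    have "mdeg c = 0" using deg[OF mc(1)] vd mc(2) by simp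
    then have "v = m" using mc(2) by simp
    then have "keys v \<subseteq> {1..n}" using mc(1) Gm by (auto simp: monomials_def)
    then show False unfolding v_def by (simp add: keys_sqmon)
  qed
  have "card (keys u - {1..<d}) = 1"
    using card_Diff_subset[OF _ sub] card d by simp
  then obtain j where j: "keys u - {1..<d} = {j}" by (rule card_1_singletonE)
  then have "keys u = insert j {1..<d}" "j \<notin> {1..<d}" using sub by auto
  then have "u = sqmon (insert j {1..<d})" "j \<notin> {1..<d}" using us by simp_all
  then have "u = sqmon {1..<d} + single j 1" by (simp add: sqmon_def add.commute)
  moreover have "j \<in> {1..n}" using j keys by auto
  ultimately show ?thesis by blast
qed

text \<open>The common factor \<open>a\<close> cancels from every syzygy, so the syzygies are those
  of the variables y_i. A syzygy c gives a form whose image under \<open>rg\<close> is t times the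
  sum of the c_i y_i, hence 0. Conversely the minors, which generate the kernel, come from the
  Koszul syzygies.\<close>

lemma (in rees) sym_ideal_eq_pker:
  fixes a :: pp
  shows "sym_ideal n q (\<lambda>i. mpmon (a + single (s i) 1)) = (pker (n + q) rg :: 'k::field mpoly set)"
proof -
  define F :: "'k mpoly set" where "F = {(\<Sum>i=1..q. c i * var (n + i)) | c.
        (\<forall>i\<in>{1..q}. c i \<in> carrier (PR n)) \<and> (\<Sum>i=1..q. c i * mpmon (a + single (s i) 1)) = 0}"
  have J: "sym_ideal n q (\<lambda>i. mpmon (a + single (s i) 1)) = Idl\<^bsub>PR (n + q)\<^esub> F"
    by (simp add: sym_ideal_def F_def)
  have syz: "(\<Sum>i=1..q. c i * mpmon (a + single (s i) 1)) = mpmon a * (\<Sum>i=1..q. c i * var (s i))"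
    for c :: "nat \<Rightarrow> 'k mpoly"
    unfolding sum_distrib_left by (intro sum.cong refl) (simp add: mpmon_add var_def mult_ac)
  have F: "F \<subseteq> pker (n + q) rg"
  proof
    fix p assume "p \<in> F"
    then obtain c where c: "p = (\<Sum>i=1..q. c i * var (n + i))" "\<And>i. i \<in> {1..q} \<Longrightarrow> c i \<in> carrier (PR n)"
        "(\<Sum>i=1..q. c i * var (s i)) = 0"
      unfolding F_def using syz by auto
    have "p \<in> carrier (PR (n + q))"
      unfolding c(1) by (intro PR_sum PR_mult PR_var PR_carrier_mono[OF _ c(2)]) auto
    moreover have "psub rg p = 0"
    proof -
      have id: "psub rg (c i) = c i" if "i \<in> {1..q}" for i
      proof (rule psub_id)
        fix m v assume "m \<in> keys (c i)" "v \<in> keys m"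
        then have "v \<le> n" using c(2)[OF that] by (fastforce simp: PR_carrier monomials_def)
        then show "rg v = single v 1" by (simp add: rg_def)
      qed
      have "psub rg p = (\<Sum>i=1..q. c i * (var (s i) * var (n + 1)))"
        unfolding c(1) psub_sum
        by (intro sum.cong refl) (simp add: psub_mult id rg_T mpmon_add, simp add: var_def)
      also have "\<dots> = (\<Sum>i=1..q. c i * var (s i)) * var (n + 1)"
        unfolding sum_distrib_right by (simp add: mult_ac)
      finally show ?thesis unfolding c(3) by simp
    qed
    ultimately show "p \<in> pker (n + q) rg" by (simp add: pker_def)
  qed
  then have Fc: "F \<subseteq> carrier (PR (n + q))" by (auto simp: pker_def)
  show ?thesis
    unfolding J
  proof
    show "Idl\<^bsub>PR (n + q)\<^esub> F \<subseteq> pker (n + q) rg" by (rule Idl_PR_minimal[OF pker_ideal F])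
    show "pker (n + q) rg \<subseteq> Idl\<^bsub>PR (n + q)\<^esub> F"
    proof (rule pker_rg_minimal[OF Idl_PR_ideal[OF Fc]])
      fix i j assume ij: "i \<in> {1..q}" "j \<in> {1..q}"
      show "minor i j \<in> Idl\<^bsub>PR (n + q)\<^esub> F"
      proof (cases "i = j")
        case True
        then show ?thesis
          using ideal_PR_0[OF Idl_PR_ideal[OF Fc]] by (simp add: minor_def)
      next
        case False
        \<comment> \<open>The Koszul syzygy of y_i and y_j: the coefficient y_i at position j and -
          y_j at position i.\<close>
        define c :: "nat \<Rightarrow> 'k mpoly" where
          "c k = (if k = j then var (s i) else 0) + (if k = i then - var (s j) else 0)" for k
        have sum: "(\<Sum>k=1..q. c k * x k) = var (s i) * x j - var (s j) * x i" for x :: "nat \<Rightarrow> 'k mpoly"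
        proof -
          have "(\<Sum>k=1..q. c k * x k) =
             (\<Sum>k=1..q. if k = j then var (s i) * x k else 0) + (\<Sum>k=1..q. if k = i then - var (s j) * x k else 0)"
            unfolding sum.distrib[symmetric] by (intro sum.cong refl) (auto simp: c_def distrib_right)
          then show ?thesis using ij by simp
        qed
        have "c k \<in> carrier (PR n)" for k
          unfolding c_def using s_bounds[OF ij(1)] s_bounds[OF ij(2)]
          by (intro PR_add) (auto intro!: PR_0 PR_uminus PR_var)
        moreover have "(\<Sum>k=1..q. c k * mpmon (a + single (s k) 1)) = 0"
          unfolding syz sum by (simp add: mult.commute)
        moreover have "minor i j = (\<Sum>k=1..q. c k * var (n + k))"
          unfolding sum by (simp add: minor_def)
        ultimately have "minor i j \<in> F" unfolding F_def by blast
        then show ?thesis by (rule Idl_PR_self[OF Fc])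
      qed
    qed
  qed
qed

theorem theorem3p9:
  fixes I J :: "'k::field mpoly set" and n d q :: nat and f :: "nat \<Rightarrow> pp"
  assumes "USLI n I"
    and "generated_in_degree n I d"
    and "bij_betw f {1..q} (min_gens n I)"
    and "J = sym_ideal n q (\<lambda>i. mpmon (f i))"
  shows "quot_dim (n + q) J = enat (n + 1) \<and>
         quot_mult (n + q) J = of_nat (card (min_gens n I)) \<and>
         (card (min_gens n I) \<ge> 2 \<longrightarrow> quot_reg (n + q) J = 1) \<and>
         quot_depth (n + q) J = enat (n + 1)"
proof -
  have card: "card (min_gens n I) = q" using bij_betw_same_card[OF assms(3)] by simp
  have "min_gens n I \<noteq> {}" using assms(2) by (simp add: generated_in_degree_def)
  then have q: "1 \<le> q" using assms(3) by (cases q) (auto simp: bij_betw_def)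
  have "\<forall>i\<in>{1..q}. \<exists>j\<in>{1..n}. f i = sqmon {1..<d} + single j 1"
    using USLI_generators[OF assms(1,2)] bij_betwE[OF assms(3)] by blast
  then obtain s where s: "\<And>i. i \<in> {1..q} \<Longrightarrow> s i \<in> {1..n} \<and> f i = sqmon {1..<d} + single (s i) 1"
    by metis
  have range: "s ` {1..q} \<subseteq> {1..n}" using s by blast
  have inj: "inj_on s {1..q}"
  proof (rule inj_onI)
    fix i j assume ij: "i \<in> {1..q}" "j \<in> {1..q}" "s i = s j"
    then have "f i = f j" using s by simp
    then show "i = j" using inj_onD[OF bij_betw_imp_inj_on[OF assms(3)]] ij(1,2) by blast
  qed
  \<comment> \<open>The stages run through all variables of A, those occurring as y_1, ..., y_q
    first.\<close>
  obtain \<tau> where \<tau>: "bij_betw \<tau> {1..n} {1..n}" "\<forall>k\<in>{1..q}. \<tau> k = s k"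
    using extend_to_permutation[OF inj range] by blast
  interpret rees n q s by unfold_locales (rule inj range)+
  interpret rees_stages n q s \<tau> by unfold_locales (use q \<tau> in auto)
  have "J = sym_ideal n q (\<lambda>i. mpmon (sqmon {1..<d} + single (s i) 1))"
  proof -
    have "(\<Sum>i=1..q. a i * mpmon (f i)) = (\<Sum>i=1..q. a i * mpmon (sqmon {1..<d} + single (s i) 1))"
      for a :: "nat \<Rightarrow> 'k mpoly"
      by (intro sum.cong refl) (use s in simp)
    then show ?thesis unfolding assms(4) sym_ideal_def by simp
  qed
  then have J: "J = pker (n + q) rg" by (simp only: sym_ideal_eq_pker)
  show ?thesis
    unfolding J card
  proof (intro conjI impI)
    show "quot_dim (n + q) (pker (n + q) rg :: 'k mpoly set) = enat (n + 1)"
      unfolding quot_dim_def by (rule krull_pker[OF q])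
    show "quot_mult (n + q) (pker (n + q) rg :: 'k mpoly set) = of_nat q"
      by (rule multiplicity_pker)
    show "quot_reg (n + q) (pker (n + q) rg :: 'k mpoly set) = 1" if "2 \<le> q"
      by (rule regularity_pker[OF that])
    show "quot_depth (n + q) (pker (n + q) rg :: 'k mpoly set) = enat (n + 1)"
      unfolding quot_depth_def by (rule depth_pker)
  qed
qed

end
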